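(* Let $\mathbb{F}$ be a field with $\operatorname{char}\mathbb{F}\neq2$ and let $q\in\mathbb{F}\setminus\{0\}$ be not a root of unity. Let $S_q=W_q$ be the coordinate ring of the quantum torus, that is, the skew Laurent polynomial ring $\mathbb{F}[y^{\pm1}][x^{\pm1};\alpha]$, where $\alpha$ is the $\mathbb{F}$-automorphism with $\alpha(y)=qy$, and let $\theta_q$ be the $\mathbb{F}$-automorphism of $S_q$ such that $\theta_q(x)=x^{-1}$ and $\theta_q(y)=y^{-1}$. Let $T_q$ be the $\mathbb{F}$-algebra generated by $x_1,x_2$ and $x_3$ subject to the relations \begin{align*} x_1x_2-qx_2x_1&=(1-q^2)x_3,\\ x_2x_3-qx_3x_2&=(q^{-1}-q)x_1,\\ x_3x_1-qx_1x_3&=(q^{-1}-q)x_2. \end{align*} (i) $T_q$ has a PBW basis $\{x_3^ix_2^jx_1^k: i,j,k\geq0\}$. (ii) $T_q$ has a filtration for which $\deg x_1=0$ and $\deg x_2=\deg x_3=1$ and the associated graded ring is an iterated skew polynomial ring over $\mathbb{F}$ generated by $y_1,y_2$ and $y_3$ subject to the relations $$y_1y_2-qy_2y_1=(1-q^2)y_3,\quad y_2y_3-qy_3y_2=0,\quad y_3y_1-qy_1y_3=(q^{-1}-q)y_2.$$ (iii) $T_q$ has a filtration for which $\deg x_1=\deg x_2=\deg x_3=1$ and the associated graded ring is an iterated skew polynomial ring over $\mathbb{F}$ generated by $y_1,y_2$ and $y_3$ subject to the relations $$y_1y_2=qy_2y_1,\quad y_2y_3=qy_3y_2,\quad y_3y_1=qy_1y_3.$$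 (iv) Let $p=x_3x_2x_1-qx_3^2-q^{-2}x_2^2-x_1^2+2(1+q^{-2})$. Then $p$ is a central element of $T_q$ and $T_q/pT_q$ is a domain. (v) The fixed ring $S_q^{\theta_q}$ is isomorphic to $T_q/pT_q$.
   Context: In the skew Laurent polynomial ring $R[x^{\pm1};\alpha]$ multiplication is determined by $xr=\alpha(r)x$ for $r\in R$; thus in $W_q$ one has $xy=qyx$. The filtrations in (ii) and (iii) are the standard filtrations for the indicated degrees of the generators: the $i$-th term ($i\geq0$) is the $\mathbb{F}$-subspace of $T_q$ spanned by all words in $x_1,x_2,x_3$ of total degree at most $i$, where each letter has the indicated degree. A PBW basis here means that the listed ordered monomials form an $\mathbb{F}$-basis. An iterated skew polynomial ring is built by successive extensions $R[z;\sigma,\delta]$ with $zr=\sigma(r)z+\delta(r)$, $\sigma$ an automorphism and $\delta$ a left $\sigma$-derivation of $R$. A domain is a not necessarily commutative nonzero ring without zero-divisors. $S_q^{\theta_q}$ is the subring of elements fixed by $\theta_q$; isomorphism is as $\mathbb{F}$-algebras. *)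

theory Defs
  imports "HOL-Library.Multiset" "HOL-Algebra.QuotRing" "HOL-Algebra.Module" "HOL-Algebra.Subrings"
begin

text \<open>
  Algebras over a field are records of type \<open>('a, 'b) module\<close>, where the type \<open>'a :: field\<close> is the
  base field. The library locale \<^locale>\<open>algebra\<close> is not used: it is restricted to commutative
  algebras.
\<close>

definition alg_iso ::
    "('a::field, 'b, 'm) module_scheme \<Rightarrow> ('a, 'c, 'n) module_scheme \<Rightarrow> ('b \<Rightarrow> 'c) set" where
  "alg_iso A B = {h \<in> ring_iso A B. \<forall>c. \<forall>a \<in> carrier A. h (c \<odot>\<^bsub>A\<^esub> a) = c \<odot>\<^bsub>B\<^esub> h a}"

definition lin_span :: "('a::field, 'b, 'm) module_scheme \<Rightarrow> 'b set \<Rightarrow> 'b set" where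
  "lin_span A S = {\<Oplus>\<^bsub>A\<^esub>s\<in>B. c s \<odot>\<^bsub>A\<^esub> s | c B. finite B \<and> B \<subseteq> S}"

definition lin_subspace :: "('a::field, 'b, 'm) module_scheme \<Rightarrow> 'b set \<Rightarrow> bool" where
  "lin_subspace A V \<longleftrightarrow> additive_subgroup V A \<and> (\<forall>c. \<forall>v\<in>V. c \<odot>\<^bsub>A\<^esub> v \<in> V)"

text \<open>An indexed family \<open>v\<close> is a basis if every element is a finite linear combination of the \<open>v i\<close>
  in exactly one way; in particular a basis has no repetitions.\<close>

definition is_basis :: "('a::field, 'b, 'm) module_scheme \<Rightarrow> ('i \<Rightarrow> 'b) \<Rightarrow> bool" where
  "is_basis A v \<longleftrightarrow> range v \<subseteq> carrier A \<and>
     (\<forall>a \<in> carrier A. \<exists>!c :: 'i \<Rightarrow> 'a. finite {i. c i \<noteq> 0} \<and> a = (\<Oplus>\<^bsub>A\<^esub>i\<in>{i. c i \<noteq> 0}. c i \<odot>\<^bsub>A\<^esub> v i))"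

definition nc_domain :: "('b, 'm) ring_scheme \<Rightarrow> bool" where
  "nc_domain R \<longleftrightarrow> ring R \<and> \<one>\<^bsub>R\<^esub> \<noteq> \<zero>\<^bsub>R\<^esub> \<and>
     (\<forall>a \<in> carrier R. \<forall>b \<in> carrier R. a \<otimes>\<^bsub>R\<^esub> b = \<zero>\<^bsub>R\<^esub> \<longrightarrow> a = \<zero>\<^bsub>R\<^esub> \<or> b = \<zero>\<^bsub>R\<^esub>)"

definition is_central :: "('b, 'm) ring_scheme \<Rightarrow> 'b \<Rightarrow> bool" where
  "is_central R z \<longleftrightarrow> z \<in> carrier R \<and> (\<forall>a \<in> carrier R. z \<otimes>\<^bsub>R\<^esub> a = a \<otimes>\<^bsub>R\<^esub> z)"

text \<open>The library quotient \<open>A Quot I\<close>, extended by the induced scalar multiplication.\<close>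

definition quot_alg ::
    "('a::field, 'b, 'm) module_scheme \<Rightarrow> 'b set \<Rightarrow> ('a, 'b set) module" where
  "quot_alg A I = ring.extend (A Quot I)
     (module.fields (\<lambda>c X. \<Union>x\<in>X. I +>\<^bsub>A\<^esub> (c \<odot>\<^bsub>A\<^esub> x)))"


section \<open>Presented algebras\<close>

text \<open>The free algebra has the words over \<open>'g\<close> as basis; its elements are the coefficient functions.\<close>

definition free_alg :: "('a::field, 'g list \<Rightarrow> 'a) module" where
  "free_alg = \<lparr>carrier = {f. finite {w. f w \<noteq> 0}},
     mult = (\<lambda>f g w. \<Sum>(u, v) \<in> {(u, v). u @ v = w}. f u * g v),
     one = (\<lambda>w. if w = [] then 1 else 0),
     zero = (\<lambda>w. 0),
     add = (\<lambda>f g w. f w + g w),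
     smult = (\<lambda>c f w. c * f w)\<rparr>"

definition free_gen :: "'g \<Rightarrow> 'g list \<Rightarrow> 'a::field" where
  "free_gen k = (\<lambda>w. if w = [k] then 1 else 0)"

definition presented_alg :: "('g list \<Rightarrow> 'a::field) set \<Rightarrow> ('a, ('g list \<Rightarrow> 'a) set) module" where
  "presented_alg rels = quot_alg free_alg (Idl\<^bsub>free_alg\<^esub> rels)"

definition presented_gen :: "('g list \<Rightarrow> 'a::field) set \<Rightarrow> 'g \<Rightarrow> ('g list \<Rightarrow> 'a) set" where
  "presented_gen rels k = Idl\<^bsub>free_alg\<^esub> rels +>\<^bsub>free_alg\<^esub> free_gen k"


section \<open>Iterated skew polynomial rings\<close>

definition left_skew_derivation ::
    "('b, 'm) ring_scheme \<Rightarrow> ('b \<Rightarrow> 'b) \<Rightarrow> ('b \<Rightarrow> 'b) \<Rightarrow> bool" where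
  "left_skew_derivation R \<sigma> \<delta> \<longleftrightarrow> \<delta> \<in> carrier R \<rightarrow> carrier R \<and>
     (\<forall>r \<in> carrier R. \<forall>s \<in> carrier R.
        \<delta> (r \<oplus>\<^bsub>R\<^esub> s) = \<delta> r \<oplus>\<^bsub>R\<^esub> \<delta> s \<and>
        \<delta> (r \<otimes>\<^bsub>R\<^esub> s) = \<sigma> r \<otimes>\<^bsub>R\<^esub> \<delta> s \<oplus>\<^bsub>R\<^esub> \<delta> r \<otimes>\<^bsub>R\<^esub> s)"

text \<open>The subring \<open>R'\<close> of \<open>A\<close> is the skew polynomial ring \<open>R[z; \<sigma>, \<delta>]\<close> for some automorphism \<open>\<sigma>\<close>
  and left \<open>\<sigma>\<close>-derivation \<open>\<delta>\<close> of the subring \<open>R\<close>, i.e. \<open>z r = \<sigma>(r) z + \<delta>(r)\<close> on \<open>R\<close> and \<open>R'\<close> is a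
  free left \<open>R\<close>-module with basis \<open>1, z, z\<^sup>2, \<dots>\<close>.\<close>

definition skew_poly_ext :: "('b, 'm) ring_scheme \<Rightarrow> 'b set \<Rightarrow> 'b \<Rightarrow> 'b set \<Rightarrow> bool" where
  "skew_poly_ext A R z R' \<longleftrightarrow>
     ring A \<and> subring R A \<and> subring R' A \<and> R \<subseteq> R' \<and> z \<in> R' \<and>
     (\<exists>\<sigma> \<delta>. \<sigma> \<in> ring_iso (A\<lparr>carrier := R\<rparr>) (A\<lparr>carrier := R\<rparr>) \<and>
        left_skew_derivation (A\<lparr>carrier := R\<rparr>) \<sigma> \<delta> \<and>
        (\<forall>r \<in> R. z \<otimes>\<^bsub>A\<^esub> r = \<sigma> r \<otimes>\<^bsub>A\<^esub> z \<oplus>\<^bsub>A\<^esub> \<delta> r)) \<and>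
     (\<forall>a \<in> R'. \<exists>!c :: nat \<Rightarrow> 'b. range c \<subseteq> R \<and> finite {i. c i \<noteq> \<zero>\<^bsub>A\<^esub>} \<and>
        a = (\<Oplus>\<^bsub>A\<^esub>i\<in>{i. c i \<noteq> \<zero>\<^bsub>A\<^esub>}. c i \<otimes>\<^bsub>A\<^esub> z [^]\<^bsub>A\<^esub> i))"

text \<open>\<open>iterated_skew_poly A zs R\<close>: the subring \<open>R\<close> of \<open>A\<close> is an iterated skew polynomial ring over
  the base field in the variables \<open>zs\<close>. The head of \<open>zs\<close> is the variable adjoined last.\<close>

inductive iterated_skew_poly ::
    "('a::field, 'b, 'm) module_scheme \<Rightarrow> 'b list \<Rightarrow> 'b set \<Rightarrow> bool" for A where
  base: "inj (\<lambda>c. c \<odot>\<^bsub>A\<^esub> \<one>\<^bsub>A\<^esub>) \<Longrightarrow> iterated_skew_poly A [] (range (\<lambda>c. c \<odot>\<^bsub>A\<^esub> \<one>\<^bsub>A\<^esub>))"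
| adjoin: "iterated_skew_poly A zs R \<Longrightarrow> skew_poly_ext A R z R' \<Longrightarrow> iterated_skew_poly A (z # zs) R'"


section \<open>Filtrations and associated graded rings\<close>

definition is_filtration ::
    "('a::field, 'b, 'm) module_scheme \<Rightarrow> (nat \<Rightarrow> 'b set) \<Rightarrow> bool" where
  "is_filtration A F \<longleftrightarrow> (\<forall>n. lin_subspace A (F n) \<and> F n \<subseteq> F (Suc n)) \<and>
     \<one>\<^bsub>A\<^esub> \<in> F 0 \<and> (\<forall>m n. \<forall>a \<in> F m. \<forall>b \<in> F n. a \<otimes>\<^bsub>A\<^esub> b \<in> F (m + n)) \<and>
     (\<Union>n. F n) = carrier A"

definition filt_deg :: "(nat \<Rightarrow> 'b set) \<Rightarrow> 'b \<Rightarrow> nat" where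
  "filt_deg F a = (LEAST n. a \<in> F n)"

definition eval_word :: "('b, 'm) ring_scheme \<Rightarrow> ('g \<Rightarrow> 'b) \<Rightarrow> 'g list \<Rightarrow> 'b" where
  "eval_word A x w = foldr (\<lambda>k a. x k \<otimes>\<^bsub>A\<^esub> a) w \<one>\<^bsub>A\<^esub>"

definition std_filtration ::
    "('a::field, 'b, 'm) module_scheme \<Rightarrow> ('g \<Rightarrow> 'b) \<Rightarrow> ('g \<Rightarrow> nat) \<Rightarrow> nat \<Rightarrow> 'b set" where
  "std_filtration A x d n = lin_span A {eval_word A x w | w. sum_list (map d w) \<le> n}"

text \<open>\<open>filt_pred A F n\<close> is \<open>F (n - 1)\<close>, with \<open>F (- 1) = 0\<close>.\<close>

definition filt_pred :: "('b, 'm) ring_scheme \<Rightarrow> (nat \<Rightarrow> 'b set) \<Rightarrow> nat \<Rightarrow> 'b set" where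
  "filt_pred A F n = (if n = 0 then {\<zero>\<^bsub>A\<^esub>} else F (n - 1))"

text \<open>An element of the direct sum of the quotients \<open>F n / F (n - 1)\<close> is the function mapping \<open>n\<close> to
  its component of degree \<open>n\<close>, a coset of \<open>F (n - 1)\<close>. As in the definition of \<^const>\<open>FactRing\<close>,
  products (and scalar multiples) are unions over all choices of representatives; for a filtration
  all choices give the same coset.\<close>

definition assoc_graded ::
    "('a::field, 'b, 'm) module_scheme \<Rightarrow> (nat \<Rightarrow> 'b set) \<Rightarrow> ('a, nat \<Rightarrow> 'b set) module" where
  "assoc_graded A F =
     \<lparr>carrier = {f. (\<forall>n. \<exists>a \<in> F n. f n = filt_pred A F n +>\<^bsub>A\<^esub> a) \<and>
                    finite {n. f n \<noteq> filt_pred A F n}},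
      mult = (\<lambda>f g n. \<Union>a \<in> {a. \<forall>i. a i \<in> f i}. \<Union>b \<in> {b. \<forall>i. b i \<in> g i}.
                filt_pred A F n +>\<^bsub>A\<^esub> (\<Oplus>\<^bsub>A\<^esub>i\<in>{..n}. a i \<otimes>\<^bsub>A\<^esub> b (n - i))),
      one = (\<lambda>n. if n = 0 then filt_pred A F n +>\<^bsub>A\<^esub> \<one>\<^bsub>A\<^esub> else filt_pred A F n),
      zero = filt_pred A F,
      add = (\<lambda>f g n. f n <+>\<^bsub>A\<^esub> g n),
      smult = (\<lambda>c f n. \<Union>a \<in> f n. filt_pred A F n +>\<^bsub>A\<^esub> (c \<odot>\<^bsub>A\<^esub> a))\<rparr>"

text \<open>The symbol of \<open>a\<close>, i.e. its leading component.\<close>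

definition graded_symbol :: "('b, 'm) ring_scheme \<Rightarrow> (nat \<Rightarrow> 'b set) \<Rightarrow> 'b \<Rightarrow> nat \<Rightarrow> 'b set" where
  "graded_symbol A F a = (\<lambda>n. if n = filt_deg F a then filt_pred A F n +>\<^bsub>A\<^esub> a else filt_pred A F n)"


section \<open>Skew Laurent polynomial rings\<close>

definition iterate_int :: "('b, 'm) ring_scheme \<Rightarrow> ('b \<Rightarrow> 'b) \<Rightarrow> int \<Rightarrow> 'b \<Rightarrow> 'b" where
  "iterate_int R \<alpha> i = (if 0 \<le> i then \<alpha> ^^ nat i else inv_into (carrier R) \<alpha> ^^ nat (- i))"

text \<open>\<open>f\<close> stands for the sum of the \<open>f i x\<^sup>i\<close>, so that \<open>x r = \<alpha>(r) x\<close> means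
  \<open>(r x\<^sup>i) (s x\<^sup>j) = r \<alpha>\<^sup>i(s) x\<^sup>i\<^sup>+\<^sup>j\<close>.\<close>

definition skew_laurent ::
    "('a::field, 'b, 'm) module_scheme \<Rightarrow> ('b \<Rightarrow> 'b) \<Rightarrow> ('a, int \<Rightarrow> 'b) module" where
  "skew_laurent R \<alpha> =
     \<lparr>carrier = {f. range f \<subseteq> carrier R \<and> finite {i. f i \<noteq> \<zero>\<^bsub>R\<^esub>}},
      mult = (\<lambda>f g n. \<Oplus>\<^bsub>R\<^esub>i\<in>{i. f i \<noteq> \<zero>\<^bsub>R\<^esub>}. f i \<otimes>\<^bsub>R\<^esub> iterate_int R \<alpha> i (g (n - i))),
      one = (\<lambda>n. if n = 0 then \<one>\<^bsub>R\<^esub> else \<zero>\<^bsub>R\<^esub>),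
      zero = (\<lambda>n. \<zero>\<^bsub>R\<^esub>),
      add = (\<lambda>f g n. f n \<oplus>\<^bsub>R\<^esub> g n),
      smult = (\<lambda>c f n. c \<odot>\<^bsub>R\<^esub> f n)\<rparr>"

definition laurent_const :: "('b, 'm) ring_scheme \<Rightarrow> 'b \<Rightarrow> int \<Rightarrow> 'b" where
  "laurent_const R r = (\<lambda>n. if n = 0 then r else \<zero>\<^bsub>R\<^esub>)"

definition laurent_var :: "('b, 'm) ring_scheme \<Rightarrow> int \<Rightarrow> 'b" where
  "laurent_var R = (\<lambda>n. if n = 1 then \<one>\<^bsub>R\<^esub> else \<zero>\<^bsub>R\<^esub>)"

definition base_field :: "('a::field, 'a) module" where
  "base_field = \<lparr>carrier = UNIV, mult = (*), one = 1, zero = 0, add = (+), smult = (*)\<rparr>"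

abbreviation laurent_poly :: "('a::field, int \<Rightarrow> 'a) module" where
  "laurent_poly \<equiv> skew_laurent base_field id"

definition fixed_subalg ::
    "('a::field, 'b, 'm) module_scheme \<Rightarrow> ('b \<Rightarrow> 'b) \<Rightarrow> ('a, 'b, 'm) module_scheme" where
  "fixed_subalg A \<theta> = A\<lparr>carrier := {a \<in> carrier A. \<theta> a = a}\<rparr>"


section \<open>The quantum torus and its quotient by the inversion\<close>

text \<open>\<open>\<alpha>\<close> is the automorphism of \<open>F[y\<^sup>\<plusminus>\<^sup>1]\<close> with \<open>\<alpha>(y) = q y\<close>; it is only determined on the carrier, and
  \<^term>\<open>skew_laurent laurent_poly \<alpha>\<close> depends on \<open>\<alpha>\<close> only through its values there.\<close>

definition torus_twist :: "'a::field \<Rightarrow> ((int \<Rightarrow> 'a) \<Rightarrow> (int \<Rightarrow> 'a)) \<Rightarrow> bool" where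
  "torus_twist q \<alpha> \<longleftrightarrow> \<alpha> \<in> alg_iso laurent_poly laurent_poly \<and>
     \<alpha> (laurent_var base_field) = q \<odot>\<^bsub>laurent_poly\<^esub> laurent_var base_field"

definition torus_x :: "int \<Rightarrow> int \<Rightarrow> 'a::field" where
  "torus_x = laurent_var laurent_poly"

definition torus_y :: "int \<Rightarrow> int \<Rightarrow> 'a::field" where
  "torus_y = laurent_const laurent_poly (laurent_var base_field)"

definition torus_inversion ::
    "('a::field, int \<Rightarrow> int \<Rightarrow> 'a) module \<Rightarrow> ((int \<Rightarrow> int \<Rightarrow> 'a) \<Rightarrow> (int \<Rightarrow> int \<Rightarrow> 'a)) \<Rightarrow> bool" where
  "torus_inversion S \<theta> \<longleftrightarrow> \<theta> \<in> alg_iso S S \<and>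
     \<theta> torus_x = inv\<^bsub>S\<^esub> torus_x \<and> \<theta> torus_y = inv\<^bsub>S\<^esub> torus_y"

datatype gen = X1 | X2 | X3

definition qcomm :: "('a::field, 'b, 'm) module_scheme \<Rightarrow> 'a \<Rightarrow> 'b \<Rightarrow> 'b \<Rightarrow> 'b" where
  "qcomm A q a b = (a \<otimes>\<^bsub>A\<^esub> b) \<ominus>\<^bsub>A\<^esub> (q \<odot>\<^bsub>A\<^esub> (b \<otimes>\<^bsub>A\<^esub> a))"

definition T_rels :: "'a::field \<Rightarrow> (gen list \<Rightarrow> 'a) set" where
  "T_rels q = (let K = free_alg; x1 = free_gen X1; x2 = free_gen X2; x3 = free_gen X3 in
     {qcomm K q x1 x2 \<ominus>\<^bsub>K\<^esub> ((1 - q^2) \<odot>\<^bsub>K\<^esub> x3),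
      qcomm K q x2 x3 \<ominus>\<^bsub>K\<^esub> ((inverse q - q) \<odot>\<^bsub>K\<^esub> x1),
      qcomm K q x3 x1 \<ominus>\<^bsub>K\<^esub> ((inverse q - q) \<odot>\<^bsub>K\<^esub> x2)})"

definition gr_rels_ii :: "'a::field \<Rightarrow> (gen list \<Rightarrow> 'a) set" where
  "gr_rels_ii q = (let K = free_alg; y1 = free_gen X1; y2 = free_gen X2; y3 = free_gen X3 in
     {qcomm K q y1 y2 \<ominus>\<^bsub>K\<^esub> ((1 - q^2) \<odot>\<^bsub>K\<^esub> y3),
      qcomm K q y2 y3,
      qcomm K q y3 y1 \<ominus>\<^bsub>K\<^esub> ((inverse q - q) \<odot>\<^bsub>K\<^esub> y2)})"

definition gr_rels_iii :: "'a::field \<Rightarrow> (gen list \<Rightarrow> 'a) set" where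
  "gr_rels_iii q = (let K = free_alg; y1 = free_gen X1; y2 = free_gen X2; y3 = free_gen X3 in
     {qcomm K q y1 y2, qcomm K q y2 y3, qcomm K q y3 y1})"

definition T_alg :: "'a::field \<Rightarrow> ('a, (gen list \<Rightarrow> 'a) set) module" where
  "T_alg q = presented_alg (T_rels q)"

definition T_gen :: "'a::field \<Rightarrow> gen \<Rightarrow> (gen list \<Rightarrow> 'a) set" where
  "T_gen q = presented_gen (T_rels q)"

definition T_p :: "'a::field \<Rightarrow> (gen list \<Rightarrow> 'a) set" where
  "T_p q = (let T = T_alg q; x1 = T_gen q X1; x2 = T_gen q X2; x3 = T_gen q X3 in
     (x3 \<otimes>\<^bsub>T\<^esub> x2 \<otimes>\<^bsub>T\<^esub> x1)
       \<ominus>\<^bsub>T\<^esub> (q \<odot>\<^bsub>T\<^esub> (x3 [^]\<^bsub>T\<^esub> (2::nat)))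
       \<ominus>\<^bsub>T\<^esub> (inverse (q^2) \<odot>\<^bsub>T\<^esub> (x2 [^]\<^bsub>T\<^esub> (2::nat)))
       \<ominus>\<^bsub>T\<^esub> (x1 [^]\<^bsub>T\<^esub> (2::nat))
       \<oplus>\<^bsub>T\<^esub> ((2 * (1 + inverse (q^2))) \<odot>\<^bsub>T\<^esub> \<one>\<^bsub>T\<^esub>))"

definition T_mod_p :: "'a::field \<Rightarrow> ('a, (gen list \<Rightarrow> 'a) set set) module" where
  "T_mod_p q = quot_alg (T_alg q) {T_p q \<otimes>\<^bsub>T_alg q\<^esub> t | t. t \<in> carrier (T_alg q)}"

text \<open>The associated graded ring of \<open>T_alg q\<close> for the standard filtration with generator degrees \<open>d\<close>
  is an iterated skew polynomial ring over the base field in the symbols of the generators, adjoined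
  in some order, and is presented by these symbols and the relations \<open>rels\<close>.\<close>

definition T_graded_claim :: "'a::field \<Rightarrow> (gen \<Rightarrow> nat) \<Rightarrow> (gen list \<Rightarrow> 'a) set \<Rightarrow> bool" where
  "T_graded_claim q d rels \<longleftrightarrow>
     (let F = std_filtration (T_alg q) (T_gen q) d;
          G = assoc_graded (T_alg q) F;
          y = (\<lambda>k. graded_symbol (T_alg q) F (T_gen q k))
      in is_filtration (T_alg q) F \<and>
         (\<forall>k. filt_deg F (T_gen q k) = d k) \<and>
         (\<exists>zs. mset zs = {#y X1, y X2, y X3#} \<and> iterated_skew_poly G zs (carrier G)) \<and>
         (\<exists>\<phi> \<in> alg_iso (presented_alg rels) G. \<forall>k. \<phi> (presented_gen rels k) = y k))"

end

theory Submission
  imports Defs "HOL-Library.Poly_Mapping"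
begin

text \<open>
  Write the relations as \<open>x\<^sub>1 x\<^sub>2 - q x\<^sub>2 x\<^sub>1 = A x\<^sub>3\<close>, \<open>x\<^sub>2 x\<^sub>3 - q x\<^sub>3 x\<^sub>2 = B x\<^sub>1\<close>, \<open>x\<^sub>3 x\<^sub>1 - q x\<^sub>1 x\<^sub>3 = C x\<^sub>2\<close>; the
  single overlap \<open>x\<^sub>1 x\<^sub>2 x\<^sub>3\<close> resolves for all values of \<open>A, B, C\<close>, so the words \<open>x\<^sub>3\<^sup>i x\<^sub>2\<^sup>j x\<^sub>1\<^sup>k\<close> always form a
  basis, and the algebra is the space of finitely supported functions on \<open>\<nat>\<^sup>3\<close> with a twisted product.
  Passing to a graded algebra only replaces those of \<open>A, B, C\<close> that lower the degree by \<open>0\<close>. When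
  \<open>B = 0\<close>, adjoining \<open>x\<^sub>3\<close>, \<open>x\<^sub>2\<close>, \<open>x\<^sub>1\<close> in this order gives an iterated skew polynomial ring.

  The map \<open>x\<^sub>1 \<mapsto> x + x\<^sup>-\<^sup>1\<close>, \<open>x\<^sub>2 \<mapsto> y + y\<^sup>-\<^sup>1\<close>, \<open>x\<^sub>3 \<mapsto> q\<^sup>-\<^sup>1 (y\<^sup>-\<^sup>1 x + y x\<^sup>-\<^sup>1)\<close> sends \<open>T\<close> to the fixed ring and
  kills \<open>p\<close>. Modulo \<open>p\<close> the words with \<open>i j k = 0\<close> span, and their leading terms run exactly once
  through the monomials \<open>y\<^sup>a x\<^sup>b\<close> up to inversion; hence the map is onto with kernel \<open>p T\<close>, and \<open>T/pT\<close>
  is a domain because the quantum torus is one.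
\<close>

section \<open>Linear maps on finitely supported functions\<close>

text \<open>Rewriting alone shows that the normal words span; their linear independence is the
  obstacle. It is obtained without a confluence theorem: left multiplication by each generator is
  defined outright as an operator on the vector space of normal words, and the defining relations
  are checked as operator identities. Elements of the ideal then act as zero, and applying an
  element of the free algebra to the empty word reads off its normal form. One space serves all
  values of \<open>A\<close>, \<open>B\<close>, \<open>C\<close>, so T and its graded algebras can
  be compared coefficient by coefficient. Since the carriers in the statement are sets of functions
  or of cosets, each algebra is modelled on a full type of finitely supported functions, where
  linear maps are determined by basis vectors, and results are carried over along isomorphisms. The
  image of x3 is forced by the first relation: (x + x^-1)(y + y^-1) - q (y + y^-1)(x + x^-1) = (q^-1
  - q)(y^-1 x + y x^-1), and q^-1 - q = q^-1 (1 - q^2).\<close>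

abbreviation coeff :: "('b \<Rightarrow>\<^sub>0 'a::zero) \<Rightarrow> 'b \<Rightarrow> 'a" where
  "coeff \<equiv> Poly_Mapping.lookup"

abbreviation keys :: "('b \<Rightarrow>\<^sub>0 'a::zero) \<Rightarrow> 'b set" where
  "keys \<equiv> Poly_Mapping.keys"

definition smul :: "'a::field \<Rightarrow> ('b \<Rightarrow>\<^sub>0 'a) \<Rightarrow> ('b \<Rightarrow>\<^sub>0 'a)" (infixr "\<bullet>" 75) where
  "c \<bullet> u = Poly_Mapping.map ((*) c) u"

abbreviation e :: "'b \<Rightarrow> ('b \<Rightarrow>\<^sub>0 'a::field)" where
  "e m \<equiv> Poly_Mapping.single m 1"

lemma coeff_smul [simp]: "coeff (c \<bullet> u) m = c * coeff u m"
  by (simp add: smul_def Poly_Mapping.map.rep_eq when_def)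

lemma coeff_e: "coeff (e m) n = (if n = m then 1 else 0)"
  by (simp add: lookup_single when_def)

lemmas coeff_simps = lookup_add lookup_minus coeff_e

lemma smul_simps [simp]:
  "c \<bullet> (u + v) = c \<bullet> u + c \<bullet> v"
  "c \<bullet> (u - v) = c \<bullet> u - c \<bullet> v"
  "c \<bullet> (- u) = - (c \<bullet> u)"
  "c \<bullet> d \<bullet> u = (c * d) \<bullet> u"
  "c \<bullet> 0 = 0" "0 \<bullet> u = 0" "1 \<bullet> u = u"
  by (rule poly_mapping_eqI; simp add: lookup_add lookup_minus algebra_simps)+

lemma smul_add_left: "(c + d) \<bullet> u = c \<bullet> u + d \<bullet> u"
  by (rule poly_mapping_eqI; simp add: lookup_add algebra_simps)

lemma smul_diff_left: "(c - d) \<bullet> u = c \<bullet> u - d \<bullet> u"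
  by (rule poly_mapping_eqI; simp add: lookup_minus algebra_simps)

lemma smul_sum: "c \<bullet> (\<Sum>i\<in>I. u i) = (\<Sum>i\<in>I. c \<bullet> u i)"
  by (induction I rule: infinite_finite_induct) auto

lemma keys_smul: "keys (c \<bullet> u) \<subseteq> keys u"
  by (auto simp: in_keys_iff)

definition is_lin :: "(('b \<Rightarrow>\<^sub>0 'a::field) \<Rightarrow> ('c \<Rightarrow>\<^sub>0 'a)) \<Rightarrow> bool" where
  "is_lin f \<longleftrightarrow> (\<forall>u v. f (u + v) = f u + f v) \<and> (\<forall>c u. f (c \<bullet> u) = c \<bullet> f u)"

lemma is_linI: "(\<And>u v. f (u + v) = f u + f v) \<Longrightarrow> (\<And>c u. f (c \<bullet> u) = c \<bullet> f u) \<Longrightarrow> is_lin f"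
  by (simp add: is_lin_def)

lemma is_linD:
  assumes "is_lin f"
  shows "f (u + v) = f u + f v" "f (c \<bullet> u) = c \<bullet> f u" "f 0 = 0" "f (- u) = - f u"
    "f (u - v) = f u - f v"
proof -
  show add: "f (u + v) = f u + f v" for u v
    using assms by (auto simp: is_lin_def)
  show sm: "f (c \<bullet> u) = c \<bullet> f u" for c u
    using assms by (auto simp: is_lin_def)
  show 0: "f 0 = 0" using sm[of 0 0] by simp
  show neg: "f (- u) = - f u" for u using add[of u "- u"] 0 by (simp add: eq_neg_iff_add_eq_0 add.commute)
  show "f (u - v) = f u - f v" using add[of u "- v"] neg by simp
qed

lemma is_lin_sum: "is_lin f \<Longrightarrow> f (\<Sum>i\<in>I. u i) = (\<Sum>i\<in>I. f (u i))"
  by (induction I rule: infinite_finite_induct) (auto simp: is_linD)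

definition lin :: "('b \<Rightarrow> ('c \<Rightarrow>\<^sub>0 'a::field)) \<Rightarrow> ('b \<Rightarrow>\<^sub>0 'a) \<Rightarrow> ('c \<Rightarrow>\<^sub>0 'a)" where
  "lin \<phi> u = (\<Sum>m\<in>keys u. coeff u m \<bullet> \<phi> m)"

lemma lin_superset: "finite S \<Longrightarrow> keys u \<subseteq> S \<Longrightarrow> lin \<phi> u = (\<Sum>m\<in>S. coeff u m \<bullet> \<phi> m)"
  unfolding lin_def by (rule sum.mono_neutral_left) (auto simp: in_keys_iff)

lemma is_lin_lin [simp]: "is_lin (lin \<phi>)"
proof (rule is_linI)
  fix u v :: "'a \<Rightarrow>\<^sub>0 'b" and c
  let ?S = "keys u \<union> keys v"
  have "lin \<phi> (u + v) = (\<Sum>m\<in>?S. coeff (u + v) m \<bullet> \<phi> m)"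
    by (rule lin_superset) (use Poly_Mapping.keys_add[of u v] in auto)
  also have "\<dots> = lin \<phi> u + lin \<phi> v"
    by (simp add: lin_superset[of ?S] lookup_add smul_add_left sum.distrib)
  finally show "lin \<phi> (u + v) = lin \<phi> u + lin \<phi> v" .
  have "lin \<phi> (c \<bullet> u) = (\<Sum>m\<in>keys u. coeff (c \<bullet> u) m \<bullet> \<phi> m)"
    by (rule lin_superset) (use keys_smul[of c u] in auto)
  then show "lin \<phi> (c \<bullet> u) = c \<bullet> lin \<phi> u"
    by (simp add: lin_def smul_sum)
qed

lemmas lin_simps [simp] = is_linD[OF is_lin_lin]

lemma lin_e [simp]: "lin \<phi> (e m) = \<phi> m"
  by (simp add: lin_def)

lemma lin_cong: "(\<And>m. m \<in> keys u \<Longrightarrow> \<phi> m = \<psi> m) \<Longrightarrow> lin \<phi> u = lin \<psi> u"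
  unfolding lin_def by (rule sum.cong) auto

lemma lin_expand: "lin e u = u"
proof (rule poly_mapping_eqI)
  fix m
  have "coeff (lin e u) m = (\<Sum>k\<in>keys u. coeff u k * coeff (e k) m)"
    by (simp add: lin_def lookup_sum)
  also have "\<dots> = (\<Sum>k\<in>keys u. if k = m then coeff u m else 0)"
    by (rule sum.cong) (auto simp: coeff_e)
  also have "\<dots> = coeff u m" by (simp add: in_keys_iff)
  finally show "coeff (lin e u) m = coeff u m" .
qed

lemma is_lin_eq_lin: "is_lin f \<Longrightarrow> f u = lin (\<lambda>m. f (e m)) u"
  by (subst lin_expand[symmetric]) (simp add: lin_def is_lin_sum is_linD)

text \<open>Agreement is required only on the support of \<open>u\<close>, so maps whose values are
  known on part of the basis can still be compared.\<close>

lemma is_lin_eq_onI: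
  "is_lin f \<Longrightarrow> is_lin g \<Longrightarrow> (\<And>m. m \<in> keys u \<Longrightarrow> f (e m) = g (e m)) \<Longrightarrow> f u = g u"
  by (subst is_lin_eq_lin[of f u], assumption, subst is_lin_eq_lin[of g u]) (auto intro: lin_cong)

lemma is_lin_ext:
  "is_lin f \<Longrightarrow> is_lin g \<Longrightarrow> (\<And>m. f (e m) = g (e m)) \<Longrightarrow> f u = g u"
  by (rule is_lin_eq_onI)

lemma is_lin_id: "is_lin (\<lambda>u. u)"
  by (simp add: is_lin_def)

lemma is_lin_comp: "is_lin f \<Longrightarrow> is_lin g \<Longrightarrow> is_lin (\<lambda>u. f (g u))"
  by (simp add: is_lin_def)

text \<open>Linearity in the parameter of a linear extension is what makes \<open>tw\<close> and
  \<open>Act\<close> linear in both arguments.\<close>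

lemma is_lin_lin_param:
  assumes "\<And>m. is_lin (\<lambda>v. \<phi> m v)"
  shows "is_lin (\<lambda>v. lin (\<lambda>m. \<phi> m v) u)"
  unfolding lin_def is_lin_def using assms
  by (simp add: is_linD sum.distrib smul_sum mult.commute)

section \<open>Subspaces, in particular those spanned by basis vectors\<close>

definition subspc :: "('b \<Rightarrow>\<^sub>0 'a::field) set \<Rightarrow> bool" where
  "subspc W \<longleftrightarrow> 0 \<in> W \<and> (\<forall>u\<in>W. \<forall>v\<in>W. u + v \<in> W) \<and> (\<forall>c. \<forall>u\<in>W. c \<bullet> u \<in> W)"

lemma subspcD:
  assumes "subspc W"
  shows "0 \<in> W" "u \<in> W \<Longrightarrow> v \<in> W \<Longrightarrow> u + v \<in> W" "u \<in> W \<Longrightarrow> c \<bullet> u \<in> W"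
    "u \<in> W \<Longrightarrow> - u \<in> W" "u \<in> W \<Longrightarrow> v \<in> W \<Longrightarrow> u - v \<in> W"
proof -
  show add: "0 \<in> W" "u \<in> W \<Longrightarrow> v \<in> W \<Longrightarrow> u + v \<in> W" "u \<in> W \<Longrightarrow> c \<bullet> u \<in> W" for u v c
    using assms by (auto simp: subspc_def)
  have "(-1) \<bullet> u = - u" for u :: "'a \<Rightarrow>\<^sub>0 'b" by (rule poly_mapping_eqI) simp
  then show neg: "u \<in> W \<Longrightarrow> - u \<in> W" for u using add(3)[of u "-1"] by simp
  show "u \<in> W \<Longrightarrow> v \<in> W \<Longrightarrow> u - v \<in> W" using add(2)[of u "- v"] neg by simp
qed

lemma subspc_sum: "subspc W \<Longrightarrow> (\<And>i. i \<in> I \<Longrightarrow> u i \<in> W) \<Longrightarrow> (\<Sum>i\<in>I. u i) \<in> W"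
  by (induction I rule: infinite_finite_induct) (auto simp: subspcD)

lemma subspc_lin: "subspc W \<Longrightarrow> (\<And>m. m \<in> keys u \<Longrightarrow> \<phi> m \<in> W) \<Longrightarrow> lin \<phi> u \<in> W"
  unfolding lin_def by (intro subspc_sum) (auto simp: subspcD)

lemma subspc_is_lin: "is_lin f \<Longrightarrow> subspc W \<Longrightarrow> (\<And>m. m \<in> keys u \<Longrightarrow> f (e m) \<in> W) \<Longrightarrow> f u \<in> W"
  by (subst is_lin_eq_lin[of f u]) (auto intro: subspc_lin)

text \<open>Filtration steps, homogeneous components, the subrings of the skew polynomial tower and
  the span of the reduced monomials are all spans of basis vectors; this encoding turns membership
  into the vanishing of coefficients.\<close>

definition supp_in :: "('b \<Rightarrow> bool) \<Rightarrow> ('b \<Rightarrow>\<^sub>0 'a::field) set" where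
  "supp_in P = {u. \<forall>m. \<not> P m \<longrightarrow> coeff u m = 0}"

lemma subspc_supp_in [simp]: "subspc (supp_in P)"
  by (simp add: subspc_def supp_in_def lookup_add)

lemma supp_in_keysD: "u \<in> supp_in P \<Longrightarrow> m \<in> keys u \<Longrightarrow> P m"
  by (auto simp: supp_in_def in_keys_iff)

lemma e_supp_in [simp]: "(e m :: 'b \<Rightarrow>\<^sub>0 'a::field) \<in> supp_in P \<longleftrightarrow> P m"
  by (auto simp: supp_in_def coeff_e)

lemma supp_in_mono: "u \<in> supp_in P \<Longrightarrow> (\<And>m. P m \<Longrightarrow> Q m) \<Longrightarrow> u \<in> supp_in Q"
  by (auto simp: supp_in_def)

lemma lin_supp_in:
  "is_lin f \<Longrightarrow> u \<in> supp_in P \<Longrightarrow> subspc W \<Longrightarrow> (\<And>m. P m \<Longrightarrow> f (e m) \<in> W) \<Longrightarrow> f u \<in> W"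
  by (rule subspc_is_lin) (auto dest: supp_in_keysD)

subsection \<open>Algebras on the full type\<close>

definition is_bilin :: "(('b \<Rightarrow>\<^sub>0 'a::field) \<Rightarrow> ('c \<Rightarrow>\<^sub>0 'a) \<Rightarrow> ('d \<Rightarrow>\<^sub>0 'a)) \<Rightarrow> bool" where
  "is_bilin m \<longleftrightarrow> (\<forall>u. is_lin (m u)) \<and> (\<forall>v. is_lin (\<lambda>u. m u v))"

lemma is_bilinD:
  assumes "is_bilin m" shows "is_lin (m u)" "is_lin (\<lambda>u. m u v)"
  using assms by (auto simp: is_bilin_def)

lemma is_bilin_ext:
  assumes "is_bilin f" "is_bilin g" "\<And>m n. f (e m) (e n) = g (e m) (e n)"
  shows "f u v = g u v"
proof -
  have "f (e m) v = g (e m) v" for m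
    by (rule is_lin_ext[OF is_bilinD(1) is_bilinD(1), OF assms(1,2,3)])
  then show ?thesis
    by (rule is_lin_ext[OF is_bilinD(2) is_bilinD(2), OF assms(1,2)])
qed

text \<open>The carrier is the whole type, so identities between elements carry no membership
  conditions; the algebras of the statement are compared with such models through
  \<open>alg_iso\<close>.\<close>

definition typed_alg ::
  "(('b \<Rightarrow>\<^sub>0 'a::field) \<Rightarrow> ('b \<Rightarrow>\<^sub>0 'a) \<Rightarrow> ('b \<Rightarrow>\<^sub>0 'a)) \<Rightarrow> ('b \<Rightarrow>\<^sub>0 'a) \<Rightarrow> ('a, 'b \<Rightarrow>\<^sub>0 'a) module" where
  "typed_alg m i = \<lparr>carrier = UNIV, mult = m, one = i, zero = 0, add = (+), smult = smul\<rparr>"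

lemma typed_alg_sel [simp]:
  "carrier (typed_alg m i) = UNIV" "mult (typed_alg m i) = m" "one (typed_alg m i) = i"
  "zero (typed_alg m i) = 0" "add (typed_alg m i) = (+)" "smult (typed_alg m i) = smul"
  by (simp_all add: typed_alg_def)

lemma ring_typed_alg:
  assumes "is_bilin m" "\<And>u v w. m (m u v) w = m u (m v w)" "\<And>u. m i u = u" "\<And>u. m u i = u"
  shows "ring (typed_alg m i)"
proof (rule ringI)
  show "abelian_group (typed_alg m i)"
  proof (rule abelian_groupI)
    fix x :: "'a \<Rightarrow>\<^sub>0 'b"
    show "\<exists>y\<in>carrier (typed_alg m i). y \<oplus>\<^bsub>typed_alg m i\<^esub> x = \<zero>\<^bsub>typed_alg m i\<^esub>"
      by (auto intro: exI[of _ "- x"])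
  qed (simp_all add: algebra_simps)
  show "Group.monoid (typed_alg m i)"
    by (rule Group.monoidI) (auto simp: assms)
qed (use assms(1) in \<open>auto simp: is_bilin_def is_lin_def\<close>)

text \<open>The twisted semigroup algebra of \<open>f\<close> with factor set \<open>c\<close>. The
  free algebra, the Laurent polynomials and the quantum torus are instances.\<close>

definition tw :: "('b \<Rightarrow> 'b \<Rightarrow> 'b) \<Rightarrow> ('b \<Rightarrow> 'b \<Rightarrow> 'a::field) \<Rightarrow> ('b \<Rightarrow>\<^sub>0 'a) \<Rightarrow> ('b \<Rightarrow>\<^sub>0 'a) \<Rightarrow> ('b \<Rightarrow>\<^sub>0 'a)" where
  "tw f c u v = lin (\<lambda>m. lin (\<lambda>n. c m n \<bullet> e (f m n)) v) u"

lemma tw_e [simp]: "tw f c (e m) (e n) = c m n \<bullet> e (f m n)"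
  by (simp add: tw_def)

lemma is_bilin_tw [simp]: "is_bilin (tw f c)"
  unfolding is_bilin_def tw_def by (intro conjI allI is_lin_lin is_lin_lin_param)

lemmas tw_lin [simp] = is_bilinD[OF is_bilin_tw]
lemmas tw_simps [simp] = is_linD[OF tw_lin(1)] is_linD[OF tw_lin(2)]

text \<open>On basis vectors this is associativity of \<open>f\<close> together with the 2-cocycle
  identity for \<open>c\<close>; trilinearity extends it to the two left arguments and then to the
  last.\<close>

lemma tw_assoc:
  assumes f: "\<And>l m n. f (f l m) n = f l (f m n)"
    and c: "\<And>l m n. c l m * c (f l m) n = c m n * c l (f m n)"
  shows "tw f c (tw f c u v) w = tw f c u (tw f c v w)"
proof -
  have 1: "tw f c (tw f c (e l) (e m)) (e n) = tw f c (e l) (tw f c (e m) (e n))" for l m n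
    by (simp add: f c mult.commute)
  have 2: "tw f c (tw f c u v) (e n) = tw f c u (tw f c v (e n))" for n
    by (rule is_bilin_ext[of "\<lambda>u v. tw f c (tw f c u v) (e n)" "\<lambda>u v. tw f c u (tw f c v (e n))"])
      (simp_all add: is_bilin_def is_lin_def 1 del: tw_e)
  show ?thesis
    by (rule is_lin_ext[of "\<lambda>w. tw f c (tw f c u v) w" "\<lambda>w. tw f c u (tw f c v w)"])
      (simp_all add: is_lin_def 2)
qed

lemma tw_unit:
  assumes "\<And>m. f i m = m" "\<And>m. c i m = 1" shows "tw f c (e i) u = u"
  by (rule is_lin_ext[of "tw f c (e i)" "\<lambda>u. u"]) (auto simp: assms is_lin_id)

lemma tw_unit':
  assumes "\<And>m. f m i = m" "\<And>m. c m i = 1" shows "tw f c u (e i) = u"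
  by (rule is_lin_ext[of "\<lambda>u. tw f c u (e i)" "\<lambda>u. u"]) (auto simp: assms is_lin_id)

lemma coeff_tw:
  "coeff (tw f c u v) w =
    (\<Sum>m\<in>keys u. \<Sum>n\<in>keys v. coeff u m * (coeff v n * (c m n * (if w = f m n then 1 else 0))))"
  unfolding tw_def lin_def lookup_sum coeff_smul coeff_e sum_distrib_left ..

section \<open>Multiplication operators on normal words\<close>

type_synonym idx = "nat \<times> nat \<times> nat"

text \<open>Index triples list the exponents of x3, x2, x1 in this order, which is the order of the
  letters in a normal word.\<close>

definition wt :: "(gen \<Rightarrow> nat) \<Rightarrow> idx \<Rightarrow> nat" where
  "wt d = (\<lambda>(i, j, k). i * d X3 + j * d X2 + k * d X1)"

lemma wt_simps [simp]: "wt d (i, j, k) = i * d X3 + j * d X2 + k * d X1"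
  by (simp add: wt_def)

lemma supp_in_conj:
  "u \<in> supp_in P \<Longrightarrow> u \<in> supp_in Q \<Longrightarrow> u \<in> supp_in (\<lambda>m. P m \<and> Q m)"
  by (auto simp: supp_in_def)

lemma supp_in_smulI: "c = 0 \<or> u \<in> supp_in P \<Longrightarrow> c \<bullet> u \<in> supp_in P"
  by (auto simp: supp_in_def)

lemma mult_inverse_cancel:
  assumes "(q::'a::field) \<noteq> 0" shows "q * inverse q = 1" "q * (inverse q * c) = c"
  using assms by (simp_all add: field_simps)

locale qalg3 =
  fixes q A B C :: "'a::field"
  assumes q0 [simp]: "q \<noteq> 0"
begin

text \<open>Left multiplication by x3, which keeps words normal. It is needed before the operators
  \<open>L\<close> exist, because the clauses of \<open>bas\<close> apply it to earlier
  values.\<close>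

definition shift3 :: "(idx \<Rightarrow>\<^sub>0 'a) \<Rightarrow> (idx \<Rightarrow>\<^sub>0 'a)" where
  "shift3 = lin (\<lambda>(i, j, k). e (Suc i, j, k))"

text \<open>\<open>bas g i j k\<close> is the normal form of \<open>x\<^sub>g x\<^sub>3\<^sup>i x\<^sub>2\<^sup>j x\<^sub>1\<^sup>k\<close>. The guard in the fourth equation only serves
  termination: \<open>bas X1 0 j k\<close> involves no monomials with larger \<open>i + j\<close>.\<close>

function bas :: "gen \<Rightarrow> nat \<Rightarrow> nat \<Rightarrow> nat \<Rightarrow> (idx \<Rightarrow>\<^sub>0 'a)" where
  "bas X3 i j k = e (Suc i, j, k)"
| "bas X2 0 j k = e (0, Suc j, k)"
| "bas X2 (Suc i) j k = q \<bullet> shift3 (bas X2 i j k) + B \<bullet> bas X1 i j k"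
| "bas X1 0 (Suc j) k = q \<bullet> lin (\<lambda>m. if fst m + fst (snd m) \<le> j
      then bas X2 (fst m) (fst (snd m)) (snd (snd m)) else 0) (bas X1 0 j k) + A \<bullet> e (1, j, k)"
| "bas X1 0 0 k = e (0, 0, Suc k)"
| "bas X1 (Suc i) j k = inverse q \<bullet> shift3 (bas X1 i j k) - (inverse q * C) \<bullet> bas X2 i j k"
proof -
  fix P :: bool and x :: "gen \<times> nat \<times> nat \<times> nat"
  assume a: "\<And>i j k. x = (X3, i, j, k) \<Longrightarrow> P" "\<And>j k. x = (X2, 0, j, k) \<Longrightarrow> P"
    "\<And>i j k. x = (X2, Suc i, j, k) \<Longrightarrow> P" "\<And>j k. x = (X1, 0, Suc j, k) \<Longrightarrow> P"
    "\<And>k. x = (X1, 0, 0, k) \<Longrightarrow> P" "\<And>i j k. x = (X1, Suc i, j, k) \<Longrightarrow> P"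
  obtain g i j k where x: "x = (g, i, j, k)" by (cases x)
  show P using a x by (cases g; cases i; cases j) blast+
qed auto
termination
  \<comment> \<open>Only the exponents of x3 and x2 are measured: their sum is smaller in every
    recursive call, while the exponent of x1 may grow.\<close>
  by (relation "measure (\<lambda>(g, i, j, k). i + j)") auto

definition L :: "gen \<Rightarrow> (idx \<Rightarrow>\<^sub>0 'a) \<Rightarrow> (idx \<Rightarrow>\<^sub>0 'a)" where
  "L g = lin (\<lambda>(i, j, k). bas g i j k)"

lemma is_lin_L [simp]: "is_lin (L g)"
  by (simp add: L_def)

lemmas L_simps [simp] = is_linD[OF is_lin_L]

lemma L_e [simp]: "L g (e (i, j, k)) = bas g i j k"
  by (simp add: L_def)

lemma shift3_eq [simp]: "shift3 = L X3"
  by (simp add: shift3_def L_def)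

text \<open>Each relation rewrites a product into terms with at most as many letters x2, x3, so left
  multiplication by x1 cannot increase their number. This discharges the guard in the recursion for
  \<open>bas\<close>.\<close>

lemma bas_degree:
  "bas g i j k \<in> supp_in (\<lambda>m. fst m + fst (snd m) \<le> i + j + (if g = X1 then 0 else 1))"
proof (induction g i j k rule: bas.induct)
  case (3 i j k)
  have "L X3 (bas X2 i j k) \<in> supp_in (\<lambda>m. fst m + fst (snd m) \<le> Suc i + j + 1)"
    by (rule lin_supp_in[OF _ 3(1)]) auto
  moreover have "bas X1 i j k \<in> supp_in (\<lambda>m. fst m + fst (snd m) \<le> Suc i + j + 1)"
    by (rule supp_in_mono[OF 3(2)]) auto
  ultimately show ?case by (simp add: subspcD)
next
  case (4 j k)
  have "lin (\<lambda>m. if fst m + fst (snd m) \<le> j then bas X2 (fst m) (fst (snd m)) (snd (snd m)) else 0)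
      (bas X1 0 j k) \<in> supp_in (\<lambda>m. fst m + fst (snd m) \<le> 0 + Suc j + 0)"
  proof (rule lin_supp_in[OF _ 4(2)])
    fix m :: idx assume m: "fst m + fst (snd m) \<le> 0 + j + (if X1 = X1 then 0 else 1)"
    then have "bas X2 (fst m) (fst (snd m)) (snd (snd m))
        \<in> supp_in (\<lambda>m'. fst m' + fst (snd m') \<le> fst m + fst (snd m) + (if X2 = X1 then 0 else 1))"
      using 4(1)[of m] by simp
    then show "lin (\<lambda>m. if fst m + fst (snd m) \<le> j then bas X2 (fst m) (fst (snd m)) (snd (snd m)) else 0)
        (e m) \<in> supp_in (\<lambda>m. fst m + fst (snd m) \<le> 0 + Suc j + 0)"
      using m by (auto elim!: supp_in_mono)
  qed auto
  then show ?case by (auto intro!: subspcD)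
next
  case (6 i j k)
  have "L X3 (bas X1 i j k) \<in> supp_in (\<lambda>m. fst m + fst (snd m) \<le> Suc i + j + 0)"
    by (rule lin_supp_in[OF _ 6(1)]) auto
  moreover have "bas X2 i j k \<in> supp_in (\<lambda>m. fst m + fst (snd m) \<le> Suc i + j + 0)"
    by (rule supp_in_mono[OF 6(2)]) auto
  ultimately show ?case by (simp add: subspcD)
qed auto

text \<open>By \<open>bas_degree\<close> the guard is true on the whole support, so the guarded
  clause becomes x1 x2 = q x2 x1 + A x3 applied to a normal word.\<close>

lemma bas_X1_Suc: "bas X1 0 (Suc j) k = q \<bullet> L X2 (bas X1 0 j k) + A \<bullet> e (1, j, k)"
proof -
  have "lin (\<lambda>m. if fst m + fst (snd m) \<le> j then bas X2 (fst m) (fst (snd m)) (snd (snd m)) else 0)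
      (bas X1 0 j k) = L X2 (bas X1 0 j k)"
    unfolding L_def
    by (rule lin_cong) (use supp_in_keysD[OF bas_degree[of X1 0 j k]] in auto)
  then show ?thesis by simp
qed

declare bas.simps(4) [simp del]

text \<open>The relation \<open>R\<close> on weights stays abstract because two instances are
  wanted: \<le> gives the filtration, equality gives the homogeneity of the graded product. The
  assumptions \<open>d\<close> say that each relation with nonzero constant relates the weight of
  its right-hand side to that of its left-hand side.\<close>

lemma bas_rel_wt:
  assumes R: "\<And>a. R a a" "\<And>a b c. R a b \<Longrightarrow> R b c \<Longrightarrow> R a c" "\<And>a b c. R a b \<Longrightarrow> R (a + c) (b + c)"
    and d: "A = 0 \<or> R (d X3) (d X1 + d X2)" "B = 0 \<or> R (d X1) (d X2 + d X3)" "C = 0 \<or> R (d X2) (d X1 + d X3)"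
  shows "bas g i j k \<in> supp_in (\<lambda>m. R (wt d m) (wt d (i, j, k) + d g))"
proof (induction g i j k rule: bas.induct)
  case (1 i j k)
  then show ?case using R(1) by (simp add: add_ac)
next
  case (2 j k)
  then show ?case using R(1) by (simp add: add_ac)
next
  case (3 i j k)
  let ?W = "supp_in (\<lambda>m. R (wt d m) (wt d (Suc i, j, k) + d X2)) :: (idx \<Rightarrow>\<^sub>0 'a) set"
  have "L X3 (bas X2 i j k) \<in> ?W"
    by (rule lin_supp_in[OF _ 3(1)]) (auto dest: R(3)[of _ _ "d X3"] simp: add_ac)
  moreover have "B \<bullet> bas X1 i j k \<in> ?W"
  proof (rule supp_in_smulI, rule disj_forward[OF d(2)])
    assume "R (d X1) (d X2 + d X3)"
    from R(3)[OF this, of "wt d (i, j, k)"] show "bas X1 i j k \<in> ?W"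
      by (intro supp_in_mono[OF 3(2)]) (auto intro: R(2) simp: add_ac)
  qed
  ultimately show ?case by (simp add: subspcD)
next
  case (4 j k)
  let ?W = "supp_in (\<lambda>m. R (wt d m) (wt d (0, Suc j, k) + d X1)) :: (idx \<Rightarrow>\<^sub>0 'a) set"
  \<comment> \<open>The degree bound travels with the weight bound: the induction hypothesis for x2
    is available only for monomials that satisfy the guard.\<close>
  have "bas X1 0 j k \<in> supp_in (\<lambda>m. fst m + fst (snd m) \<le> j \<and> R (wt d m) (wt d (0, j, k) + d X1))"
    using bas_degree[of X1 0 j k] 4(2) by (intro supp_in_conj) simp_all
  then have "L X2 (bas X1 0 j k) \<in> ?W"
  proof (rule lin_supp_in[rotated])
    fix m :: idx assume m: "fst m + fst (snd m) \<le> j \<and> R (wt d m) (wt d (0, j, k) + d X1)"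
    obtain i' j' k' where [simp]: "m = (i', j', k')" by (cases m)
    have "bas X2 i' j' k' \<in> supp_in (\<lambda>m'. R (wt d m') (wt d m + d X2))"
      using 4(1)[of m] m by simp
    then show "L X2 (e m) \<in> ?W"
      unfolding \<open>m = (i', j', k')\<close> L_e
      by (rule supp_in_mono) (use R(3)[OF conjunct2[OF m], of "d X2"] in \<open>auto intro: R(2) simp: add_ac\<close>)
  qed auto
  moreover have "A \<bullet> e (1, j, k) \<in> ?W"
  proof (rule supp_in_smulI, rule disj_forward[OF d(1)])
    assume "R (d X3) (d X1 + d X2)"
    from R(3)[OF this, of "wt d (0, j, k)"] show "e (1, j, k) \<in> ?W" by (simp add: add_ac)
  qed
  ultimately show ?case unfolding bas_X1_Suc by (simp only: subspcD[OF subspc_supp_in])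
next
  case (5 k)
  then show ?case using R(1) by (simp add: add_ac)
next
  case (6 i j k)
  let ?W = "supp_in (\<lambda>m. R (wt d m) (wt d (Suc i, j, k) + d X1)) :: (idx \<Rightarrow>\<^sub>0 'a) set"
  have "L X3 (bas X1 i j k) \<in> ?W"
    by (rule lin_supp_in[OF _ 6(1)]) (auto dest: R(3)[of _ _ "d X3"] simp: add_ac)
  moreover have "(inverse q * C) \<bullet> bas X2 i j k \<in> ?W"
  proof (rule supp_in_smulI)
    show "inverse q * C = 0 \<or> bas X2 i j k \<in> ?W"
      using d(3)
    proof (rule disj_forward)
      assume "R (d X2) (d X1 + d X3)"
      from R(3)[OF this, of "wt d (i, j, k)"] show "bas X2 i j k \<in> ?W"
        by (intro supp_in_mono[OF 6(2)]) (auto intro: R(2) simp: add_ac)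
    qed simp
  qed
  ultimately show ?case by (simp add: subspcD)
qed

text \<open>On basis vectors \<open>L X3\<close> only raises the first exponent, so this identity
  and the next are clauses of \<open>bas\<close>.\<close>

lemma rel13: "L X1 (L X3 v) = inverse q \<bullet> L X3 (L X1 v) - (inverse q * C) \<bullet> L X2 v"
  by (rule is_lin_ext[of "\<lambda>v. L X1 (L X3 v)" "\<lambda>v. inverse q \<bullet> L X3 (L X1 v) - (inverse q * C) \<bullet> L X2 v"])
    (auto simp: is_lin_def mult.commute)

lemma rel23: "L X2 (L X3 v) = q \<bullet> L X3 (L X2 v) + B \<bullet> L X1 v"
  by (rule is_lin_ext[of "\<lambda>v. L X2 (L X3 v)" "\<lambda>v. q \<bullet> L X3 (L X2 v) + B \<bullet> L X1 v"])
    (auto simp: is_lin_def mult.commute)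

text \<open>The only ambiguity of the rewriting system is \<open>x\<^sub>1 x\<^sub>2 x\<^sub>3\<close>; it is resolved in the induction step.\<close>

lemma rel12: "L X1 (L X2 v) = q \<bullet> L X2 (L X1 v) + A \<bullet> L X3 v"
proof -
  have "L X1 (L X2 (e (i, j, k))) = q \<bullet> L X2 (L X1 (e (i, j, k))) + A \<bullet> L X3 (e (i, j, k))" for i j k
  proof (induction i)
    case 0 then show ?case by (simp add: bas_X1_Suc)
  next
    case (Suc i)
    define v where "v = (e (i, j, k) :: idx \<Rightarrow>\<^sub>0 'a)"
    have v: "e (Suc i, j, k) = L X3 v" by (simp add: v_def)
    have IH: "L X1 (L X2 v) = q \<bullet> L X2 (L X1 v) + A \<bullet> L X3 v" using Suc by (simp add: v_def)
    \<comment> \<open>Moving x3 to the front on either side of the claim leaves the same extra terms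
      B x1^2 - C x2^2; what remains is the induction hypothesis multiplied by x3.\<close>
    have "L X1 (L X2 (L X3 v)) = L X3 (L X1 (L X2 v)) - C \<bullet> L X2 (L X2 v) + B \<bullet> L X1 (L X1 v)"
      by (simp only: rel13 rel23 L_simps smul_simps mult_inverse_cancel[OF q0]) (simp only: diff_conv_add_uminus add_ac)?
    also have "\<dots> = q \<bullet> L X3 (L X2 (L X1 v)) + A \<bullet> L X3 (L X3 v) - C \<bullet> L X2 (L X2 v) + B \<bullet> L X1 (L X1 v)"
      by (simp add: IH mult.commute)
    also have "\<dots> = q \<bullet> L X2 (L X1 (L X3 v)) + A \<bullet> L X3 (L X3 v)"
      by (simp only: rel13 rel23 L_simps smul_simps mult_inverse_cancel[OF q0]) (simp only: diff_conv_add_uminus add_ac)?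
    finally show ?case unfolding v .
  qed
  then have "L X1 (L X2 (e m)) = q \<bullet> L X2 (L X1 (e m)) + A \<bullet> L X3 (e m)" for m
    by (cases m) (simp only:)
  then show ?thesis
    by (rule is_lin_ext[of "\<lambda>v. L X1 (L X2 v)" "\<lambda>v. q \<bullet> L X2 (L X1 v) + A \<bullet> L X3 v", rotated 2])
      (simp_all add: is_lin_def mult.commute)
qed

end

text \<open>\<open>A'\<close>, \<open>B'\<close>, \<open>C'\<close> are the structure constants of the associated graded algebra for the degrees \<open>d\<close>: a
  constant survives if and only if its relation is homogeneous.\<close>

locale qalg3_weight = qalg3 q A B C for q A B C :: "'a::field" +
  fixes d :: "gen \<Rightarrow> nat" and A' B' C' :: 'a
  assumes tri: "d X3 \<le> d X1 + d X2" "d X1 \<le> d X2 + d X3" "d X2 \<le> d X1 + d X3"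
    and tri_eq: "A' = 0 \<or> d X3 = d X1 + d X2" "B' = 0 \<or> d X1 = d X2 + d X3" "C' = 0 \<or> d X2 = d X1 + d X3"
    and tri_less: "A' = A \<or> d X3 < d X1 + d X2" "B' = B \<or> d X1 < d X2 + d X3" "C' = C \<or> d X2 < d X1 + d X3"
begin

lemma bas_wt: "bas g i j k \<in> supp_in (\<lambda>m. wt d m \<le> wt d (i, j, k) + d g)"
  by (rule bas_rel_wt) (use tri in auto)

lemma L_wt: "v \<in> supp_in (\<lambda>m. wt d m \<le> n) \<Longrightarrow> L g v \<in> supp_in (\<lambda>m. wt d m \<le> n + d g)"
  by (rule lin_supp_in[OF is_lin_L, of v "\<lambda>m. wt d m \<le> n"]) (auto intro!: supp_in_mono[OF bas_wt])

lemma L_wt_less: "v \<in> supp_in (\<lambda>m. wt d m < n) \<Longrightarrow> L g v \<in> supp_in (\<lambda>m. wt d m < n + d g)"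
  by (rule lin_supp_in[OF is_lin_L, of v "\<lambda>m. wt d m < n"]) (auto intro!: supp_in_mono[OF bas_wt])

sublocale G: qalg3 q A' B' C'
  by unfold_locales simp

lemma G_bas_wt: "G.bas g i j k \<in> supp_in (\<lambda>m. wt d m = wt d (i, j, k) + d g)"
  by (rule G.bas_rel_wt) (use tri_eq in auto)

lemma G_L_wt: "v \<in> supp_in (\<lambda>m. wt d m = n) \<Longrightarrow> G.L g v \<in> supp_in (\<lambda>m. wt d m = n + d g)"
  by (rule lin_supp_in[OF G.is_lin_L, of v "\<lambda>m. wt d m = n"]) (auto intro!: supp_in_mono[OF G_bas_wt])

text \<open>The two recursions differ only where the constant of a weight-lowering relation is
  replaced by 0; the error so made has smaller weight, and the operators preserve the bound.\<close>

lemma bas_diff_wt: "bas g i j k - G.bas g i j k \<in> supp_in (\<lambda>m. wt d m < wt d (i, j, k) + d g)"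
proof (induction g i j k rule: bas.induct)
  case (3 i j k)
  let ?W = "supp_in (\<lambda>m. wt d m < wt d (Suc i, j, k) + d X2) :: (idx \<Rightarrow>\<^sub>0 'a) set"
  have L3: "L X3 v = G.L X3 v" for v by (simp add: L_def G.L_def)
  have "L X3 (bas X2 i j k - G.bas X2 i j k) \<in> ?W"
    by (rule lin_supp_in[OF _ 3(1)]) auto
  moreover have "B' \<bullet> (bas X1 i j k - G.bas X1 i j k) \<in> ?W"
    by (rule supp_in_smulI, rule disj_forward[OF tri_eq(2)]) (auto intro!: supp_in_mono[OF 3(2)])
  moreover have "(B - B') \<bullet> bas X1 i j k \<in> ?W"
    by (rule supp_in_smulI, rule disj_forward[OF tri_less(2)]) (auto intro!: supp_in_mono[OF bas_wt])
  \<comment> \<open>The difference is split by adding and subtracting \<open>B'\<close> times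
    \<open>bas X1 i j k\<close>: a nonzero \<open>B'\<close> forces equal weights, so the induction
    hypothesis suffices there, and a nonzero \<open>B - B'\<close> forces a strict drop.\<close>
  ultimately have "q \<bullet> L X3 (bas X2 i j k - G.bas X2 i j k) + B' \<bullet> (bas X1 i j k - G.bas X1 i j k)
      + (B - B') \<bullet> bas X1 i j k \<in> ?W"
    by (simp only: subspcD[OF subspc_supp_in])
  also have "q \<bullet> L X3 (bas X2 i j k - G.bas X2 i j k) + B' \<bullet> (bas X1 i j k - G.bas X1 i j k)
      + (B - B') \<bullet> bas X1 i j k = bas X2 (Suc i) j k - G.bas X2 (Suc i) j k"
    by (simp add: L3 smul_diff_left right_diff_distrib)
  finally show ?case .
next
  case (4 j k)
  let ?W = "supp_in (\<lambda>m. wt d m < wt d (0, Suc j, k) + d X1) :: (idx \<Rightarrow>\<^sub>0 'a) set"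
  have "L X2 (bas X1 0 j k - G.bas X1 0 j k) \<in> supp_in (\<lambda>m. wt d m < wt d (0, j, k) + d X1 + d X2)"
    by (rule L_wt_less[OF 4(2)])
  then have 1: "L X2 (bas X1 0 j k - G.bas X1 0 j k) \<in> ?W" by (rule supp_in_mono) simp
  \<comment> \<open>\<open>L X2\<close> and \<open>G.L X2\<close> have to be compared on a whole
    vector; homogeneity and the degree bound let the induction hypothesis act on each monomial of
    its support.\<close>
  have "G.bas X1 0 j k \<in> supp_in (\<lambda>m. fst m + fst (snd m) \<le> j \<and> wt d m = wt d (0, j, k) + d X1)"
    using G.bas_degree[of X1 0 j k] G_bas_wt[of X1 0 j k] by (intro supp_in_conj) simp_all
  then have 2: "L X2 (G.bas X1 0 j k) - G.L X2 (G.bas X1 0 j k) \<in> ?W"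
  proof (rule lin_supp_in[rotated])
    fix m :: idx assume m: "fst m + fst (snd m) \<le> j \<and> wt d m = wt d (0, j, k) + d X1"
    obtain i' j' k' where [simp]: "m = (i', j', k')" by (cases m)
    have "bas X2 i' j' k' - G.bas X2 i' j' k' \<in> supp_in (\<lambda>m'. wt d m' < wt d m + d X2)"
      using 4(1)[of m] m by simp
    then show "L X2 (e m) - G.L X2 (e m) \<in> ?W"
      using m by (auto elim!: supp_in_mono)
  qed (auto simp: is_lin_def)
  have 3: "(A - A') \<bullet> e (1, j, k) \<in> ?W"
    by (rule supp_in_smulI, rule disj_forward[OF tri_less(1)]) auto
  have "q \<bullet> (L X2 (bas X1 0 j k - G.bas X1 0 j k) + (L X2 (G.bas X1 0 j k) - G.L X2 (G.bas X1 0 j k)))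
      + (A - A') \<bullet> e (1, j, k) \<in> ?W"
    using 1 2 3 by (simp only: subspcD[OF subspc_supp_in])
  also have "q \<bullet> (L X2 (bas X1 0 j k - G.bas X1 0 j k) + (L X2 (G.bas X1 0 j k) - G.L X2 (G.bas X1 0 j k)))
      + (A - A') \<bullet> e (1, j, k) = bas X1 0 (Suc j) k - G.bas X1 0 (Suc j) k"
    by (simp add: bas_X1_Suc G.bas_X1_Suc smul_diff_left)
  finally show ?case .
next
  case (6 i j k)
  let ?W = "supp_in (\<lambda>m. wt d m < wt d (Suc i, j, k) + d X1) :: (idx \<Rightarrow>\<^sub>0 'a) set"
  have L3: "L X3 v = G.L X3 v" for v by (simp add: L_def G.L_def)
  have "L X3 (bas X1 i j k - G.bas X1 i j k) \<in> ?W"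
    by (rule lin_supp_in[OF _ 6(1)]) auto
  moreover have "(inverse q * C') \<bullet> (bas X2 i j k - G.bas X2 i j k) \<in> ?W"
    by (rule supp_in_smulI, rule disj_forward[OF tri_eq(3)]) (auto intro!: supp_in_mono[OF 6(2)])
  moreover have "(inverse q * (C - C')) \<bullet> bas X2 i j k \<in> ?W"
    by (rule supp_in_smulI, rule disj_forward[OF tri_less(3)]) (auto intro!: supp_in_mono[OF bas_wt])
  ultimately have "inverse q \<bullet> L X3 (bas X1 i j k - G.bas X1 i j k)
      - (inverse q * C') \<bullet> (bas X2 i j k - G.bas X2 i j k)
      - (inverse q * (C - C')) \<bullet> bas X2 i j k \<in> ?W"
    by (simp only: subspcD[OF subspc_supp_in])
  also have "inverse q \<bullet> L X3 (bas X1 i j k - G.bas X1 i j k)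
      - (inverse q * C') \<bullet> (bas X2 i j k - G.bas X2 i j k)
      - (inverse q * (C - C')) \<bullet> bas X2 i j k = bas X1 (Suc i) j k - G.bas X1 (Suc i) j k"
    by (simp add: L3 smul_diff_left right_diff_distrib)
  finally show ?case .
qed (auto simp: subspcD)

lemma L_diff_wt:
  "v \<in> supp_in (\<lambda>m. wt d m \<le> n) \<Longrightarrow> L g v - G.L g v \<in> supp_in (\<lambda>m. wt d m < n + d g)"
  by (rule lin_supp_in[of "\<lambda>v. L g v - G.L g v" v "\<lambda>m. wt d m \<le> n"])
    (auto simp: is_lin_def intro!: supp_in_mono[OF bas_diff_wt])

end

section \<open>Presented algebras\<close>

definition falg :: "('a::field, 'b, 'm) module_scheme \<Rightarrow> bool" where
  "falg A \<longleftrightarrow> ring A \<and> (\<forall>c. \<forall>a\<in>carrier A. c \<odot>\<^bsub>A\<^esub> a \<in> carrier A) \<and>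
     (\<forall>c. \<forall>a\<in>carrier A. \<forall>b\<in>carrier A. c \<odot>\<^bsub>A\<^esub> (a \<oplus>\<^bsub>A\<^esub> b) = c \<odot>\<^bsub>A\<^esub> a \<oplus>\<^bsub>A\<^esub> c \<odot>\<^bsub>A\<^esub> b \<and>
       (c \<odot>\<^bsub>A\<^esub> a) \<otimes>\<^bsub>A\<^esub> b = c \<odot>\<^bsub>A\<^esub> (a \<otimes>\<^bsub>A\<^esub> b) \<and> a \<otimes>\<^bsub>A\<^esub> (c \<odot>\<^bsub>A\<^esub> b) = c \<odot>\<^bsub>A\<^esub> (a \<otimes>\<^bsub>A\<^esub> b))"

lemma falgD:
  assumes "falg A"
  shows "ring A" "a \<in> carrier A \<Longrightarrow> c \<odot>\<^bsub>A\<^esub> a \<in> carrier A"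
    "a \<in> carrier A \<Longrightarrow> b \<in> carrier A \<Longrightarrow> c \<odot>\<^bsub>A\<^esub> (a \<oplus>\<^bsub>A\<^esub> b) = c \<odot>\<^bsub>A\<^esub> a \<oplus>\<^bsub>A\<^esub> c \<odot>\<^bsub>A\<^esub> b"
    "a \<in> carrier A \<Longrightarrow> b \<in> carrier A \<Longrightarrow> (c \<odot>\<^bsub>A\<^esub> a) \<otimes>\<^bsub>A\<^esub> b = c \<odot>\<^bsub>A\<^esub> (a \<otimes>\<^bsub>A\<^esub> b)"
    "a \<in> carrier A \<Longrightarrow> b \<in> carrier A \<Longrightarrow> a \<otimes>\<^bsub>A\<^esub> (c \<odot>\<^bsub>A\<^esub> b) = c \<odot>\<^bsub>A\<^esub> (a \<otimes>\<^bsub>A\<^esub> b)"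
  using assms unfolding falg_def by blast+

lemma alg_isoI:
  assumes "\<And>a. a \<in> carrier A \<Longrightarrow> h a \<in> carrier B"
    and "\<And>a b. a \<in> carrier A \<Longrightarrow> b \<in> carrier A \<Longrightarrow> h (a \<otimes>\<^bsub>A\<^esub> b) = h a \<otimes>\<^bsub>B\<^esub> h b"
    and "\<And>a b. a \<in> carrier A \<Longrightarrow> b \<in> carrier A \<Longrightarrow> h (a \<oplus>\<^bsub>A\<^esub> b) = h a \<oplus>\<^bsub>B\<^esub> h b"
    and "h \<one>\<^bsub>A\<^esub> = \<one>\<^bsub>B\<^esub>" and "\<And>c a. a \<in> carrier A \<Longrightarrow> h (c \<odot>\<^bsub>A\<^esub> a) = c \<odot>\<^bsub>B\<^esub> h a"
    and "inj_on h (carrier A)" and "\<And>b. b \<in> carrier B \<Longrightarrow> b \<in> h ` carrier A"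
  shows "h \<in> alg_iso A B"
  using assms by (auto simp: alg_iso_def ring_iso_def ring_hom_def bij_betw_def)

lemma alg_isoD:
  assumes "h \<in> alg_iso A B"
  shows "a \<in> carrier A \<Longrightarrow> h a \<in> carrier B"
    "a \<in> carrier A \<Longrightarrow> b \<in> carrier A \<Longrightarrow> h (a \<otimes>\<^bsub>A\<^esub> b) = h a \<otimes>\<^bsub>B\<^esub> h b"
    "a \<in> carrier A \<Longrightarrow> b \<in> carrier A \<Longrightarrow> h (a \<oplus>\<^bsub>A\<^esub> b) = h a \<oplus>\<^bsub>B\<^esub> h b"
    "h \<one>\<^bsub>A\<^esub> = \<one>\<^bsub>B\<^esub>" "a \<in> carrier A \<Longrightarrow> h (c \<odot>\<^bsub>A\<^esub> a) = c \<odot>\<^bsub>B\<^esub> h a"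
    "inj_on h (carrier A)" "h ` carrier A = carrier B"
  using assms by (auto simp: alg_iso_def ring_iso_def ring_hom_def bij_betw_def)

text \<open>Here \<open>B\<close> is not yet known to be a ring, and \<open>alg_iso\<close> speaks
  of sums, products and the unit but not of zero, which is therefore checked separately.\<close>

lemma alg_iso_ring_zero:
  assumes h: "h \<in> alg_iso A B" and A: "ring A" and B: "h \<zero>\<^bsub>A\<^esub> = \<zero>\<^bsub>B\<^esub>"
  shows "ring B"
  using ring.ring_iso_imp_img_ring[OF A, of h B] h by (simp add: alg_iso_def B)

lemma alg_iso_zero:
  assumes "h \<in> alg_iso A B" "ring A" "ring B"
  shows "h \<zero>\<^bsub>A\<^esub> = \<zero>\<^bsub>B\<^esub>"
  using assms by (auto simp: alg_iso_def ring_iso_def intro: ring_hom_zero)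

lemma falg_alg_iso:
  assumes h: "h \<in> alg_iso A B" and A: "falg A" and B: "ring B"
  shows "falg B"
  unfolding falg_def alg_isoD(7)[OF h, symmetric]
  using B falgD[OF A] ring.ring_simprules(1,5)[OF falgD(1)[OF A]]
  by (simp add: alg_isoD(2-5)[OF h, symmetric])

lemma alg_iso_comp:
  assumes g: "g \<in> alg_iso A B" and h: "h \<in> alg_iso B D"
  shows "(\<lambda>a. h (g a)) \<in> alg_iso A D"
proof (rule alg_isoI)
  show "inj_on (\<lambda>a. h (g a)) (carrier A)"
    using comp_inj_on[of g "carrier A" h] alg_isoD(6,7)[OF g] alg_isoD(6)[OF h] by (simp add: o_def)
  show "b \<in> carrier D \<Longrightarrow> b \<in> (\<lambda>a. h (g a)) ` carrier A" for b
    using alg_isoD(7)[OF g] alg_isoD(7)[OF h] by (metis image_image)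
qed (auto simp: alg_isoD(1-5)[OF g] alg_isoD(1-5)[OF h])

lemma alg_iso_inv:
  assumes h: "h \<in> alg_iso A B" and A: "falg A"
  shows "inv_into (carrier A) h \<in> alg_iso B A"
proof -
  interpret A: ring A by (rule falgD[OF A])
  let ?g = "inv_into (carrier A) h"
  have gh: "?g (h a) = a" if "a \<in> carrier A" for a
    using alg_isoD(6)[OF h] that by simp
  note hD = alg_isoD(2-5)[OF h, symmetric]
  show ?thesis
  proof (rule alg_isoI)
    show "?g \<one>\<^bsub>B\<^esub> = \<one>\<^bsub>A\<^esub>" using gh[of "\<one>\<^bsub>A\<^esub>"] by (simp add: alg_isoD(4)[OF h])
    show "inj_on ?g (carrier B)" using alg_isoD(7)[OF h] by (simp add: inj_on_inv_into)
    show "a \<in> ?g ` carrier B" if "a \<in> carrier A" for a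
      using gh[OF that] alg_isoD(1)[OF h that] by (metis imageI)
  qed (auto simp: alg_isoD(7)[OF h, symmetric] gh hD falgD[OF A])
qed

lemma alg_iso_minus:
  assumes h: "h \<in> alg_iso A B" and R: "ring A" "ring B" and a: "a \<in> carrier A" "b \<in> carrier A"
  shows "h (a \<ominus>\<^bsub>A\<^esub> b) = h a \<ominus>\<^bsub>B\<^esub> h b"
proof -
  interpret ring_hom_ring A B h
    using h R by (intro ring_hom_ringI2) (auto simp: alg_iso_def ring_iso_def)
  show ?thesis using a by (simp add: a_minus_def)
qed

lemma alg_iso_finsum:
  assumes h: "h \<in> alg_iso A B" and R: "ring A" "ring B" and c: "f \<in> S \<rightarrow> carrier A"
  shows "h (\<Oplus>\<^bsub>A\<^esub>i\<in>S. f i) = (\<Oplus>\<^bsub>B\<^esub>i\<in>S. h (f i))"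
proof -
  interpret ring_hom_ring A B h
    using h R by (intro ring_hom_ringI2) (auto simp: alg_iso_def ring_iso_def)
  show ?thesis using c by simp (simp add: o_def)
qed

lemma alg_iso_pow:
  assumes h: "h \<in> alg_iso A B" and A: "ring A" and a: "a \<in> carrier A"
  shows "h (a [^]\<^bsub>A\<^esub> (n::nat)) = h a [^]\<^bsub>B\<^esub> n"
proof -
  interpret A: ring A by (rule A)
  show ?thesis by (induction n) (simp_all add: a alg_isoD(2,4)[OF h])
qed

lemma falg_typed_alg:
  assumes "is_bilin m" "\<And>u v w. m (m u v) w = m u (m v w)" "\<And>u. m i u = u" "\<And>u. m u i = u"
  shows "falg (typed_alg m i)"
  unfolding falg_def using ring_typed_alg[OF assms] assms(1)
  by (auto simp: is_bilin_def is_lin_def)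

lemma typed_alg_finsum:
  assumes "ring (typed_alg m i)"
  shows "(\<Oplus>\<^bsub>typed_alg m i\<^esub>x\<in>S. f x) = (\<Sum>x\<in>S. f x)"
proof -
  interpret ring "typed_alg m i" by fact
  show ?thesis
    by (induction S rule: infinite_finite_induct) (auto simp: finsum_infinite)
qed

lemma typed_alg_minus:
  assumes "ring (typed_alg m i)"
  shows "u \<ominus>\<^bsub>typed_alg m i\<^esub> v = u - v"
proof -
  interpret ring "typed_alg m i" by fact
  have "\<ominus>\<^bsub>typed_alg m i\<^esub> v = - v" by (rule minus_equality) auto
  then show ?thesis by (simp add: a_minus_def)
qed

lemma quot_alg_sel [simp]:
  "carrier (quot_alg A I) = carrier (A Quot I)" "mult (quot_alg A I) = mult (A Quot I)"
  "one (quot_alg A I) = one (A Quot I)" "zero (quot_alg A I) = zero (A Quot I)"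
  "add (quot_alg A I) = add (A Quot I)"
  "smult (quot_alg A I) = (\<lambda>c X. \<Union>x\<in>X. I +>\<^bsub>A\<^esub> (c \<odot>\<^bsub>A\<^esub> x))"
  by (simp_all add: quot_alg_def ring.extend_def ring.defs module.defs)

lemma ring_quot_alg: "ideal I A \<Longrightarrow> ring (quot_alg A I)"
proof -
  assume I: "ideal I A"
  \<comment> \<open>Both records have the same ring operations and differ only by the added scalar
    multiplication; the identity map carries the ring axioms over.\<close>
  have "(\<lambda>x. x) \<in> ring_iso (A Quot I) (quot_alg A I)"
    by (auto simp: ring_iso_def ring_hom_def bij_betw_def ideal.quotient_is_ring[OF I, THEN ring.ring_simprules(5)]
        ideal.quotient_is_ring[OF I, THEN ring.ring_simprules(1)])
  from ring.ring_iso_imp_img_ring[OF ideal.quotient_is_ring[OF I] this]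
  show ?thesis by (simp flip: quot_alg_sel(4))
qed

lemma quot_alg_coset:
  assumes "ideal I A" "a \<in> carrier A"
  shows "I +>\<^bsub>A\<^esub> a \<in> carrier (quot_alg A I)"
  using ideal.rcos_ring_hom[OF assms(1)] assms(2) by (auto simp: ring_hom_def)

lemma quot_alg_cases:
  assumes "ideal I A" "X \<in> carrier (quot_alg A I)"
  obtains a where "a \<in> carrier A" "X = I +>\<^bsub>A\<^esub> a"
proof -
  interpret ideal I A by fact
  show ?thesis using assms(2) that by (auto simp: FactRing_def A_RCOSETS_def')
qed

lemma quot_alg_coset_eq:
  assumes "ideal I A" "a \<in> carrier A" "b \<in> carrier A"
  shows "I +>\<^bsub>A\<^esub> a = I +>\<^bsub>A\<^esub> b \<longleftrightarrow> a \<ominus>\<^bsub>A\<^esub> b \<in> I"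
proof -
  interpret ideal I A by fact
  show ?thesis using assms(2,3) quotient_eq_iff_same_a_r_cos[OF assms(1), of a b] by simp
qed

text \<open>Scalars act through multiples of the unit, so an ideal of the underlying ring is
  automatically a subspace.\<close>

lemma ideal_smult:
  assumes "ideal I A" "falg A" "a \<in> I"
  shows "c \<odot>\<^bsub>A\<^esub> a \<in> I"
proof -
  interpret ideal I A by fact
  have a: "a \<in> carrier A" using assms(3) by (rule Icarr)
  have "(c \<odot>\<^bsub>A\<^esub> \<one>\<^bsub>A\<^esub>) \<otimes>\<^bsub>A\<^esub> a \<in> I" using assms(3) by (intro I_l_closed) (auto intro: falgD[OF assms(2)])
  then show ?thesis using a by (simp add: falgD[OF assms(2)])
qed

lemma quot_alg_coset_smult:
  assumes I: "ideal I A" and A: "falg A" and a: "a \<in> carrier A"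
  shows "c \<odot>\<^bsub>quot_alg A I\<^esub> (I +>\<^bsub>A\<^esub> a) = I +>\<^bsub>A\<^esub> (c \<odot>\<^bsub>A\<^esub> a)"
proof -
  interpret ideal I A by fact
  have eq: "I +>\<^bsub>A\<^esub> (c \<odot>\<^bsub>A\<^esub> x) = I +>\<^bsub>A\<^esub> (c \<odot>\<^bsub>A\<^esub> a)" if x: "x \<in> I +>\<^bsub>A\<^esub> a" for x
  proof -
    obtain i where i: "i \<in> I" "x = i \<oplus>\<^bsub>A\<^esub> a" using x by (auto simp: a_r_coset_def')
    have ic: "i \<in> carrier A" using i by (simp add: Icarr)
    have "(c \<odot>\<^bsub>A\<^esub> x) \<ominus>\<^bsub>A\<^esub> (c \<odot>\<^bsub>A\<^esub> a) = c \<odot>\<^bsub>A\<^esub> i"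
      using falgD(2)[OF A, of i c] falgD(2)[OF A, of a c] ic a
      by (simp add: i falgD(3)[OF A] a_minus_def a_assoc r_neg)
    then show ?thesis
      using ideal_smult[OF I A i(1)] i ic a by (subst quot_alg_coset_eq[OF I]) (auto intro: falgD[OF A])
  qed
  show ?thesis unfolding quot_alg_sel by (rule UN_constant_eq[OF a_rcos_self[OF a]], rule ballI, rule eq)
qed

lemma quot_alg_coset_ops:
  assumes I: "ideal I A" and a: "a \<in> carrier A" "b \<in> carrier A"
  shows "(I +>\<^bsub>A\<^esub> a) \<otimes>\<^bsub>quot_alg A I\<^esub> (I +>\<^bsub>A\<^esub> b) = I +>\<^bsub>A\<^esub> (a \<otimes>\<^bsub>A\<^esub> b)"
    "(I +>\<^bsub>A\<^esub> a) \<oplus>\<^bsub>quot_alg A I\<^esub> (I +>\<^bsub>A\<^esub> b) = I +>\<^bsub>A\<^esub> (a \<oplus>\<^bsub>A\<^esub> b)"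
    "\<one>\<^bsub>quot_alg A I\<^esub> = I +>\<^bsub>A\<^esub> \<one>\<^bsub>A\<^esub>"
  using ring_hom_mult[OF ideal.rcos_ring_hom[OF I] a] ring_hom_add[OF ideal.rcos_ring_hom[OF I] a]
    ring_hom_one[OF ideal.rcos_ring_hom[OF I]] by simp_all

subsection \<open>The free algebra\<close>

definition fm :: "('g list \<Rightarrow>\<^sub>0 'a::field) \<Rightarrow> ('g list \<Rightarrow>\<^sub>0 'a) \<Rightarrow> ('g list \<Rightarrow>\<^sub>0 'a)" where
  "fm = tw (@) (\<lambda>_ _. 1)"

lemma fm_e [simp]: "fm (e v) (e w) = e (v @ w)"
  by (simp add: fm_def)

lemma fm_lin [simp]: "is_lin (fm u)" "is_lin (\<lambda>u. fm u v)"
  by (simp_all add: fm_def)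

lemmas fm_simps [simp] = is_linD[OF fm_lin(1)] is_linD[OF fm_lin(2)]

lemma fm_assoc: "fm (fm u v) w = fm u (fm v w)"
  unfolding fm_def by (rule tw_assoc) auto

lemma fm_unit [simp]: "fm (e []) u = u" "fm u (e []) = u"
  unfolding fm_def by (rule tw_unit tw_unit', simp, simp)+

lemma falg_fm: "falg (typed_alg fm (e []))"
  by (rule falg_typed_alg) (auto simp: is_bilin_def fm_assoc)

lemma coeff_fm: "coeff (fm u v) w = (\<Sum>(x, y) \<in> {(x, y). x @ y = w}. coeff u x * coeff v y)"
proof -
  have fin: "finite {(x, y). x @ y = w}"
  proof (rule finite_subset)
    show "{(x, y). x @ y = w} \<subseteq> (\<lambda>n. (take n w, drop n w)) ` {..length w}"
    proof clarify
      fix x y show "(x, y) \<in> (\<lambda>n. (take n (x @ y), drop n (x @ y))) ` {..length (x @ y)}"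
        by (rule image_eqI[of _ _ "length x"]) simp_all
    qed
  qed simp
  have "coeff (fm u v) w = (\<Sum>(x, y) \<in> keys u \<times> keys v. if x @ y = w then coeff u x * coeff v y else 0)"
    unfolding fm_def coeff_tw sum.cartesian_product
    by (rule sum.cong[OF refl]) (simp add: case_prod_unfold eq_commute[of w])
  also have "\<dots> = (\<Sum>p \<in> (keys u \<times> keys v) \<inter> {(x, y). x @ y = w}. coeff u (fst p) * coeff v (snd p))"
    by (subst sum.inter_restrict) (simp_all add: case_prod_unfold)
  also have "\<dots> = (\<Sum>p \<in> {(x, y). x @ y = w}. coeff u (fst p) * coeff v (snd p))"
    by (rule sum.mono_neutral_left[OF fin]) (auto simp: in_keys_iff)
  also have "\<dots> = (\<Sum>(x, y) \<in> {(x, y). x @ y = w}. coeff u x * coeff v y)"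
    by (simp add: case_prod_unfold)
  finally show ?thesis .
qed

lemma coeff_alg_iso_free:
  "(coeff :: ('g list \<Rightarrow>\<^sub>0 'a::field) \<Rightarrow> _) \<in> alg_iso (typed_alg fm (e [])) free_alg"
proof (rule alg_isoI)
  fix u v :: "'g list \<Rightarrow>\<^sub>0 'a" and c
  show "coeff u \<in> carrier free_alg" by (simp add: free_alg_def)
  show "coeff (u \<otimes>\<^bsub>typed_alg fm (e [])\<^esub> v) = coeff u \<otimes>\<^bsub>free_alg\<^esub> coeff v"
    by (rule ext) (simp only: typed_alg_sel coeff_fm, simp add: free_alg_def)
  show "coeff (u \<oplus>\<^bsub>typed_alg fm (e [])\<^esub> v) = coeff u \<oplus>\<^bsub>free_alg\<^esub> coeff v"
    by (rule ext) (simp add: free_alg_def lookup_add)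
  show "coeff (c \<odot>\<^bsub>typed_alg fm (e [])\<^esub> u) = c \<odot>\<^bsub>free_alg\<^esub> coeff u"
    by (rule ext) (simp add: free_alg_def)
  show "coeff \<one>\<^bsub>typed_alg fm (e [])\<^esub> = \<one>\<^bsub>free_alg\<^esub>"
    by (rule ext) (simp add: free_alg_def coeff_e)
  show "inj_on coeff (carrier (typed_alg fm (e [])))"
    by (simp add: inj_on_def lookup_inject)
  show "f \<in> carrier free_alg \<Longrightarrow> f \<in> coeff ` carrier (typed_alg fm (e []))" for f :: "'g list \<Rightarrow> 'a"
    by (intro image_eqI[of _ _ "Abs_poly_mapping f"]) (auto simp: free_alg_def)
qed

lemma coeff_zero_free: "coeff 0 = \<zero>\<^bsub>free_alg\<^esub>"
  by (auto simp: free_alg_def)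

lemma ring_free_alg: "ring (free_alg :: ('a::field, 'g list \<Rightarrow> 'a) module)"
  by (rule alg_iso_ring_zero[OF coeff_alg_iso_free falgD(1)[OF falg_fm]]) (simp add: coeff_zero_free)

lemma falg_free_alg: "falg (free_alg :: ('a::field, 'g list \<Rightarrow> 'a) module)"
  by (rule falg_alg_iso[OF coeff_alg_iso_free falg_fm ring_free_alg])

lemma coeff_free_ops:
  "coeff u \<in> carrier free_alg"
  "coeff u \<otimes>\<^bsub>free_alg\<^esub> coeff v = coeff (fm u v)"
  "coeff u \<oplus>\<^bsub>free_alg\<^esub> coeff v = coeff (u + v)"
  "coeff u \<ominus>\<^bsub>free_alg\<^esub> coeff v = coeff (u - v)"
  "c \<odot>\<^bsub>free_alg\<^esub> coeff u = coeff (c \<bullet> u)"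
  using alg_isoD(1)[OF coeff_alg_iso_free, of u] alg_isoD(2)[OF coeff_alg_iso_free, of u v]
    alg_isoD(3)[OF coeff_alg_iso_free, of u v]
    alg_isoD(5)[OF coeff_alg_iso_free, of u c]
    alg_iso_minus[OF coeff_alg_iso_free falgD(1)[OF falg_fm] ring_free_alg, of u v]
  by (simp_all add: typed_alg_minus[OF falgD(1)[OF falg_fm]])

lemma coeff_one_free: "\<one>\<^bsub>free_alg\<^esub> = coeff (e [] :: 'g list \<Rightarrow>\<^sub>0 'a::field)"
  by (simp add: free_alg_def coeff_e fun_eq_iff)

lemma free_gen_eq: "free_gen g = coeff (e [g])"
  by (simp add: free_gen_def coeff_e fun_eq_iff)

section \<open>Two-sided ideals of the free algebra and the defining relations\<close>

definition tideal :: "('g list \<Rightarrow>\<^sub>0 'a::field) set \<Rightarrow> bool" where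
  "tideal J \<longleftrightarrow> subspc J \<and> (\<forall>u v. u \<in> J \<longrightarrow> fm v u \<in> J \<and> fm u v \<in> J)"

lemma tidealD:
  assumes "tideal J"
  shows "subspc J" "u \<in> J \<Longrightarrow> fm v u \<in> J" "u \<in> J \<Longrightarrow> fm u v \<in> J"
  using assms by (auto simp: tideal_def)

lemma tideal_ideal:
  assumes "ideal I free_alg"
  shows "tideal {u. coeff u \<in> I}"
proof -
  interpret ideal I free_alg by fact
  have "coeff (fm v u) \<in> I" "coeff (fm u v) \<in> I" if "coeff u \<in> I" for u v :: "'a list \<Rightarrow>\<^sub>0 'b"
    using I_l_closed[OF that coeff_free_ops(1)[of v]] I_r_closed[OF that coeff_free_ops(1)[of v]]
    by (simp_all add: coeff_free_ops)
  moreover have "coeff (c \<bullet> u) \<in> I" if "coeff u \<in> I" for c and u :: "'a list \<Rightarrow>\<^sub>0 'b"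
    using ideal_smult[OF assms falg_free_alg that, of c] by (simp add: coeff_free_ops)
  moreover have "coeff (u + v) \<in> I" if "coeff u \<in> I" "coeff v \<in> I" for u v :: "'a list \<Rightarrow>\<^sub>0 'b"
    using additive_subgroup.a_closed[OF additive_subgroup_axioms that] by (simp add: coeff_free_ops)
  moreover have "coeff 0 \<in> I"
    unfolding coeff_zero_free by (rule additive_subgroup.zero_closed[OF additive_subgroup_axioms])
  ultimately show ?thesis by (simp add: tideal_def subspc_def)
qed

lemma ideal_tideal:
  assumes J: "tideal J"
  shows "ideal (coeff ` J) free_alg"
proof (rule idealI[OF ring_free_alg])
  interpret ring "free_alg :: ('b, 'a list \<Rightarrow> 'b) module" by (rule ring_free_alg)
  note s = subspcD[OF tidealD(1)[OF J]]
  show "subgroup (coeff ` J) (add_monoid free_alg)"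
  proof (rule group.subgroupI[OF a_group])
    fix f assume "f \<in> coeff ` J"
    then obtain u where u: "u \<in> J" "f = coeff u" by auto
    have "\<ominus>\<^bsub>free_alg\<^esub> f = coeff (- u)"
    proof (rule minus_equality)
      show "coeff (- u) \<oplus>\<^bsub>free_alg\<^esub> f = \<zero>\<^bsub>free_alg\<^esub>"
        using coeff_free_ops(3)[of "- u" u] by (simp add: u coeff_zero_free)
    qed (auto simp: u coeff_free_ops)
    then have "inv\<^bsub>add_monoid free_alg\<^esub> f = coeff (- u)" by (simp add: a_inv_def)
    then show "inv\<^bsub>add_monoid free_alg\<^esub> f \<in> coeff ` J" using s(4)[OF u(1)] by auto
  qed (use s(1,2) in \<open>auto simp: coeff_free_ops\<close>)
  fix f g :: "'a list \<Rightarrow> 'b" assume "f \<in> coeff ` J" "g \<in> carrier free_alg"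
  moreover have "g = coeff (Abs_poly_mapping g)"
    using \<open>g \<in> carrier free_alg\<close> by (simp add: free_alg_def)
  ultimately obtain u v where "u \<in> J" "f = coeff u" "g = coeff v"
    by blast
  then show "g \<otimes>\<^bsub>free_alg\<^esub> f \<in> coeff ` J" "f \<otimes>\<^bsub>free_alg\<^esub> g \<in> coeff ` J"
    using tidealD(2,3)[OF J] by (auto simp: coeff_free_ops)
qed

text \<open>The common shape of the three presentations: T and its two graded algebras differ in
  which of \<open>A\<close>, \<open>B\<close>, \<open>C\<close> vanish.\<close>

definition rels3 :: "'a::field \<Rightarrow> 'a \<Rightarrow> 'a \<Rightarrow> 'a \<Rightarrow> (gen list \<Rightarrow>\<^sub>0 'a) set" where
  "rels3 q A B C =
    {e [X1, X2] - q \<bullet> e [X2, X1] - A \<bullet> e [X3], e [X2, X3] - q \<bullet> e [X3, X2] - B \<bullet> e [X1],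
     e [X3, X1] - q \<bullet> e [X1, X3] - C \<bullet> e [X2]}"

lemma T_rels_eq: "T_rels q = coeff ` rels3 q (1 - q^2) (inverse q - q) (inverse q - q)"
  by (simp add: T_rels_def Let_def qcomm_def free_gen_eq coeff_free_ops rels3_def)

lemma gr_rels_ii_eq: "gr_rels_ii q = coeff ` rels3 q (1 - q^2) 0 (inverse q - q)"
  by (simp add: gr_rels_ii_def Let_def qcomm_def free_gen_eq coeff_free_ops rels3_def)

lemma gr_rels_iii_eq: "gr_rels_iii q = coeff ` rels3 q 0 0 0"
  by (simp add: gr_rels_iii_def Let_def qcomm_def free_gen_eq coeff_free_ops rels3_def)

section \<open>The Poincare--Birkhoff--Witt basis\<close>

fun fmon :: "idx \<Rightarrow> gen list" where
  "fmon (i, j, k) = replicate i X3 @ replicate j X2 @ replicate k X1"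

text \<open>Normal words regarded inside the free algebra; a linear section of the normal form map
  \<open>N\<close>.\<close>

definition iota :: "(idx \<Rightarrow>\<^sub>0 'a::field) \<Rightarrow> (gen list \<Rightarrow>\<^sub>0 'a)" where
  "iota = lin (\<lambda>m. e (fmon m))"

lemma iota_lin [simp]: "is_lin iota"
  by (simp add: iota_def)

lemmas iota_simps [simp] = is_linD[OF iota_lin]

lemma iota_e [simp]: "iota (e m) = e (fmon m)"
  by (simp add: iota_def)

fun gidx :: "gen \<Rightarrow> idx" where
  "gidx X1 = (0, 0, 1)" | "gidx X2 = (0, 1, 0)" | "gidx X3 = (1, 0, 0)"

lemma fmon_gidx [simp]: "fmon (gidx g) = [g]"
  by (cases g) auto

lemma wt_gidx [simp]: "wt d (gidx g) = d g"
  by (cases g) auto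

section \<open>The free algebra acting on normal forms\<close>

context qalg3
begin

lemma foldr_L_lin [simp]: "is_lin (foldr L w)"
proof (induction w)
  case Nil
  then show ?case by (simp add: is_lin_def)
next
  case (Cons g w)
  then show ?case using is_lin_comp[OF is_lin_L[of g] Cons] by (simp add: o_def)
qed

definition Act :: "(gen list \<Rightarrow>\<^sub>0 'a) \<Rightarrow> (idx \<Rightarrow>\<^sub>0 'a) \<Rightarrow> (idx \<Rightarrow>\<^sub>0 'a)" where
  "Act u v = lin (\<lambda>w. foldr L w v) u"

lemma Act_lin: "is_lin (Act u)" "is_lin (\<lambda>u. Act u v)"
  unfolding Act_def by (rule is_lin_lin_param, simp) simp

lemmas Act_simps [simp] = is_linD[OF Act_lin(1)] is_linD[OF Act_lin(2)]

lemma Act_e [simp]: "Act (e w) v = foldr L w v"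
  by (simp add: Act_def)

lemma Act_fm: "Act (fm u v) x = Act u (Act v x)"
  by (rule is_bilin_ext[of "\<lambda>u v. Act (fm u v) x" "\<lambda>u v. Act u (Act v x)"])
    (simp_all add: is_bilin_def is_lin_def)

definition N :: "(gen list \<Rightarrow>\<^sub>0 'a) \<Rightarrow> (idx \<Rightarrow>\<^sub>0 'a)" where
  "N u = Act u (e (0, 0, 0))"

lemma N_lin [simp]: "is_lin N"
  unfolding N_def by (rule Act_lin)

lemmas N_simps [simp] = is_linD[OF N_lin]

lemma foldr_fmon: "foldr L (fmon m) (e (0, 0, 0)) = e m"
proof -
  obtain i j k where m: "m = (i, j, k)" by (cases m)
  have 1: "foldr L (replicate k X1) (e (0, 0, 0)) = e (0, 0, k)" by (induction k) simp_all
  have 2: "foldr L (replicate j X2) (e (0, 0, k)) = e (0, j, k)" by (induction j) simp_all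
  have 3: "foldr L (replicate i X3) (e (0, j, k)) = e (i, j, k)" by (induction i) simp_all
  show ?thesis by (simp only: m fmon.simps foldr_append 1 2 3)
qed

text \<open>A normal word applied to the empty word rebuilds itself letter by letter without
  rewriting; this is the linear independence of the normal words.\<close>

lemma N_iota [simp]: "N (iota v) = v"
  by (rule is_lin_ext[of "\<lambda>v. N (iota v)" "\<lambda>v. v"])
    (simp_all add: is_lin_def N_def foldr_fmon)

lemma tideal_ker: "tideal {u. \<forall>v. Act u v = 0}"
  by (simp add: tideal_def subspc_def Act_fm)

text \<open>The relations are the operator identities \<open>rel12\<close>, \<open>rel23\<close> and
  \<open>rel13\<close>; together with \<open>tideal_ker\<close> they show that every element of the
  generated ideal acts as zero.\<close>

lemma rels_ker: "rels3 q A B C \<subseteq> {u. \<forall>v. Act u v = 0}"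
  by (simp add: rels3_def rel12 rel13 rel23 mult_inverse_cancel)

section \<open>Spanning by normal words modulo an ideal that contains the relations\<close>

context
  fixes J :: "(gen list \<Rightarrow>\<^sub>0 'a) set"
  assumes J: "tideal J" "rels3 q A B C \<subseteq> J"
begin

lemma iota_X3: "fm (e [X3]) (iota v) = iota (L X3 v)"
  by (rule is_lin_ext[of "\<lambda>v. fm (e [X3]) (iota v)" "\<lambda>v. iota (L X3 v)"])
    (auto simp: is_lin_def)

lemmas J_sub = subspcD[OF tidealD(1)[OF J(1)]]

text \<open>The recursive clauses of \<open>bas\<close> are the relations multiplied on the right by
  the remaining word; adding multiples of the induction hypotheses replaces each intermediate word
  by its normal form.\<close>

lemma span_bas: "e (g # fmon (i, j, k)) - iota (bas g i j k) \<in> J"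
proof (induction g i j k rule: bas.induct)
  case (3 i j k)
  let ?w = "fmon (i, j, k)" and ?b1 = "bas X1 i j k" and ?b2 = "bas X2 i j k"
  have "e [X2, X3] - q \<bullet> e [X3, X2] - B \<bullet> e [X1] \<in> J" using J(2) by (simp add: rels3_def)
  then have "fm (e [X2, X3] - q \<bullet> e [X3, X2] - B \<bullet> e [X1]) (e ?w) \<in> J" by (rule tidealD(3)[OF J(1)])
  moreover have "fm (e [X3]) (e (X2 # ?w) - iota ?b2) \<in> J" by (rule tidealD(2)[OF J(1) 3(1)])
  ultimately have "fm (e [X2, X3] - q \<bullet> e [X3, X2] - B \<bullet> e [X1]) (e ?w)
      + q \<bullet> fm (e [X3]) (e (X2 # ?w) - iota ?b2) + B \<bullet> (e (X1 # ?w) - iota ?b1) \<in> J"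
    by (intro J_sub 3(2))
  then show ?case by (simp add: iota_X3 algebra_simps)
next
  case (4 j k)
  let ?w = "fmon (0, j, k)" and ?b = "bas X1 0 j k"
  have "e [X1, X2] - q \<bullet> e [X2, X1] - A \<bullet> e [X3] \<in> J" using J(2) by (simp add: rels3_def)
  then have 1: "fm (e [X1, X2] - q \<bullet> e [X2, X1] - A \<bullet> e [X3]) (e ?w) \<in> J" by (rule tidealD(3)[OF J(1)])
  have 2: "fm (e [X2]) (e (X1 # ?w) - iota ?b) \<in> J" by (rule tidealD(2)[OF J(1) 4(2)])
  \<comment> \<open>The normal form of x1 x2^j x1^k is a combination of words; x2 times it is
    rewritten word by word, each within the degree bound of the induction hypothesis.\<close>
  have 3: "fm (e [X2]) (iota ?b) - iota (L X2 ?b) \<in> J"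
  proof (rule subspc_is_lin[of "\<lambda>b. fm (e [X2]) (iota b) - iota (L X2 b)"])
    fix m assume "m \<in> keys ?b"
    then have "fst m + fst (snd m) \<le> j" using supp_in_keysD[OF bas_degree[of X1 0 j k], of m] by simp
    from 4(1)[OF this] show "fm (e [X2]) (iota (e m)) - iota (L X2 (e m)) \<in> J" by (cases m) simp
  qed (simp_all add: is_lin_def tidealD(1)[OF J(1)])
  have "fm (e [X1, X2] - q \<bullet> e [X2, X1] - A \<bullet> e [X3]) (e ?w)
      + q \<bullet> fm (e [X2]) (e (X1 # ?w) - iota ?b) + q \<bullet> (fm (e [X2]) (iota ?b) - iota (L X2 ?b)) \<in> J"
    by (intro J_sub 1 2 3)
  then show ?case by (simp add: bas_X1_Suc algebra_simps)
next
  case (6 i j k)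
  let ?w = "fmon (i, j, k)" and ?b1 = "bas X1 i j k" and ?b2 = "bas X2 i j k"
  have "e [X3, X1] - q \<bullet> e [X1, X3] - C \<bullet> e [X2] \<in> J" using J(2) by (simp add: rels3_def)
  then have "fm (e [X3, X1] - q \<bullet> e [X1, X3] - C \<bullet> e [X2]) (e ?w) \<in> J" by (rule tidealD(3)[OF J(1)])
  moreover have "fm (e [X3]) (e (X1 # ?w) - iota ?b1) \<in> J" by (rule tidealD(2)[OF J(1) 6(1)])
  ultimately have "inverse q \<bullet> fm (e [X3]) (e (X1 # ?w) - iota ?b1)
      - inverse q \<bullet> fm (e [X3, X1] - q \<bullet> e [X1, X3] - C \<bullet> e [X2]) (e ?w)
      - (inverse q * C) \<bullet> (e (X2 # ?w) - iota ?b2) \<in> J"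
    by (intro J_sub 6(2))
  then show ?case by (simp add: iota_X3 algebra_simps)
qed (simp_all add: subspcD[OF tidealD(1)[OF J(1)]])

lemma span_gen: "fm (e [g]) (iota v) - iota (L g v) \<in> J"
proof (rule subspc_is_lin[of "\<lambda>v. fm (e [g]) (iota v) - iota (L g v)"])
  fix m :: idx
  show "fm (e [g]) (iota (e m)) - iota (L g (e m)) \<in> J"
    using span_bas by (cases m) simp
qed (simp_all add: is_lin_def tidealD(1)[OF J(1)])

lemma span_word: "e w - iota (foldr L w (e (0, 0, 0))) \<in> J"
proof (induction w)
  case Nil
  then show ?case by (simp add: subspcD[OF tidealD(1)[OF J(1)]])
next
  case (Cons g w)
  let ?v = "foldr L w (e (0, 0, 0))"
  have "fm (e [g]) (e w - iota ?v) + (fm (e [g]) (iota ?v) - iota (L g ?v)) \<in> J"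
    by (intro subspcD(2)[OF tidealD(1)[OF J(1)]] tidealD(2)[OF J(1)] Cons span_gen)
  then show ?case by simp
qed

text \<open>The ideal is arbitrary because three are used: the generated ideal, the kernel of the
  action, and the kernel of the evaluation in the quantum torus.\<close>

lemma span: "u - iota (N u) \<in> J"
proof (rule subspc_is_lin[of "\<lambda>u. u - iota (N u)"])
  fix w show "e w - iota (N (e w)) \<in> J" using span_word by (simp add: N_def)
qed (simp_all add: is_lin_def tidealD(1)[OF J(1)])

end

section \<open>The algebra of normal forms and its identification with the presented algebra\<close>

lemma Act_iota_N: "Act (iota (N u)) v = Act u v"
  using span[OF tideal_ker rels_ker, of u] by simp

text \<open>By \<open>N_fm\<close> this is the product for which the normal form map is
  multiplicative.\<close>

definition vm :: "(idx \<Rightarrow>\<^sub>0 'a) \<Rightarrow> (idx \<Rightarrow>\<^sub>0 'a) \<Rightarrow> (idx \<Rightarrow>\<^sub>0 'a)" where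
  "vm u v = Act (iota u) v"

lemma N_fm: "N (fm u v) = vm (N u) (N v)"
  by (simp add: vm_def Act_iota_N) (simp add: N_def Act_fm)

lemma vm_lin [simp]: "is_lin (vm u)" "is_lin (\<lambda>u. vm u v)"
  by (simp_all add: vm_def is_lin_def)

lemmas vm_simps [simp] = is_linD[OF vm_lin(1)] is_linD[OF vm_lin(2)]

text \<open>Inherited from the free algebra, since \<open>N\<close> is multiplicative and
  \<open>iota\<close> is a section of it.\<close>

lemma vm_assoc: "vm (vm u v) w = vm u (vm v w)"
  using N_fm[of "fm (iota u) (iota v)" "iota w"] N_fm[of "iota u" "fm (iota v) (iota w)"]
    N_fm[of "iota u" "iota v"] N_fm[of "iota v" "iota w"]
  by (simp add: fm_assoc)

lemma vm_one [simp]: "vm (e (0, 0, 0)) v = v" "vm v (e (0, 0, 0)) = v"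
  using N_iota[of v] by (simp_all add: vm_def N_def)

lemma vm_e: "vm (e m) v = foldr L (fmon m) v"
  by (simp add: vm_def)

lemma vm_gen [simp]: "vm (e (gidx g)) v = L g v"
  by (simp add: vm_e)

abbreviation "Valg \<equiv> typed_alg vm (e (0, 0, 0))"

lemma falg_Valg: "falg Valg"
  by (rule falg_typed_alg) (simp_all add: is_bilin_def vm_assoc)

abbreviation "relI \<equiv> Idl\<^bsub>free_alg\<^esub> (coeff ` rels3 q A B C)"
abbreviation "T \<equiv> presented_alg (coeff ` rels3 q A B C)"

definition psi :: "(idx \<Rightarrow>\<^sub>0 'a) \<Rightarrow> (gen list \<Rightarrow> 'a) set" where
  "psi v = relI +>\<^bsub>free_alg\<^esub> coeff (iota v)"

lemma rels_carrier: "coeff ` rels3 q A B C \<subseteq> carrier free_alg"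
  using coeff_free_ops(1) by blast

lemma ideal_rels: "ideal relI free_alg"
  by (rule ring.genideal_ideal[OF ring_free_alg rels_carrier])

text \<open>Elements of the generated ideal act as zero; conversely, by \<open>span\<close>, every
  element agrees with its normal form modulo that ideal.\<close>

lemma Idl_rels_iff: "coeff u \<in> relI \<longleftrightarrow> N u = 0"
proof
  assume "coeff u \<in> relI"
  also have "\<dots> \<subseteq> coeff ` {u. \<forall>v. Act u v = 0}"
    using rels_ker by (intro ring.genideal_minimal[OF ring_free_alg] ideal_tideal[OF tideal_ker]) auto
  finally show "N u = 0" by (auto simp: lookup_inject N_def)
next
  assume "N u = 0"
  moreover have "rels3 q A B C \<subseteq> {u. coeff u \<in> relI}"
    using ring.genideal_self[OF ring_free_alg, of "coeff ` rels3 q A B C"] rels_carrier by auto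
  ultimately show "coeff u \<in> relI"
    using span[OF tideal_ideal[OF ideal_rels], of u] by simp
qed

lemma coset_eq_iff:
  "relI +>\<^bsub>free_alg\<^esub> coeff u =
   relI +>\<^bsub>free_alg\<^esub> coeff v \<longleftrightarrow> N u = N v"
  by (simp add: quot_alg_coset_eq[OF ideal_rels coeff_free_ops(1) coeff_free_ops(1)]
      coeff_free_ops(4) Idl_rels_iff)

lemma psi_N: "psi (N u) = relI +>\<^bsub>free_alg\<^esub> coeff u"
  unfolding psi_def by (subst coset_eq_iff) simp

text \<open>\<open>psi\<close> inverts the map that \<open>N\<close> induces on the quotient, so
  each operation is checked on representatives through \<open>psi_N\<close>.\<close>

theorem psi_iso: "psi \<in> alg_iso Valg T"
proof (rule alg_isoI)
  fix u v :: "idx \<Rightarrow>\<^sub>0 'a" and c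
  note cosets = coeff_free_ops(1) ideal_rels
  note ops = quot_alg_coset_ops[OF ideal_rels coeff_free_ops(1) coeff_free_ops(1)]
  show "psi u \<in> carrier T"
    unfolding presented_alg_def psi_def by (rule quot_alg_coset[OF ideal_rels coeff_free_ops(1)])
  have "psi (N (fm (iota u) (iota v))) = psi u \<otimes>\<^bsub>T\<^esub> psi v"
    unfolding psi_N unfolding presented_alg_def psi_def ops coeff_free_ops ..
  then show "psi (u \<otimes>\<^bsub>Valg\<^esub> v) = psi u \<otimes>\<^bsub>T\<^esub> psi v"
    by (simp add: N_fm)
  have "psi (N (iota u + iota v)) = psi u \<oplus>\<^bsub>T\<^esub> psi v"
    unfolding psi_N unfolding presented_alg_def psi_def ops coeff_free_ops ..
  then show "psi (u \<oplus>\<^bsub>Valg\<^esub> v) = psi u \<oplus>\<^bsub>T\<^esub> psi v"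
    by simp
  have "psi (N (c \<bullet> iota u)) = c \<odot>\<^bsub>T\<^esub> psi u"
    unfolding psi_N unfolding presented_alg_def psi_def
      quot_alg_coset_smult[OF ideal_rels falg_free_alg coeff_free_ops(1)] coeff_free_ops ..
  then show "psi (c \<odot>\<^bsub>Valg\<^esub> u) = c \<odot>\<^bsub>T\<^esub> psi u"
    by simp
  have "psi (N (e [])) = \<one>\<^bsub>T\<^esub>"
    unfolding psi_N unfolding presented_alg_def quot_alg_coset_ops(3)[OF ideal_rels coeff_free_ops(1) coeff_free_ops(1)]
      coeff_one_free ..
  then show "psi \<one>\<^bsub>Valg\<^esub> = \<one>\<^bsub>T\<^esub>"
    by (simp add: N_def)
  show "inj_on psi (carrier Valg)"
    by (rule inj_onI) (use coset_eq_iff in \<open>simp add: psi_def\<close>)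
  fix X assume "X \<in> carrier T"
  then obtain f where f: "f \<in> carrier free_alg" "X = relI +>\<^bsub>free_alg\<^esub> f"
    unfolding presented_alg_def by (rule quot_alg_cases[OF ideal_rels])
  have "f = coeff (Abs_poly_mapping f)" using f(1) by (simp add: free_alg_def)
  then have "X = psi (N (Abs_poly_mapping f))" unfolding psi_N f(2) by (rule arg_cong)
  then show "X \<in> psi ` carrier Valg" by simp
qed

lemma psi_gen: "psi (e (gidx g)) = presented_gen (coeff ` rels3 q A B C) g"
  by (simp add: psi_def presented_gen_def free_gen_eq)

lemma ring_presented: "ring T"
  unfolding presented_alg_def by (rule ring_quot_alg[OF ideal_rels])

lemma falg_presented: "falg T"
  by (rule falg_alg_iso[OF psi_iso falg_Valg ring_presented])

lemma vm_pow: "vm (e (gidx g) [^]\<^bsub>Valg\<^esub> (n::nat)) v = foldr L (replicate n g) v"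
proof (induction n arbitrary: v)
  case (Suc n)
  interpret ring Valg by (rule falgD[OF falg_Valg])
  have "vm (e (gidx g) [^]\<^bsub>Valg\<^esub> Suc n) v = vm (e (gidx g) [^]\<^bsub>Valg\<^esub> n) (vm (e (gidx g)) v)"
    by (simp add: vm_assoc)
  then show ?case
    by (simp only: Suc vm_gen) (simp add: funpow_swap1)
qed simp

lemma Valg_pow: "e (gidx g) [^]\<^bsub>Valg\<^esub> (n::nat) = foldr L (replicate n g) (e (0, 0, 0))"
  using vm_pow[of g n "e (0, 0, 0)"] by (simp only: vm_one)

lemma Valg_monomial:
  "e (gidx X3) [^]\<^bsub>Valg\<^esub> i \<otimes>\<^bsub>Valg\<^esub> e (gidx X2) [^]\<^bsub>Valg\<^esub> j \<otimes>\<^bsub>Valg\<^esub> e (gidx X1) [^]\<^bsub>Valg\<^esub> k = e (i, j, k)"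
  using foldr_fmon[of "(i, j, k)"] by (simp only: typed_alg_sel vm_assoc) (simp only: vm_pow, simp only: Valg_pow fmon.simps foldr_append)

end

lemma is_basis_alg_iso:
  assumes h: "h \<in> alg_iso (typed_alg m i) A" and V: "falg (typed_alg m i)" and A: "ring A"
    and v: "\<And>x. v x = h (e x)"
  shows "is_basis A v"
  unfolding is_basis_def
proof (intro conjI ballI)
  show "range v \<subseteq> carrier A" using alg_isoD(1)[OF h] by (auto simp: v)
  have sum: "(\<Oplus>\<^bsub>A\<^esub>x\<in>{x. c x \<noteq> 0}. c x \<odot>\<^bsub>A\<^esub> v x) = h (Abs_poly_mapping c)"
    if "finite {x. c x \<noteq> 0}" for c
  proof -
    have "h (\<Oplus>\<^bsub>typed_alg m i\<^esub>x\<in>{x. c x \<noteq> 0}. c x \<bullet> e x) = (\<Oplus>\<^bsub>A\<^esub>x\<in>{x. c x \<noteq> 0}. h (c x \<bullet> e x))"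
      by (rule alg_iso_finsum[OF h falgD(1)[OF V] A]) simp
    also have "(\<lambda>x. h (c x \<bullet> e x)) = (\<lambda>x. c x \<odot>\<^bsub>A\<^esub> v x)"
      using alg_isoD(5)[OF h] by (auto simp: v)
    also have "(\<Oplus>\<^bsub>typed_alg m i\<^esub>x\<in>{x. c x \<noteq> 0}. c x \<bullet> e x) = lin e (Abs_poly_mapping c)"
      using that by (simp add: typed_alg_finsum[OF falgD(1)[OF V]] lin_def keys.abs_eq eq_onp_def)
    finally show ?thesis by (simp add: lin_expand)
  qed
  fix a assume "a \<in> carrier A"
  then obtain u where u: "a = h u" using alg_isoD(7)[OF h] by auto
  show "\<exists>!c. finite {x. c x \<noteq> 0} \<and> a = (\<Oplus>\<^bsub>A\<^esub>x\<in>{x. c x \<noteq> 0}. c x \<odot>\<^bsub>A\<^esub> v x)"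
  proof (rule ex1I[of _ "coeff u"])
    show "finite {x. coeff u x \<noteq> 0} \<and> a = (\<Oplus>\<^bsub>A\<^esub>x\<in>{x. coeff u x \<noteq> 0}. coeff u x \<odot>\<^bsub>A\<^esub> v x)"
      using sum[of "coeff u"] by (simp add: u lookup_inverse)
    fix c assume c: "finite {x. c x \<noteq> 0} \<and> a = (\<Oplus>\<^bsub>A\<^esub>x\<in>{x. c x \<noteq> 0}. c x \<odot>\<^bsub>A\<^esub> v x)"
    then have "h (Abs_poly_mapping c) = h u" using sum[OF conjunct1[OF c]] u by metis
    then have "Abs_poly_mapping c = u" using alg_isoD(6)[OF h] by (simp add: inj_on_def)
    moreover have "coeff (Abs_poly_mapping c) = c" using conjunct1[OF c] by simp
    ultimately show "c = coeff u" by simp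
  qed
qed

context qalg3
begin

theorem presented_basis:
  defines "P \<equiv> T" and "x \<equiv> presented_gen (coeff ` rels3 q A B C)"
  shows "is_basis P (\<lambda>(i :: nat, j :: nat, k :: nat). x X3 [^]\<^bsub>P\<^esub> i \<otimes>\<^bsub>P\<^esub> x X2 [^]\<^bsub>P\<^esub> j \<otimes>\<^bsub>P\<^esub> x X1 [^]\<^bsub>P\<^esub> k)"
proof (rule is_basis_alg_iso[OF psi_iso falg_Valg, folded P_def])
  show "ring P" unfolding P_def by (rule ring_presented)
  interpret V: ring Valg by (rule falgD[OF falg_Valg])
  have "x X3 [^]\<^bsub>P\<^esub> i \<otimes>\<^bsub>P\<^esub> x X2 [^]\<^bsub>P\<^esub> j \<otimes>\<^bsub>P\<^esub> x X1 [^]\<^bsub>P\<^esub> k = psi (e (i, j, k))" for i j k :: nat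
  proof -
    have "psi (e (i, j, k)) = psi (e (gidx X3) [^]\<^bsub>Valg\<^esub> i \<otimes>\<^bsub>Valg\<^esub> e (gidx X2) [^]\<^bsub>Valg\<^esub> j
        \<otimes>\<^bsub>Valg\<^esub> e (gidx X1) [^]\<^bsub>Valg\<^esub> k)"
      by (simp only: Valg_monomial)
    also have "\<dots> = x X3 [^]\<^bsub>P\<^esub> i \<otimes>\<^bsub>P\<^esub> x X2 [^]\<^bsub>P\<^esub> j \<otimes>\<^bsub>P\<^esub> x X1 [^]\<^bsub>P\<^esub> k"
      unfolding P_def x_def psi_gen[symmetric]
      by (simp only: alg_isoD(2)[OF psi_iso] alg_iso_pow[OF psi_iso V.ring_axioms] typed_alg_sel(1) UNIV_I)
    finally show ?thesis ..
  qed
  then show "(case m of (i, j, k) \<Rightarrow> x X3 [^]\<^bsub>P\<^esub> i \<otimes>\<^bsub>P\<^esub> x X2 [^]\<^bsub>P\<^esub> j \<otimes>\<^bsub>P\<^esub> x X1 [^]\<^bsub>P\<^esub> k) = psi (e m)" for m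
    by (cases m) simp
qed

end

section \<open>Associated graded algebras\<close>

lemma e_inject: "(e m :: 'b \<Rightarrow>\<^sub>0 'a::field) = e n \<longleftrightarrow> m = n"
  by (metis coeff_e zero_neq_one)

lemma supp_inD: "u \<in> supp_in P \<Longrightarrow> \<not> P m \<Longrightarrow> coeff u m = 0"
  by (auto simp: supp_in_def)

lemma alg_iso_typed_finsum:
  assumes h: "h \<in> alg_iso (typed_alg m i) R" and V: "falg (typed_alg m i)" and R: "ring R"
  shows "(\<Oplus>\<^bsub>R\<^esub>x\<in>S. h (f x)) = h (\<Sum>x\<in>S. f x)"
  using alg_iso_finsum[OF h falgD(1)[OF V] R, of f S] by (simp add: typed_alg_finsum[OF falgD(1)[OF V]])

text \<open>\<open>lin_span\<close> indexes coefficients by the spanning elements themselves, so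
  passing between the two algebras means reindexing along the injective map
  \<open>h\<close>.\<close>

lemma alg_iso_lin_span:
  assumes h: "h \<in> alg_iso (typed_alg m i) R" and V: "falg (typed_alg m i)" and R: "ring R"
  shows "lin_span R (h ` S) = h ` {\<Sum>s\<in>B. c s \<bullet> s | c B. finite B \<and> B \<subseteq> S}" (is "_ = h ` ?T")
proof -
  interpret ring R by (rule R)
  have inj: "inj_on h B" for B
    using alg_isoD(6)[OF h] by (rule inj_on_subset) simp
  have *: "(\<Oplus>\<^bsub>R\<^esub>s\<in>h ` B. c s \<odot>\<^bsub>R\<^esub> s) = h (\<Sum>s\<in>B. c (h s) \<bullet> s)" for c B
  proof -
    have "(\<Oplus>\<^bsub>R\<^esub>s\<in>h ` B. c s \<odot>\<^bsub>R\<^esub> s) = (\<Oplus>\<^bsub>R\<^esub>s\<in>h ` B. h (c s \<bullet> inv_into UNIV h s))"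
    proof (rule finsum_cong')
      fix s assume "s \<in> h ` B"
      then show "c s \<odot>\<^bsub>R\<^esub> s = h (c s \<bullet> inv_into UNIV h s)"
        using alg_isoD(5)[OF h] inj[of UNIV] by auto
    qed (use alg_isoD(1)[OF h] in auto)
    also have "\<dots> = (\<Oplus>\<^bsub>R\<^esub>s\<in>B. h (c (h s) \<bullet> s))"
      by (subst finsum_reindex[OF _ inj]) (use alg_isoD(1)[OF h] inj[of UNIV] in auto)
    also have "\<dots> = h (\<Sum>s\<in>B. c (h s) \<bullet> s)"
      by (rule alg_iso_typed_finsum[OF h V R])
    finally show ?thesis .
  qed
  show ?thesis
  proof (intro equalityI subsetI)
    fix a assume "a \<in> lin_span R (h ` S)"
    then obtain c D where D: "finite D" "D \<subseteq> h ` S" "a = (\<Oplus>\<^bsub>R\<^esub>s\<in>D. c s \<odot>\<^bsub>R\<^esub> s)"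
      by (auto simp: lin_span_def)
    obtain B where B: "B \<subseteq> S" "finite B" "D = h ` B"
      using finite_subset_image[OF D(1,2)] by blast
    have "a = h (\<Sum>s\<in>B. (\<lambda>s. c (h s)) s \<bullet> s)" unfolding D(3) B(3) * ..
    moreover have "(\<Sum>s\<in>B. (\<lambda>s. c (h s)) s \<bullet> s) \<in> ?T"
      unfolding mem_Collect_eq by (rule exI[of _ "\<lambda>s. c (h s)"], rule exI[of _ B]) (simp add: B)
    ultimately show "a \<in> h ` ?T" by blast
  next
    fix a assume "a \<in> h ` ?T"
    then obtain c B where B: "finite B" "B \<subseteq> S" "a = h (\<Sum>s\<in>B. c s \<bullet> s)" by blast
    have "a = (\<Oplus>\<^bsub>R\<^esub>s\<in>h ` B. c (inv_into UNIV h s) \<odot>\<^bsub>R\<^esub> s)"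
      unfolding * B(3) using inj[of UNIV] by simp
    then show "a \<in> lin_span R (h ` S)" unfolding lin_span_def mem_Collect_eq
      by (intro exI[of _ "\<lambda>s. c (inv_into UNIV h s)"] exI[of _ "h ` B"]) (use B(1,2) in auto)
  qed
qed

lemma alg_iso_lin_subspace:
  assumes h: "h \<in> alg_iso (typed_alg m i) R" and V: "falg (typed_alg m i)" and R: "ring R" and W: "subspc W"
  shows "lin_subspace R (h ` W)"
  unfolding lin_subspace_def
proof (intro conjI allI ballI)
  interpret ring R by (rule R)
  note hh = alg_isoD(1,3,5)[OF h] alg_iso_zero[OF h falgD(1)[OF V] R]
  show "additive_subgroup (h ` W) R"
  proof (rule additive_subgroup.intro, rule group.subgroupI[OF a_group])
    fix a assume "a \<in> h ` W"
    then obtain u where u: "u \<in> W" "a = h u" by auto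
    have "\<ominus>\<^bsub>R\<^esub> a = h (- u)"
    proof (rule minus_equality)
      show "h (- u) \<oplus>\<^bsub>R\<^esub> a = \<zero>\<^bsub>R\<^esub>" using hh(2)[of "- u" u] hh(4) by (simp add: u)
    qed (use hh in \<open>auto simp: u\<close>)
    then show "inv\<^bsub>add_monoid R\<^esub> a \<in> h ` W" using subspcD(4)[OF W u(1)] by (simp add: a_inv_def)
  next
    fix a b assume "a \<in> h ` W" "b \<in> h ` W"
    then obtain u v where u: "u \<in> W" "a = h u" "v \<in> W" "b = h v" by auto
    have "h (u + v) = a \<oplus>\<^bsub>R\<^esub> b" using hh(2)[of u v] by (simp add: u)
    then show "a \<otimes>\<^bsub>add_monoid R\<^esub> b \<in> h ` W" using subspcD(2)[OF W u(1,3)] by (simp, metis imageI)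
  qed (use hh(1) subspcD(1)[OF W] in auto)
  fix c v assume "v \<in> h ` W"
  then obtain u where u: "u \<in> W" "v = h u" by auto
  have "h (c \<bullet> u) = c \<odot>\<^bsub>R\<^esub> v" using hh(3)[of u c] by (simp add: u)
  then show "c \<odot>\<^bsub>R\<^esub> v \<in> h ` W" using subspcD(3)[OF W u(1), of c] by (metis imageI)
qed

lemma sum_list_fmon [simp]: "sum_list (map d (fmon m)) = wt d m"
  by (cases m) (simp add: sum_list_replicate)

context qalg3_weight
begin

abbreviation "X \<equiv> presented_gen (coeff ` rels3 q A B C)"
abbreviation "F \<equiv> std_filtration T X d"

abbreviation VW :: "nat \<Rightarrow> (idx \<Rightarrow>\<^sub>0 'a) set" where "VW n \<equiv> supp_in (\<lambda>m. wt d m \<le> n)"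
abbreviation VL :: "nat \<Rightarrow> (idx \<Rightarrow>\<^sub>0 'a) set" where "VL n \<equiv> supp_in (\<lambda>m. wt d m < n)"
abbreviation VH :: "nat \<Rightarrow> (idx \<Rightarrow>\<^sub>0 'a) set" where "VH n \<equiv> supp_in (\<lambda>m. wt d m = n)"

abbreviation dw :: "gen list \<Rightarrow> nat" where "dw w \<equiv> sum_list (map d w)"

lemma foldr_wt: "v \<in> VW n \<Longrightarrow> foldr L w v \<in> VW (n + dw w)"
proof (induction w)
  case (Cons g w)
  from L_wt[OF Cons.IH[OF Cons.prems], of g] show ?case by (simp add: add_ac)
qed simp

lemma foldr_wt_less: "v \<in> VL n \<Longrightarrow> foldr L w v \<in> VL (n + dw w)"
proof (induction w)
  case (Cons g w)
  from L_wt_less[OF Cons.IH[OF Cons.prems], of g] show ?case by (simp add: add_ac)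
qed simp

lemma G_foldr_wt: "v \<in> VH n \<Longrightarrow> foldr G.L w v \<in> VH (n + dw w)"
proof (induction w)
  case (Cons g w)
  from G_L_wt[OF Cons.IH[OF Cons.prems], of g] show ?case by (simp add: add_ac)
qed simp

lemma foldr_diff_wt: "v \<in> VH n \<Longrightarrow> foldr L w v - foldr G.L w v \<in> VL (n + dw w)"
proof (induction w)
  case Nil
  then show ?case by (simp add: subspcD[OF subspc_supp_in])
next
  case (Cons g w)
  let ?x = "foldr L w v" and ?y = "foldr G.L w v"
  \<comment> \<open>The difference is split at \<open>L g ?y\<close>: the error made so far is
    multiplied by a letter, and the new letter contributes an error of its own.\<close>
  have "L g (?x - ?y) \<in> VL (n + dw w + d g)" by (rule L_wt_less[OF Cons.IH[OF Cons.prems]])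
  moreover have "L g ?y - G.L g ?y \<in> VL (n + dw w + d g)"
    by (rule L_diff_wt, rule supp_in_mono[OF G_foldr_wt[OF Cons.prems]]) simp
  ultimately have "L g (?x - ?y) + (L g ?y - G.L g ?y) \<in> VL (n + dw w + d g)"
    by (rule subspcD(2)[OF subspc_supp_in])
  then show ?case by (simp add: add_ac)
qed

lemma vm_wt: "u \<in> VW i \<Longrightarrow> v \<in> VW j \<Longrightarrow> vm u v \<in> VW (i + j)"
  by (rule lin_supp_in[of "\<lambda>u. vm u v" u "\<lambda>m. wt d m \<le> i"])
    (auto simp: vm_e simp del: foldr_replicate intro!: supp_in_mono[OF foldr_wt[of v j]] simp del: fmon.simps wt_simps)

lemma vm_wt_less1: "u \<in> VL i \<Longrightarrow> v \<in> VW j \<Longrightarrow> vm u v \<in> VL (i + j)"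
  by (rule lin_supp_in[of "\<lambda>u. vm u v" u "\<lambda>m. wt d m < i"])
    (auto simp: vm_e simp del: foldr_replicate intro!: supp_in_mono[OF foldr_wt[of v j]] simp del: fmon.simps wt_simps)

lemma vm_wt_less2: "u \<in> VW i \<Longrightarrow> v \<in> VL j \<Longrightarrow> vm u v \<in> VL (i + j)"
  by (rule lin_supp_in[of "\<lambda>u. vm u v" u "\<lambda>m. wt d m \<le> i"])
    (auto simp: vm_e simp del: foldr_replicate intro!: supp_in_mono[OF foldr_wt_less[of v j]] simp del: fmon.simps wt_simps)

lemma G_vm_wt: "u \<in> VH i \<Longrightarrow> v \<in> VH j \<Longrightarrow> G.vm u v \<in> VH (i + j)"
  by (rule lin_supp_in[of "\<lambda>u. G.vm u v" u "\<lambda>m. wt d m = i"])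
    (auto simp: G.vm_e simp del: foldr_replicate intro!: supp_in_mono[OF G_foldr_wt[of v j]] simp del: fmon.simps wt_simps)

text \<open>A left factor acts letter by letter, so \<open>foldr_diff_wt\<close> bounds the error.
  This is why products of leading components in T are computed by \<open>G.vm\<close>.\<close>

lemma vm_diff_wt: "u \<in> VH i \<Longrightarrow> v \<in> VH j \<Longrightarrow> vm u v - G.vm u v \<in> VL (i + j)"
  by (rule lin_supp_in[of "\<lambda>u. vm u v - G.vm u v" u "\<lambda>m. wt d m = i"])
    (auto simp: is_lin_def vm_e G.vm_e simp del: foldr_replicate intro!: supp_in_mono[OF foldr_diff_wt[of v j]]
      simp del: fmon.simps wt_simps)

lemma eval_word_psi: "eval_word T X w = psi (foldr L w (e (0, 0, 0)))"
proof (induction w)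
  case Nil
  show ?case using alg_isoD(4)[OF psi_iso] by (simp add: eval_word_def)
next
  case (Cons g w)
  have "eval_word T X (g # w) = X g \<otimes>\<^bsub>T\<^esub> eval_word T X w" by (simp add: eval_word_def)
  also have "\<dots> = psi (vm (e (gidx g)) (foldr L w (e (0, 0, 0))))"
    unfolding Cons psi_gen[symmetric] using alg_isoD(2)[OF psi_iso] by (simp del: vm_gen)
  finally show ?case by simp
qed

text \<open>The operators never exceed the weight of their letter, so the normal form of a word
  stays within the weight of the word; conversely each normal word is itself a word.\<close>

lemma F_eq: "F n = psi ` VW n"
proof -
  let ?S = "{foldr L w (e (0, 0, 0)) | w. dw w \<le> n}"
  have e0: "e (0, 0, 0) \<in> VW 0" by simp
  have S: "{eval_word T X w | w. dw w \<le> n} = psi ` ?S"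
    unfolding eval_word_psi by blast
  have "{\<Sum>s\<in>B. c s \<bullet> s | c B. finite B \<and> B \<subseteq> ?S} = VW n"
  proof (intro equalityI subsetI)
    fix u assume "u \<in> {\<Sum>s\<in>B. c s \<bullet> s | c B. finite B \<and> B \<subseteq> ?S}"
    then obtain c B where B: "B \<subseteq> ?S" "u = (\<Sum>s\<in>B. c s \<bullet> s)" by blast
    show "u \<in> VW n" unfolding B(2)
    proof (rule subspc_sum[OF subspc_supp_in], rule subspcD(3)[OF subspc_supp_in])
      fix s assume "s \<in> B"
      then obtain w where w: "s = foldr L w (e (0, 0, 0))" "dw w \<le> n" using B(1) by blast
      show "s \<in> VW n" unfolding w(1) using foldr_wt[OF e0, of w] by (rule supp_in_mono) (use w(2) in simp)
    qed
  next
    fix u :: "idx \<Rightarrow>\<^sub>0 'a" assume u: "u \<in> VW n"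
    have inj: "inj (e :: idx \<Rightarrow> idx \<Rightarrow>\<^sub>0 'a)" by (simp add: inj_on_def e_inject del: split_paired_All)
    let ?c = "\<lambda>s. coeff u (inv_into UNIV e s)"
    have "u = lin e u" by (simp add: lin_expand)
    also have "\<dots> = (\<Sum>s\<in>e ` keys u. ?c s \<bullet> s)"
      unfolding lin_def using inj by (subst sum.reindex) (auto simp: inv_into_f_f[OF inj] intro: inj_on_subset)
    finally have "u = (\<Sum>s\<in>e ` keys u. ?c s \<bullet> s)" .
    moreover have "e ` keys u \<subseteq> ?S"
    proof (rule image_subsetI)
      fix m assume "m \<in> keys u"
      then have "dw (fmon m) \<le> n" using supp_in_keysD[OF u] by simp
      then show "e m \<in> ?S" using foldr_fmon[of m] by (metis (mono_tags, lifting) mem_Collect_eq)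
    qed
    ultimately show "u \<in> {\<Sum>s\<in>B. c s \<bullet> s | c B. finite B \<and> B \<subseteq> ?S}"
      unfolding mem_Collect_eq using finite_imageI[OF finite_keys, of e u]
      by (intro exI[of _ ?c] exI[of _ "e ` keys u"] conjI)
  qed
  then show ?thesis
    unfolding std_filtration_def S alg_iso_lin_span[OF psi_iso falg_Valg ring_presented] by simp
qed

lemma psi_inj: "psi u = psi v \<longleftrightarrow> u = v"
  using alg_isoD(6)[OF psi_iso] by (auto simp: inj_on_def)

lemma psi_image_iff: "psi u \<in> psi ` W \<longleftrightarrow> u \<in> W"
  by (auto simp: psi_inj)

lemma is_filtration_F: "is_filtration T F"
  unfolding is_filtration_def F_eq
proof (intro conjI allI ballI)
  show "lin_subspace T (psi ` VW n)" for n
    by (rule alg_iso_lin_subspace[OF psi_iso falg_Valg ring_presented]) simp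
  show "psi ` VW n \<subseteq> psi ` VW (Suc n)" for n
    by (rule image_mono) (auto elim: supp_in_mono)
  show "\<one>\<^bsub>T\<^esub> \<in> psi ` VW 0"
  proof -
    have "psi (e (0, 0, 0)) \<in> psi ` VW 0" by (simp add: psi_image_iff)
    then show ?thesis using alg_isoD(4)[OF psi_iso] by (metis typed_alg_sel(3))
  qed
  show "a \<otimes>\<^bsub>T\<^esub> b \<in> psi ` VW (m + n)" if "a \<in> psi ` VW m" "b \<in> psi ` VW n" for a b m n
  proof -
    note ab = that
    obtain u v where u: "a = psi u" "u \<in> VW m" "b = psi v" "v \<in> VW n" using ab by blast
    have "a \<otimes>\<^bsub>T\<^esub> b = psi (vm u v)" using alg_isoD(2)[OF psi_iso, of u v] by (simp add: u)
    then show ?thesis using vm_wt[OF u(2,4)] by (simp only: psi_image_iff)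
  qed
  \<comment> \<open>The sum of all weights occurring in \<open>u\<close> is a common bound that
    makes sense for empty support as well.\<close>
  have "u \<in> VW (\<Sum>m\<in>keys u. wt d m)" for u
    unfolding supp_in_def mem_Collect_eq
  proof (intro allI impI, rule ccontr)
    fix m assume m: "\<not> wt d m \<le> (\<Sum>m\<in>keys u. wt d m)" "coeff u m \<noteq> 0"
    then have "wt d m \<le> (\<Sum>m\<in>keys u. wt d m)" by (intro member_le_sum) (simp_all add: in_keys_iff)
    with m show False by simp
  qed
  then have "(\<Union>n. VW n) = UNIV" by blast
  moreover have "(\<Union>n. psi ` VW n) = psi ` (\<Union>n. VW n)" by blast
  ultimately have "(\<Union>n. psi ` VW n) = psi ` carrier Valg" by (simp only: typed_alg_sel)
  then show "(\<Union>n. psi ` VW n) = carrier T" by (simp only: alg_isoD(7)[OF psi_iso])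
qed

lemma filt_deg_gen: "filt_deg F (X g) = d g"
  unfolding filt_deg_def F_eq psi_gen[symmetric] psi_image_iff
  by (simp add: Least_equality)

abbreviation FP :: "nat \<Rightarrow> (gen list \<Rightarrow> 'a) set set" where "FP n \<equiv> filt_pred T F n"

lemma psi_zero: "psi 0 = \<zero>\<^bsub>T\<^esub>"
  using alg_iso_zero[OF psi_iso falgD(1)[OF falg_Valg] ring_presented] by simp

lemma FP_eq: "FP n = psi ` VL n"
proof (cases n)
  case 0
  \<comment> \<open>No weight is below 0, which matches the convention that the filtration step of
    index -1 is zero.\<close>
  have "VL 0 = {0}" by (auto simp: supp_in_def poly_mapping_eq_iff fun_eq_iff)
  then show ?thesis using 0 by (simp add: filt_pred_def psi_zero)
next
  case (Suc k)
  then show ?thesis by (simp add: filt_pred_def F_eq less_Suc_eq_le)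
qed

lemma coset_psi: "FP n +>\<^bsub>T\<^esub> psi u = psi ` {v. v - u \<in> VL n}"
proof -
  have "psi w \<oplus>\<^bsub>T\<^esub> psi u = psi (w + u)" for w using alg_isoD(3)[OF psi_iso, of w u] by simp
  then have "FP n +>\<^bsub>T\<^esub> psi u = psi ` (\<lambda>w. w + u) ` VL n"
    by (auto simp: a_r_coset_def' FP_eq)
  also have "(\<lambda>w. w + u) ` VL n = {v. v - u \<in> VL n}"
    by (auto intro: image_eqI[of _ _ "v - u" for v])
  finally show ?thesis .
qed

definition cs :: "nat \<Rightarrow> (idx \<Rightarrow>\<^sub>0 'a) \<Rightarrow> (gen list \<Rightarrow> 'a) set set" where
  "cs n u = psi ` {v. v - u \<in> VL n}"

lemma cs_eq_iff: "cs n u = cs n v \<longleftrightarrow> u - v \<in> VL n"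
proof
  assume "cs n u = cs n v"
  moreover have "psi u \<in> cs n u" by (simp add: cs_def subspcD[OF subspc_supp_in])
  ultimately show "u - v \<in> VL n" by (simp add: cs_def psi_image_iff)
next
  assume uv: "u - v \<in> VL n"
  have "w - u \<in> VL n \<longleftrightarrow> w - v \<in> VL n" for w
    using subspcD(2)[OF subspc_supp_in _ uv, of "w - u"] subspcD(5)[OF subspc_supp_in _ uv, of "w - v"]
    by auto
  then show "cs n u = cs n v" by (simp add: cs_def)
qed

lemma FP_cs: "FP n = cs n 0"
  by (simp add: FP_eq cs_def)

section \<open>Homogeneous components and the associated graded algebra\<close>

definition hom :: "nat \<Rightarrow> (idx \<Rightarrow>\<^sub>0 'a) \<Rightarrow> (idx \<Rightarrow>\<^sub>0 'a)" where
  "hom n = lin (\<lambda>m. if wt d m = n then e m else 0)"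

lemma hom_lin [simp]: "is_lin (hom n)"
  by (simp add: hom_def)

lemmas hom_simps [simp] = is_linD[OF hom_lin]

lemma hom_e: "hom n (e m) = (if wt d m = n then e m else 0)"
  by (simp add: hom_def)

lemma coeff_hom: "coeff (hom n u) m = (if wt d m = n then coeff u m else 0)"
proof -
  have "coeff (hom n u) m = (\<Sum>k\<in>keys u. if k = m then (if wt d m = n then coeff u m else 0) else 0)"
    unfolding hom_def lin_def lookup_sum by (rule sum.cong) (auto simp: coeff_e)
  then show ?thesis by (simp add: in_keys_iff)
qed

lemma hom_VH [simp]: "hom n u \<in> VH n"
  by (simp add: supp_in_def coeff_hom)

lemma hom_id: "u \<in> VH n \<Longrightarrow> hom k u = (if k = n then u else 0)"
  by (rule poly_mapping_eqI) (auto simp: coeff_hom supp_in_def)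

lemma hom_VW: "hom n u \<in> VW n"
  by (rule supp_in_mono[OF hom_VH]) simp

lemma hom_diff: "u \<in> VW n \<Longrightarrow> u - hom n u \<in> VL n"
  by (simp add: supp_in_def coeff_hom lookup_minus)

lemma finite_hom: "finite {n. hom n u \<noteq> 0}"
proof (rule finite_subset)
  show "{n. hom n u \<noteq> 0} \<subseteq> wt d ` keys u"
  proof (rule subsetI, rule ccontr)
    fix n assume n: "n \<in> {n. hom n u \<noteq> 0}" "n \<notin> wt d ` keys u"
    have "hom n u = 0"
    proof (rule poly_mapping_eqI)
      fix m show "coeff (hom n u) m = coeff 0 m" using n(2) by (auto simp: coeff_hom in_keys_iff)
    qed
    then show False using n(1) by simp
  qed
qed simp

text \<open>Each coset in \<open>F n\<close> modulo \<open>F (n - 1)\<close> has exactly one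
  representative that is homogeneous of weight n, so the graded algebra lives on the same space of
  functions on index triples.\<close>

definition Phi :: "(idx \<Rightarrow>\<^sub>0 'a) \<Rightarrow> nat \<Rightarrow> (gen list \<Rightarrow> 'a) set set" where
  "Phi u n = cs n (hom n u)"

lemma Phi_e: "Phi (e m) n = (if n = wt d m then cs n (e m) else FP n)"
  by (simp add: Phi_def hom_e FP_cs)

text \<open>Changing a representative alters a product only in lower weight, and so does replacing
  \<open>vm\<close> by \<open>G.vm\<close>; hence the unions defining the product run over a single
  coset.\<close>

lemma Phi_mult:
  "(\<Union>a \<in> {a. \<forall>i. a i \<in> Phi u i}. \<Union>b \<in> {b. \<forall>i. b i \<in> Phi v i}.
     FP n +>\<^bsub>T\<^esub> (\<Oplus>\<^bsub>T\<^esub>i\<in>{..n}. a i \<otimes>\<^bsub>T\<^esub> b (n - i))) = Phi (G.vm u v) n"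
proof -
  \<comment> \<open>\<open>G.vm\<close> is graded, so a component of a product is the convolution of
    the components of the factors; this is checked on basis vectors.\<close>
  have hom_vm: "hom n (G.vm u v) = (\<Sum>i\<le>n. G.vm (hom i u) (hom (n - i) v))"
  proof (rule is_bilin_ext[of "\<lambda>u v. hom n (G.vm u v)" "\<lambda>u v. \<Sum>i\<le>n. G.vm (hom i u) (hom (n - i) v)"])
    fix m m' :: idx
    have "(\<Sum>i\<le>n. G.vm (hom i (e m)) (hom (n - i) (e m')))
        = (\<Sum>i\<le>n. if i = wt d m then (if wt d m' = n - wt d m then G.vm (e m) (e m') else 0) else 0)"
      by (rule sum.cong) (auto simp: hom_e)
    also have "\<dots> = (if wt d m + wt d m' = n then G.vm (e m) (e m') else 0)"
      by auto
    also have "\<dots> = hom n (G.vm (e m) (e m'))"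
      using hom_id[OF G_vm_wt[of "e m" "wt d m" "e m'" "wt d m'"], of n] by simp
    finally show "hom n (G.vm (e m) (e m')) = (\<Sum>i\<le>n. G.vm (hom i (e m)) (hom (n - i) (e m')))" ..
  qed (simp_all add: is_bilin_def is_lin_def sum.distrib smul_sum)
  have main: "FP n +>\<^bsub>T\<^esub> (\<Oplus>\<^bsub>T\<^esub>i\<in>{..n}. a i \<otimes>\<^bsub>T\<^esub> b (n - i)) = Phi (G.vm u v) n"
    if a: "\<forall>i. a i \<in> Phi u i" and b: "\<forall>i. b i \<in> Phi v i" for a b
  proof -
    have "\<forall>i. \<exists>x. a i = psi x \<and> x - hom i u \<in> VL i"
    proof
      fix i
      have "a i \<in> psi ` {v. v - hom i u \<in> VL i}" using a by (simp only: Phi_def cs_def)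
      then show "\<exists>x. a i = psi x \<and> x - hom i u \<in> VL i" by blast
    qed
    from choice[OF this] obtain \<alpha> where \<alpha>: "\<And>i. a i = psi (\<alpha> i)" "\<And>i. \<alpha> i - hom i u \<in> VL i"
      by blast
    have "\<forall>i. \<exists>x. b i = psi x \<and> x - hom i v \<in> VL i"
    proof
      fix i
      have "b i \<in> psi ` {w. w - hom i v \<in> VL i}" using b by (simp only: Phi_def cs_def)
      then show "\<exists>x. b i = psi x \<and> x - hom i v \<in> VL i" by blast
    qed
    from choice[OF this] obtain \<beta> where \<beta>: "\<And>i. b i = psi (\<beta> i)" "\<And>i. \<beta> i - hom i v \<in> VL i"
      by blast
    have "(\<Oplus>\<^bsub>T\<^esub>i\<in>{..n}. a i \<otimes>\<^bsub>T\<^esub> b (n - i)) = (\<Oplus>\<^bsub>T\<^esub>i\<in>{..n}. psi (vm (\<alpha> i) (\<beta> (n - i))))"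
      using alg_isoD(2)[OF psi_iso] by (simp add: \<alpha>(1) \<beta>(1))
    also have "\<dots> = psi (\<Sum>i\<le>n. vm (\<alpha> i) (\<beta> (n - i)))"
      by (rule alg_iso_typed_finsum[OF psi_iso falg_Valg ring_presented])
    finally have eq: "FP n +>\<^bsub>T\<^esub> (\<Oplus>\<^bsub>T\<^esub>i\<in>{..n}. a i \<otimes>\<^bsub>T\<^esub> b (n - i)) = cs n (\<Sum>i\<le>n. vm (\<alpha> i) (\<beta> (n - i)))"
      by (simp only: coset_psi cs_def)
    have "vm (\<alpha> i) (\<beta> (n - i)) - G.vm (hom i u) (hom (n - i) v) \<in> VL n" if i: "i \<in> {..n}" for i
    proof -
      let ?h = "hom i u" and ?k = "hom (n - i) v"
      have \<alpha>W: "\<alpha> i \<in> VW i"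
        using subspcD(2)[OF subspc_supp_in supp_in_mono[OF \<alpha>(2)[of i]] hom_VW[of i u]] by simp
      have "vm (\<alpha> i) (\<beta> (n - i) - ?k) \<in> VL (i + (n - i))"
        by (rule vm_wt_less2[OF \<alpha>W \<beta>(2)])
      moreover have "vm (\<alpha> i - ?h) ?k \<in> VL (i + (n - i))"
        by (rule vm_wt_less1[OF \<alpha>(2) hom_VW])
      moreover have "vm ?h ?k - G.vm ?h ?k \<in> VL (i + (n - i))"
        by (rule vm_diff_wt) simp_all
      \<comment> \<open>Telescopes from the product of representatives through
        \<open>vm (\<alpha> i) ?k\<close> and \<open>vm ?h ?k\<close> to
        \<open>G.vm ?h ?k\<close>.\<close>
      ultimately have "vm (\<alpha> i) (\<beta> (n - i) - ?k) + vm (\<alpha> i - ?h) ?k + (vm ?h ?k - G.vm ?h ?k) \<in> VL (i + (n - i))"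
        by (intro subspcD(2)[OF subspc_supp_in])
      then show ?thesis using i by simp
    qed
    then have "(\<Sum>i\<le>n. vm (\<alpha> i) (\<beta> (n - i)) - G.vm (hom i u) (hom (n - i) v)) \<in> VL n"
      by (rule subspc_sum[OF subspc_supp_in])
    then show ?thesis
      unfolding eq Phi_def cs_eq_iff hom_vm by (simp add: sum_subtractf)
  qed
  have mem: "psi (hom i w) \<in> Phi w i" for i w
    by (simp add: Phi_def cs_def subspcD[OF subspc_supp_in])
  show ?thesis
  proof (rule UN_constant_eq[of "\<lambda>i. psi (hom i u)"], use mem in blast, intro ballI,
      rule UN_constant_eq[of "\<lambda>i. psi (hom i v)"], use mem in blast, intro ballI)
    fix a b assume "a \<in> {a. \<forall>i. a i \<in> Phi u i}" "b \<in> {b. \<forall>i. b i \<in> Phi v i}"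
    then show "FP n +>\<^bsub>T\<^esub> (\<Oplus>\<^bsub>T\<^esub>i\<in>{..n}. a i \<otimes>\<^bsub>T\<^esub> b (n - i)) = Phi (G.vm u v) n"
      by (intro main) simp_all
  qed
qed

abbreviation "Gr \<equiv> assoc_graded T F"

theorem Phi_iso: "Phi \<in> alg_iso G.Valg Gr"
proof (rule alg_isoI)
  fix u v :: "idx \<Rightarrow>\<^sub>0 'a" and c
  have fin: "finite {n. cs n (hom n u) \<noteq> FP n}" for u
    by (rule finite_subset[OF _ finite_hom[of u]]) (auto simp: FP_cs)
  have "\<exists>a\<in>F n. Phi u n = FP n +>\<^bsub>T\<^esub> a" for n
    by (rule bexI[of _ "psi (hom n u)"]) (simp_all add: Phi_def coset_psi cs_def F_eq hom_VW)
  then show "Phi u \<in> carrier Gr"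
    using fin[of u] by (simp add: assoc_graded_def Phi_def)
  show "Phi (u \<otimes>\<^bsub>G.Valg\<^esub> v) = Phi u \<otimes>\<^bsub>Gr\<^esub> Phi v"
    by (rule ext) (simp add: assoc_graded_def Phi_mult)
  have "cs n x <+>\<^bsub>T\<^esub> cs n y = cs n (x + y)" for n x y
  proof -
    have "psi w \<oplus>\<^bsub>T\<^esub> psi w' = psi (w + w')" for w w' using alg_isoD(3)[OF psi_iso, of w w'] by simp
    then have "cs n x <+>\<^bsub>T\<^esub> cs n y = psi ` {w + w' | w w'. w - x \<in> VL n \<and> w' - y \<in> VL n}"
      by (auto simp: set_add_def' cs_def)
    also have "{w + w' | w w'. w - x \<in> VL n \<and> w' - y \<in> VL n} = {w. w - (x + y) \<in> VL n}"
    proof (intro equalityI subsetI; clarify)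
      fix w w' assume "w - x \<in> VL n" "w' - y \<in> VL n"
      from subspcD(2)[OF subspc_supp_in this] show "w + w' - (x + y) \<in> VL n" by (simp add: algebra_simps)
    next
      fix w assume "w - (x + y) \<in> VL n"
      then have "w = (w - y) + y \<and> w - y - x \<in> VL n \<and> y - y \<in> VL n"
        by (simp add: algebra_simps subspcD[OF subspc_supp_in])
      then show "\<exists>v v'. w = v + v' \<and> v - x \<in> VL n \<and> v' - y \<in> VL n" by blast
    qed
    finally show ?thesis by (simp add: cs_def)
  qed
  then show "Phi (u \<oplus>\<^bsub>G.Valg\<^esub> v) = Phi u \<oplus>\<^bsub>Gr\<^esub> Phi v"
    by (intro ext) (simp add: assoc_graded_def Phi_def)
  have "(\<Union>a \<in> cs n x. FP n +>\<^bsub>T\<^esub> (c \<odot>\<^bsub>T\<^esub> a)) = cs n (c \<bullet> x)" for n x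
  proof (rule UN_constant_eq[of "psi x"], simp add: cs_def subspcD[OF subspc_supp_in], rule ballI)
    fix a assume "a \<in> cs n x"
    then obtain w where w: "a = psi w" "w - x \<in> VL n" by (auto simp: cs_def)
    have "c \<odot>\<^bsub>T\<^esub> a = psi (c \<bullet> w)" using alg_isoD(5)[OF psi_iso, of w c] by (simp add: w)
    then have "FP n +>\<^bsub>T\<^esub> (c \<odot>\<^bsub>T\<^esub> a) = cs n (c \<bullet> w)" by (simp only: coset_psi cs_def)
    also have "\<dots> = cs n (c \<bullet> x)"
      using subspcD(3)[OF subspc_supp_in w(2), of c] by (simp add: cs_eq_iff)
    finally show "FP n +>\<^bsub>T\<^esub> (c \<odot>\<^bsub>T\<^esub> a) = cs n (c \<bullet> x)" .
  qed
  then show "Phi (c \<odot>\<^bsub>G.Valg\<^esub> u) = c \<odot>\<^bsub>Gr\<^esub> Phi u"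
    by (intro ext) (simp add: assoc_graded_def Phi_def)
  have "\<one>\<^bsub>T\<^esub> = psi (e (0, 0, 0))" using alg_isoD(4)[OF psi_iso] by simp
  then show "Phi \<one>\<^bsub>G.Valg\<^esub> = \<one>\<^bsub>Gr\<^esub>"
    by (intro ext) (simp add: assoc_graded_def Phi_e coset_psi cs_def)
  show "inj_on Phi (carrier G.Valg)"
  proof (rule inj_onI)
    fix x y assume xy: "Phi x = Phi y"
    show "x = y"
    proof (rule poly_mapping_eqI)
      fix m
      have "hom (wt d m) x - hom (wt d m) y \<in> VL (wt d m)"
        using fun_cong[OF xy, of "wt d m"] by (simp only: Phi_def cs_eq_iff)
      then have "coeff (hom (wt d m) x - hom (wt d m) y) m = 0" by (rule supp_inD) simp
      then show "coeff x m = coeff y m" by (simp add: lookup_minus coeff_hom)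
    qed
  qed
  fix f assume f: "f \<in> carrier Gr"
  then have ex: "\<And>n. \<exists>a\<in>F n. f n = FP n +>\<^bsub>T\<^esub> a" and fin: "finite {n. f n \<noteq> FP n}" (is "finite ?S")
    by (simp_all add: assoc_graded_def)
  have "\<exists>w. w \<in> VW n \<and> f n = cs n w" for n
  proof -
    obtain a where a: "a \<in> F n" "f n = FP n +>\<^bsub>T\<^esub> a" using ex by blast
    obtain w where w: "w \<in> VW n" "a = psi w" using a(1) unfolding F_eq by blast
    have "f n = cs n w" unfolding a(2) w(2) coset_psi cs_def ..
    then show ?thesis using w(1) by blast
  qed
  then obtain w where w: "\<And>n. w n \<in> VW n" "\<And>n. f n = cs n (w n)" by metis
  \<comment> \<open>The preimage collects the top component of one representative for each of the
    finitely many degrees in which \<open>f\<close> is not the zero coset.\<close>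
  let ?u = "\<Sum>n\<in>?S. hom n (w n)"
  have "Phi ?u n = f n" for n
  proof -
    have "hom n ?u = (\<Sum>k\<in>?S. if k = n then hom n (w n) else 0)"
      unfolding is_lin_sum[OF hom_lin] by (rule sum.cong) (auto simp: hom_id[OF hom_VH])
    then have hu: "hom n ?u = (if n \<in> ?S then hom n (w n) else 0)" using fin by simp
    show ?thesis
    proof (cases "n \<in> ?S")
      case True
      have "Phi ?u n = cs n (hom n (w n))" unfolding Phi_def hu if_P[OF True] ..
      also have "\<dots> = cs n (w n)"
        unfolding cs_eq_iff using subspcD(4)[OF subspc_supp_in hom_diff[OF w(1)[of n]]] by simp
      finally show ?thesis by (simp only: w(2))
    next
      case False
      have "Phi ?u n = FP n" unfolding Phi_def hu if_not_P[OF False] by (rule FP_cs[symmetric])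
      then show ?thesis using False by simp
    qed
  qed
  then have "f = Phi ?u" by (simp add: fun_eq_iff)
  then show "f \<in> Phi ` carrier G.Valg" by simp
qed

lemma ring_Gr: "ring Gr"
proof (rule alg_iso_ring_zero[OF Phi_iso falgD(1)[OF G.falg_Valg]])
  show "Phi \<zero>\<^bsub>G.Valg\<^esub> = \<zero>\<^bsub>Gr\<^esub>"
    by (rule ext) (simp add: Phi_def assoc_graded_def FP_cs)
qed

lemma graded_symbol_gen: "graded_symbol T F (X g) = Phi (e (gidx g))"
  by (rule ext) (simp add: graded_symbol_def filt_deg_gen Phi_e, simp add: psi_gen[symmetric] coset_psi cs_def)

lemma graded_presentation:
  "\<exists>\<phi> \<in> alg_iso (presented_alg (coeff ` rels3 q A' B' C')) Gr.
     \<forall>k. \<phi> (presented_gen (coeff ` rels3 q A' B' C') k) = graded_symbol T F (X k)"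
proof (rule bexI[OF _ alg_iso_comp[OF alg_iso_inv[OF G.psi_iso G.falg_Valg] Phi_iso]], rule allI)
  fix k
  have "inv_into (carrier G.Valg) G.psi (G.psi (e (gidx k))) = e (gidx k)"
    by (rule inv_into_f_f[OF alg_isoD(6)[OF G.psi_iso]]) simp
  then show "Phi (inv_into (carrier G.Valg) G.psi (presented_gen (coeff ` rels3 q A' B' C') k))
      = graded_symbol T F (X k)"
    by (simp add: graded_symbol_gen G.psi_gen[symmetric])
qed

end

section \<open>Iterated skew polynomial rings\<close>

lemma alg_iso_subring:
  assumes h: "h \<in> alg_iso (typed_alg m i) K" and V: "falg (typed_alg m i)" and K: "ring K"
    and R: "subspc R" "i \<in> R" "\<And>u v. u \<in> R \<Longrightarrow> v \<in> R \<Longrightarrow> m u v \<in> R"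
  shows "subring (h ` R) K"
proof (rule ring.subringI[OF K])
  note lin = alg_iso_lin_subspace[OF h V K R(1), unfolded lin_subspace_def]
  interpret additive_subgroup "h ` R" K using lin by (rule conjunct1)
  interpret K: ring K by (rule K)
  show "h ` R \<subseteq> carrier K" by (rule a_subset)
  show "\<one>\<^bsub>K\<^esub> \<in> h ` R" using alg_isoD(4)[OF h] R(2) by (metis imageI typed_alg_sel(3))
  show "\<ominus>\<^bsub>K\<^esub> a \<in> h ` R" if "a \<in> h ` R" for a
    using that by (rule a_inv_closed[unfolded a_inv_def, folded a_inv_def])
  show "a \<oplus>\<^bsub>K\<^esub> b \<in> h ` R" if "a \<in> h ` R" "b \<in> h ` R" for a b
    using that by (rule a_closed)
  show "a \<otimes>\<^bsub>K\<^esub> b \<in> h ` R" if ab: "a \<in> h ` R" "b \<in> h ` R" for a b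
  proof -
    obtain u v where u: "a = h u" "b = h v" "u \<in> R" "v \<in> R" using ab by blast
    have "a \<otimes>\<^bsub>K\<^esub> b = h (m u v)" using alg_isoD(2)[OF h, of u v] by (simp add: u)
    then show ?thesis using R(3)[OF u(3,4)] by blast
  qed
qed

text \<open>That \<open>\<sigma>\<close> is multiplicative and that \<open>u \<mapsto> z u - \<sigma>(u) z\<close> is a \<open>\<sigma>\<close>-derivation follows by comparing the two
  expansions of \<open>z (u v) = (z u) v\<close> in powers of \<open>z\<close>.\<close>

lemma skew_poly_ext_typed:
  assumes h: "h \<in> alg_iso (typed_alg m i) K" and V: "falg (typed_alg m i)" and K: "ring K"
    and m: "is_bilin m"
    and R: "subspc R" "i \<in> R" "\<And>u v. u \<in> R \<Longrightarrow> v \<in> R \<Longrightarrow> m u v \<in> R"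
    and R': "subspc R'" "i \<in> R'" "\<And>u v. u \<in> R' \<Longrightarrow> v \<in> R' \<Longrightarrow> m u v \<in> R'"
    and RR': "R \<subseteq> R'" "z \<in> R'"
    and \<sigma>: "is_lin \<sigma>" "\<And>u. u \<in> R \<Longrightarrow> \<sigma> u \<in> R" "\<And>u. u \<in> R \<Longrightarrow> \<tau> u \<in> R"
      "\<And>u. \<sigma> (\<tau> u) = u" "\<And>u. \<tau> (\<sigma> u) = u"
    and \<delta>: "\<And>u. u \<in> R \<Longrightarrow> m z u - m (\<sigma> u) z \<in> R"
    and free: "\<And>a. a \<in> R' \<Longrightarrow> \<exists>!c :: nat \<Rightarrow> _. range c \<subseteq> R \<and> finite {n. c n \<noteq> 0} \<and>
        a = (\<Sum>n | c n \<noteq> 0. m (c n) (z [^]\<^bsub>typed_alg m i\<^esub> n))"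
  shows "skew_poly_ext K (h ` R) (h z) (h ` R')"
proof -
  interpret K: ring K by (rule K)
  interpret V: ring "typed_alg m i" by (rule falgD[OF V])
  let ?zp = "\<lambda>n::nat. z [^]\<^bsub>typed_alg m i\<^esub> n"
  note ml = is_linD[OF is_bilinD(1)[OF m]] is_linD[OF is_bilinD(2)[OF m]]
  note sub = subspcD[OF R(1)]
  have massoc: "m (m u v) w = m u (m v w)" and mone: "m u i = u" "m i u = u" for u v w
    using V.m_assoc[of u v w] V.r_one[of u] V.l_one[of u] by simp_all
  define p where "p = inv_into UNIV h"
  have inj: "h u = h v \<longleftrightarrow> u = v" for u v using alg_isoD(6)[OF h] by (auto simp: inj_on_def)
  have ph: "p (h u) = u" for u
    unfolding p_def by (rule inv_into_f_f) (use alg_isoD(6)[OF h] in simp_all)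
  have hm: "h u \<otimes>\<^bsub>K\<^esub> h v = h (m u v)" and ha: "h u \<oplus>\<^bsub>K\<^esub> h v = h (u + v)" for u v
    using alg_isoD(2,3)[OF h, of u v] by simp_all
  have h1: "\<one>\<^bsub>K\<^esub> = h i" using alg_isoD(4)[OF h] by simp
  have h0: "\<zero>\<^bsub>K\<^esub> = h 0" using alg_iso_zero[OF h V.ring_axioms K] by simp
  have hz: "h z [^]\<^bsub>K\<^esub> n = h (?zp n)" for n
    using alg_iso_pow[OF h V.ring_axioms, of z n] by simp
  \<comment> \<open>The expansion with coefficients u, v, 0, 0, ... is compared with the zero
    expansion. Only \<open>v = 0\<close> is recorded; the constant term is recovered later by
    substitution.\<close>
  have uniq: "v = 0" if uv: "u \<in> R" "v \<in> R" "u + m v z = 0" for u v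
  proof -
    let ?c = "\<lambda>n::nat. if n = 0 then u else if n = 1 then v else 0"
    have fin: "finite {n. ?c n \<noteq> 0}" by (rule finite_subset[of _ "{0, 1}"]) auto
    have "(\<Sum>n | ?c n \<noteq> 0. m (?c n) (?zp n)) = (\<Sum>n\<in>{0, 1}. m (?c n) (?zp n))"
      by (rule sum.mono_neutral_left) (auto simp: ml)
    also have "\<dots> = 0" using uv(3) by (simp add: mone)
    finally have "range ?c \<subseteq> R \<and> finite {n. ?c n \<noteq> 0} \<and> 0 = (\<Sum>n | ?c n \<noteq> 0. m (?c n) (?zp n))"
      using fin uv sub(1) by auto
    moreover have "range (\<lambda>n::nat. 0) \<subseteq> R \<and> finite {n::nat. (\<lambda>n. 0) n \<noteq> (0 :: 'a \<Rightarrow>\<^sub>0 'b)} \<and>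
        0 = (\<Sum>n | (\<lambda>n. 0) n \<noteq> (0 :: 'a \<Rightarrow>\<^sub>0 'b). m ((\<lambda>n. 0) n) (?zp n))"
      using sub(1) by auto
    ultimately have "?c = (\<lambda>n. 0)" using free[OF subspcD(1)[OF R'(1)]] by blast
    from fun_cong[OF this, of 1] show "v = 0" by simp
  qed
  define D where "D u = m z u - m (\<sigma> u) z" for u
  have D: "D u \<in> R" if "u \<in> R" for u using \<delta>[OF that] by (simp add: D_def)
  have Dadd: "D (u + v) = D u + D v" for u v
    by (simp add: D_def ml is_linD[OF \<sigma>(1)])
  have zu: "m z u = m (\<sigma> u) z + D u" for u by (simp add: D_def)
  have \<sigma>D: "\<sigma> (m u v) = m (\<sigma> u) (\<sigma> v)" "D (m u v) = m (\<sigma> u) (D v) + m (D u) v"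
    if uv: "u \<in> R" "v \<in> R" for u v
  proof -
    have "m z (m u v) = m (\<sigma> u) (m (\<sigma> v) z) + m (\<sigma> u) (D v) + m (D u) v"
      using massoc[of z u v] by (simp add: zu ml massoc)
    then have eq: "D (m u v) - (m (\<sigma> u) (D v) + m (D u) v) + m (\<sigma> (m u v) - m (\<sigma> u) (\<sigma> v)) z = 0"
      by (simp add: zu ml massoc algebra_simps)
    have "\<sigma> (m u v) - m (\<sigma> u) (\<sigma> v) = 0"
      by (rule uniq[OF _ _ eq]) (intro sub R(3) D \<sigma>(2) uv)+
    then show 1: "\<sigma> (m u v) = m (\<sigma> u) (\<sigma> v)" by simp
    show "D (m u v) = m (\<sigma> u) (D v) + m (D u) v" using eq by (simp add: 1 ml)
  qed
  have \<sigma>1: "\<sigma> i = i"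
  proof -
    have "- D i + m (i - \<sigma> i) z = 0" by (simp add: D_def ml mone)
    then have "i - \<sigma> i = 0" by (rule uniq[rotated 2]) (intro sub D \<sigma>(2) R(2))+
    then show ?thesis by simp
  qed
  show ?thesis
    unfolding skew_poly_ext_def
  proof (intro conjI ballI K exI)
    show "subring (h ` R) K" by (rule alg_iso_subring[OF h V K R])
    show "subring (h ` R') K" by (rule alg_iso_subring[OF h V K R'])
    show "h ` R \<subseteq> h ` R'" "h z \<in> h ` R'" using RR' by auto
    let ?s = "\<lambda>a. h (\<sigma> (p a))" and ?d = "\<lambda>a. h (D (p a))"
    show "?s \<in> ring_iso (K\<lparr>carrier := h ` R\<rparr>) (K\<lparr>carrier := h ` R\<rparr>)"
    proof (rule ring_iso_memI)
      show "bij_betw ?s (carrier (K\<lparr>carrier := h ` R\<rparr>)) (carrier (K\<lparr>carrier := h ` R\<rparr>))"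
        by (rule bij_betw_byWitness[where f' = "\<lambda>a. h (\<tau> (p a))"]) (auto simp: ph \<sigma>)
      fix a b assume "a \<in> carrier (K\<lparr>carrier := h ` R\<rparr>)" "b \<in> carrier (K\<lparr>carrier := h ` R\<rparr>)"
      then obtain u v where uv: "a = h u" "b = h v" "u \<in> R" "v \<in> R" by auto
      show "?s (a \<otimes>\<^bsub>K\<lparr>carrier := h ` R\<rparr>\<^esub> b) = ?s a \<otimes>\<^bsub>K\<lparr>carrier := h ` R\<rparr>\<^esub> ?s b"
        using uv by (simp add: hm ph \<sigma>D)
      show "?s (a \<oplus>\<^bsub>K\<lparr>carrier := h ` R\<rparr>\<^esub> b) = ?s a \<oplus>\<^bsub>K\<lparr>carrier := h ` R\<rparr>\<^esub> ?s b"
        using uv by (simp add: ha ph is_linD[OF \<sigma>(1)])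
    qed (auto simp: h1 ph \<sigma>1 \<sigma>)
    show "left_skew_derivation (K\<lparr>carrier := h ` R\<rparr>) ?s ?d"
      unfolding left_skew_derivation_def by (auto simp: hm ha ph D Dadd \<sigma>D)
    fix r assume "r \<in> h ` R"
    then obtain u where "r = h u" by auto
    then show "h z \<otimes>\<^bsub>K\<^esub> r = ?s r \<otimes>\<^bsub>K\<^esub> h z \<oplus>\<^bsub>K\<^esub> ?d r"
      by (simp add: hm ha ph) (simp add: zu)
  next
    fix a assume "a \<in> h ` R'"
    then obtain u where u: "a = h u" "u \<in> R'" by auto
    have sum: "(\<Oplus>\<^bsub>K\<^esub>n\<in>{n. h (c n) \<noteq> \<zero>\<^bsub>K\<^esub>}. h (c n) \<otimes>\<^bsub>K\<^esub> h z [^]\<^bsub>K\<^esub> n)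
        = h (\<Sum>n | c n \<noteq> 0. m (c n) (?zp n))" for c :: "nat \<Rightarrow> 'a \<Rightarrow>\<^sub>0 'b"
      by (simp only: hz hm h0 inj alg_iso_typed_finsum[OF h V K])
    obtain c where c: "range c \<subseteq> R" "finite {n. c n \<noteq> 0}" "u = (\<Sum>n | c n \<noteq> 0. m (c n) (?zp n))"
      using free[OF u(2)] by blast
    show "\<exists>!c :: nat \<Rightarrow> _. range c \<subseteq> h ` R \<and> finite {n. c n \<noteq> \<zero>\<^bsub>K\<^esub>} \<and>
        a = (\<Oplus>\<^bsub>K\<^esub>n\<in>{n. c n \<noteq> \<zero>\<^bsub>K\<^esub>}. c n \<otimes>\<^bsub>K\<^esub> h z [^]\<^bsub>K\<^esub> n)"
    proof (rule ex1I[of _ "\<lambda>n. h (c n)"], intro conjI)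
      show "range (\<lambda>n. h (c n)) \<subseteq> h ` R" using c(1) by auto
      show "finite {n. h (c n) \<noteq> \<zero>\<^bsub>K\<^esub>}" using c(2) by (simp add: h0 inj)
      show "a = (\<Oplus>\<^bsub>K\<^esub>n\<in>{n. h (c n) \<noteq> \<zero>\<^bsub>K\<^esub>}. h (c n) \<otimes>\<^bsub>K\<^esub> h z [^]\<^bsub>K\<^esub> n)"
        unfolding sum u(1) using c(3) by (rule arg_cong)
      fix c' :: "nat \<Rightarrow> _" assume c': "range c' \<subseteq> h ` R \<and> finite {n. c' n \<noteq> \<zero>\<^bsub>K\<^esub>} \<and>
        a = (\<Oplus>\<^bsub>K\<^esub>n\<in>{n. c' n \<noteq> \<zero>\<^bsub>K\<^esub>}. c' n \<otimes>\<^bsub>K\<^esub> h z [^]\<^bsub>K\<^esub> n)"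
      define c'' where "c'' n = p (c' n)" for n
      have cc: "c' = (\<lambda>n. h (c'' n))"
      proof
        fix n
        have "c' n \<in> h ` R" using conjunct1[OF c'] by blast
        then show "c' n = h (c'' n)" by (auto simp: c''_def ph)
      qed
      have "range c'' \<subseteq> R" 
      proof (rule image_subsetI)
        fix n
        have "c' n \<in> h ` R" using conjunct1[OF c'] by blast
        then show "c'' n \<in> R" by (auto simp: c''_def ph)
      qed
      moreover have "finite {n. c'' n \<noteq> 0}"
        using conjunct1[OF conjunct2[OF c']] by (simp add: cc h0 inj)
      moreover have "u = (\<Sum>n | c'' n \<noteq> 0. m (c'' n) (?zp n))"
        using conjunct2[OF conjunct2[OF c']] unfolding cc sum u(1) inj .
      ultimately have "c'' = c" using c free[OF u(2)] by blast
      then show "c' = (\<lambda>n. h (c n))" by (simp add: cc)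
    qed
  qed
qed

text \<open>When the powers \<open>zp n\<close> of the new variable send basis vectors to basis
  vectors, freeness is combinatorial: \<open>f\<close> is a bijection from pairs of a
  \<open>P\<close>-index and an exponent onto the \<open>P'\<close>-indices, with inverse given by
  \<open>base\<close> and \<open>ex\<close>.\<close>

lemma free_over_supp:
  assumes m: "is_bilin m"
    and f: "\<And>x n. P x \<Longrightarrow> m (e x) (zp n) = e (f x n)"
    and Pf: "\<And>x n. P x \<Longrightarrow> P' (f x n) \<and> base (f x n) = x \<and> ex (f x n) = n"
    and fP: "\<And>y. P' y \<Longrightarrow> P (base y) \<and> f (base y) (ex y) = y"
    and a: "a \<in> supp_in P'"
  shows "\<exists>!c :: nat \<Rightarrow> ('b \<Rightarrow>\<^sub>0 'a::field). range c \<subseteq> supp_in P \<and> finite {n. c n \<noteq> 0} \<and>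
      a = (\<Sum>n | c n \<noteq> 0. m (c n) (zp n))"
proof -
  note ml = is_linD[OF is_bilinD(2)[OF m]]
  have co: "coeff (m u (zp n)) y = (if P' y \<and> ex y = n then coeff u (base y) else 0)"
    if u: "u \<in> supp_in P" for u n y
  proof -
    have "m u (zp n) = lin (\<lambda>x. e (f x n)) u"
      by (rule is_lin_eq_onI[OF is_bilinD(2)[OF m] is_lin_lin]) (use supp_in_keysD[OF u] in \<open>simp add: f\<close>)
    then have "coeff (m u (zp n)) y = (\<Sum>x\<in>keys u. coeff u x * coeff (e (f x n)) y)"
      by (simp add: lin_def lookup_sum)
    also have "\<dots> = (\<Sum>x\<in>keys u. if x = base y then (if P' y \<and> ex y = n then coeff u x else 0) else 0)"
    proof (rule sum.cong[OF refl])
      fix x assume "x \<in> keys u"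
      then have "P x" by (rule supp_in_keysD[OF u])
      then show "coeff u x * coeff (e (f x n)) y
          = (if x = base y then (if P' y \<and> ex y = n then coeff u x else 0) else 0)"
        using Pf[of x n] fP[of y] by (auto simp: coeff_e)
    qed
    also have "\<dots> = (if P' y \<and> ex y = n then coeff u (base y) else 0)"
      by (simp add: in_keys_iff)
    finally show ?thesis .
  qed
  have co_sum: "coeff (\<Sum>n | c n \<noteq> 0. m (c n) (zp n)) y = (if P' y then coeff (c (ex y)) (base y) else 0)"
    if c: "range c \<subseteq> supp_in P" "finite {n. c n \<noteq> 0}" for c y
  proof -
    have "coeff (\<Sum>n | c n \<noteq> 0. m (c n) (zp n)) y = (\<Sum>n | c n \<noteq> 0. if n = ex y then (if P' y then coeff (c n) (base y) else 0) else 0)"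
      unfolding lookup_sum by (rule sum.cong[OF refl]) (use c(1) in \<open>auto simp: co image_subset_iff\<close>)
    then show ?thesis using c(2) by (simp add: sum.delta)
  qed
  \<comment> \<open>The n-th coefficient gathers the terms of \<open>a\<close> with exponent n, with
    the power of the variable removed.\<close>
  define c where "c n = lin (\<lambda>y. if ex y = n then e (base y) else 0) a" for n
  have cP: "range c \<subseteq> supp_in P"
    unfolding c_def by (intro image_subsetI subspc_lin subspc_supp_in)
      (use supp_in_keysD[OF a] fP in \<open>auto intro: subspcD(1)[OF subspc_supp_in]\<close>)
  have "{n. c n \<noteq> 0} \<subseteq> ex ` keys a"
  proof (rule subsetI, rule ccontr)
    fix n assume n: "n \<in> {n. c n \<noteq> 0}" "n \<notin> ex ` keys a"
    have "c n = lin (\<lambda>y. 0) a" unfolding c_def by (rule lin_cong) (use n(2) in auto)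
    then show False using n(1) by (simp add: lin_def)
  qed
  then have cfin: "finite {n. c n \<noteq> 0}" by (rule finite_subset) simp
  have cco: "coeff (c n) x = coeff a (f x n)" if "P x" for n x
  proof -
    have "coeff (c n) x = (\<Sum>y\<in>keys a. if y = f x n then coeff a (f x n) else 0)"
      unfolding c_def lin_def lookup_sum
    proof (rule sum.cong[OF refl])
      fix y assume "y \<in> keys a"
      then have "P' y" by (rule supp_in_keysD[OF a])
      then show "coeff (coeff a y \<bullet> (if ex y = n then e (base y) else 0)) x = (if y = f x n then coeff a (f x n) else 0)"
        using fP[of y] Pf[OF that, of n] by (auto simp: coeff_e)
    qed
    then show ?thesis by (simp add: in_keys_iff)
  qed
  show ?thesis
  proof (rule ex1I[of _ c], intro conjI cP cfin)
    show "a = (\<Sum>n | c n \<noteq> 0. m (c n) (zp n))"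
    proof (rule poly_mapping_eqI)
      fix y
      show "coeff a y = coeff (\<Sum>n | c n \<noteq> 0. m (c n) (zp n)) y"
        unfolding co_sum[OF cP cfin] using cco[of "base y" "ex y"] fP[of y] supp_inD[OF a, of y] by auto
    qed
    fix c' assume c': "range c' \<subseteq> supp_in P \<and> finite {n. c' n \<noteq> 0} \<and> a = (\<Sum>n | c' n \<noteq> 0. m (c' n) (zp n))"
    show "c' = c"
    proof (rule ext, rule poly_mapping_eqI)
      fix n x
      show "coeff (c' n) x = coeff (c n) x"
      proof (cases "P x")
        case True
        have "coeff a (f x n) = coeff (c' n) x"
          using co_sum[of c' "f x n"] c' Pf[OF True, of n] by metis
        then show ?thesis by (simp add: cco[OF True])
      next
        case False
        have "c' n \<in> supp_in P" "c n \<in> supp_in P" using c' cP by auto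
        then show ?thesis using False by (simp add: supp_inD)
      qed
    qed
  qed
qed

text \<open>Both the automorphisms of the skew polynomial tower and the twist of the Laurent
  polynomials only scale monomials.\<close>

definition diag :: "('b \<Rightarrow> 'a::field) \<Rightarrow> ('b \<Rightarrow>\<^sub>0 'a) \<Rightarrow> ('b \<Rightarrow>\<^sub>0 'a)" where
  "diag s = lin (\<lambda>m. s m \<bullet> e m)"

lemma diag_lin [simp]: "is_lin (diag s)"
  by (simp add: diag_def)

lemma diag_e [simp]: "diag s (e m) = s m \<bullet> e m"
  by (simp add: diag_def)

lemma diag_supp_in: "u \<in> supp_in P \<Longrightarrow> diag s u \<in> supp_in P"
  by (rule lin_supp_in[OF diag_lin, of u P]) (auto intro: subspcD(3)[OF subspc_supp_in])

lemma diag_inverse: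
  assumes "\<And>m. s m \<noteq> 0"
  shows "diag s (diag (\<lambda>m. inverse (s m)) u) = u" "diag (\<lambda>m. inverse (s m)) (diag s u) = u"
  by (rule is_lin_ext[of "\<lambda>u. diag s (diag (\<lambda>m. inverse (s m)) u)" "\<lambda>u. u"],
      simp_all add: is_lin_def is_linD[OF diag_lin] assms)
    (rule is_lin_ext[of "\<lambda>u. diag (\<lambda>m. inverse (s m)) (diag s u)" "\<lambda>u. u"],
      simp_all add: is_lin_def is_linD[OF diag_lin] assms)

context qalg3
begin

lemma foldr_supp_in:
  assumes "\<And>g v. g \<in> set w \<Longrightarrow> v \<in> supp_in Q \<Longrightarrow> L g v \<in> supp_in Q"
  shows "v \<in> supp_in Q \<Longrightarrow> foldr L w v \<in> supp_in Q"
  using assms by (induction w) auto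

lemma vm_supp_in:
  assumes "\<And>m g v. P m \<Longrightarrow> g \<in> set (fmon m) \<Longrightarrow> v \<in> supp_in P \<Longrightarrow> L g v \<in> supp_in P"
    and u: "u \<in> supp_in P" and v: "v \<in> supp_in P"
  shows "vm u v \<in> supp_in P"
proof (rule lin_supp_in[OF vm_lin(2) u subspc_supp_in])
  fix m assume "P m"
  then show "vm (e m) v \<in> supp_in P"
    unfolding vm_e by (intro foldr_supp_in[OF _ v]) (rule assms(1))
qed

lemma gen_pow:
  "e (gidx X1) [^]\<^bsub>Valg\<^esub> (n::nat) = e (0, 0, n)" "e (gidx X2) [^]\<^bsub>Valg\<^esub> n = e (0, n, 0)"
  "e (gidx X3) [^]\<^bsub>Valg\<^esub> n = e (n, 0, 0)"
  using foldr_fmon[of "(0, 0, n)"] foldr_fmon[of "(0, n, 0)"] foldr_fmon[of "(n, 0, 0)"]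
  by (simp_all only: Valg_pow fmon.simps replicate_0 append_Nil append_Nil2)

lemma vm_e_X1: "vm (e (i, j, 0)) (e (0, 0, n)) = e (i, j, n)"
  using foldr_fmon[of "(i, j, n)"] foldr_fmon[of "(0, 0, n)"]
  by (simp only: vm_e fmon.simps foldr_append replicate_0 append_Nil append_Nil2)

lemma vm_e_X2: "vm (e (i, 0, 0)) (e (0, n, 0)) = e (i, n, 0)"
  using foldr_fmon[of "(i, n, 0)"] foldr_fmon[of "(0, n, 0)"]
  by (simp only: vm_e fmon.simps foldr_append replicate_0 append_Nil append_Nil2)

lemma iterated_skew_poly_base:
  assumes h: "h \<in> alg_iso Valg K" and K: "ring K"
  shows "iterated_skew_poly K [] (h ` supp_in (\<lambda>m. m = (0, 0, 0)))"
proof -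
  have eq: "c \<odot>\<^bsub>K\<^esub> \<one>\<^bsub>K\<^esub> = h (c \<bullet> e (0, 0, 0))" for c
    using alg_isoD(5)[OF h, of "e (0, 0, 0)" c] alg_isoD(4)[OF h] by simp
  have inj: "h u = h v \<longleftrightarrow> u = v" for u v using alg_isoD(6)[OF h] by (auto simp: inj_on_def)
  have "inj (\<lambda>c. c \<odot>\<^bsub>K\<^esub> \<one>\<^bsub>K\<^esub>)"
  proof (rule injI)
    fix c c' assume "c \<odot>\<^bsub>K\<^esub> \<one>\<^bsub>K\<^esub> = c' \<odot>\<^bsub>K\<^esub> \<one>\<^bsub>K\<^esub>"
    then have "c \<bullet> e (0, 0, 0) = c' \<bullet> (e (0, 0, 0) :: idx \<Rightarrow>\<^sub>0 'a)" by (simp only: eq inj)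
    from arg_cong[OF this, of "\<lambda>u. coeff u (0, 0, 0)"] show "c = c'" by (simp add: coeff_e)
  qed
  moreover have "range (\<lambda>c. c \<odot>\<^bsub>K\<^esub> \<one>\<^bsub>K\<^esub>) = h ` supp_in (\<lambda>m. m = (0, 0, 0))"
  proof (intro equalityI subsetI)
    fix a assume "a \<in> h ` supp_in (\<lambda>m. m = (0, 0, 0))"
    then obtain u where u: "a = h u" "u \<in> supp_in (\<lambda>m. m = (0, 0, 0))" by auto
    have "u = coeff u (0, 0, 0) \<bullet> e (0, 0, 0)"
      by (rule poly_mapping_eqI) (use supp_inD[OF u(2)] in \<open>auto simp: coeff_e\<close>)
    then have "a = coeff u (0, 0, 0) \<odot>\<^bsub>K\<^esub> \<one>\<^bsub>K\<^esub>" unfolding eq u(1) by (rule arg_cong)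
    then show "a \<in> range (\<lambda>c. c \<odot>\<^bsub>K\<^esub> \<one>\<^bsub>K\<^esub>)" by simp
  qed (auto simp: eq intro!: imageI subspcD(3)[OF subspc_supp_in])
  ultimately show ?thesis using iterated_skew_poly.base by metis
qed

text \<open>For \<open>B = 0\<close> the relation x2 x3 = q x3 x2 makes the span of the words in x3
  and x2 a subring. The automorphism for x2 sends x3 to q x3; the one for x1 sends x3 to q^-1 x3 and
  x2 to q x2. The terms with constants \<open>A\<close> and \<open>C\<close> make up the derivation
  for x1.\<close>

theorem iterated_skew_poly_Valg:
  assumes B: "B = 0" and h: "h \<in> alg_iso Valg K" and K: "ring K"
  shows "iterated_skew_poly K [h (e (gidx X1)), h (e (gidx X2)), h (e (gidx X3))] (carrier K)"
proof -
  have bil: "is_bilin vm" by (simp add: is_bilin_def)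
  let ?P0 = "\<lambda>m::idx. m = (0, 0, 0)" and ?P1 = "\<lambda>m::idx. snd m = (0, 0)" and ?P2 = "\<lambda>m::idx. snd (snd m) = 0"
    and ?P3 = "\<lambda>m::idx. True"
  have B0: "B \<bullet> u = 0" for u :: "idx \<Rightarrow>\<^sub>0 'a" by (simp add: B)
  have L2: "L X2 (e (i, j, k)) = q ^ i \<bullet> e (i, Suc j, k)" for i j k
    by (induction i) (simp_all add: B0 mult.commute)
  have pres3: "L X3 v \<in> supp_in ?P1" if "v \<in> supp_in ?P1" for v
    by (rule lin_supp_in[OF is_lin_L that]) auto
  have pres3': "L X3 v \<in> supp_in ?P2" if "v \<in> supp_in ?P2" for v
    by (rule lin_supp_in[OF is_lin_L that]) auto
  have pres2: "L X2 v \<in> supp_in ?P2" if "v \<in> supp_in ?P2" for v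
    by (rule lin_supp_in[OF is_lin_L that]) (auto simp: L2 simp del: L_e intro!: subspcD(3)[OF subspc_supp_in])
  have c0: "vm u v \<in> supp_in ?P0" if "u \<in> supp_in ?P0" "v \<in> supp_in ?P0" for u v
    by (rule vm_supp_in[OF _ that]) simp
  have c1: "vm u v \<in> supp_in ?P1" if "u \<in> supp_in ?P1" "v \<in> supp_in ?P1" for u v
  proof (rule vm_supp_in[OF _ that])
    fix m :: idx and g and v :: "idx \<Rightarrow>\<^sub>0 'a" assume "?P1 m" "g \<in> set (fmon m)" "v \<in> supp_in ?P1"
    then show "L g v \<in> supp_in ?P1" by (cases m) (auto intro: pres3 split: if_splits)
  qed
  have c2: "vm u v \<in> supp_in ?P2" if "u \<in> supp_in ?P2" "v \<in> supp_in ?P2" for u v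
  proof (rule vm_supp_in[OF _ that])
    fix m :: idx and g and v :: "idx \<Rightarrow>\<^sub>0 'a" assume "?P2 m" "g \<in> set (fmon m)" "v \<in> supp_in ?P2"
    then show "L g v \<in> supp_in ?P2" by (cases m) (auto intro: pres2 pres3' split: if_splits)
  qed
  have U': "subspc (UNIV :: (idx \<Rightarrow>\<^sub>0 'a) set)" by (simp add: subspc_def)
  have U: "supp_in ?P3 = UNIV" by (simp add: supp_in_def)
  have s1: "skew_poly_ext K (h ` supp_in ?P0) (h (e (gidx X3))) (h ` supp_in ?P1)"
  proof (rule skew_poly_ext_typed[OF h falg_Valg K bil, where \<sigma> = "\<lambda>u. u" and \<tau> = "\<lambda>u. u"])
    show "vm (e (gidx X3)) u - vm u (e (gidx X3)) \<in> supp_in ?P0" if "u \<in> supp_in ?P0" for u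
      by (rule lin_supp_in[of "\<lambda>u. vm (e (gidx X3)) u - vm u (e (gidx X3))", OF _ that])
        (simp_all add: is_lin_def algebra_simps subspcD(1)[OF subspc_supp_in] del: gidx.simps vm_gen)
    show "\<exists>!c :: nat \<Rightarrow> _. range c \<subseteq> supp_in ?P0 \<and> finite {n. c n \<noteq> 0} \<and>
        a = (\<Sum>n | c n \<noteq> 0. vm (c n) (e (gidx X3) [^]\<^bsub>Valg\<^esub> n))" if "a \<in> supp_in ?P1" for a
      unfolding gen_pow
      by (rule free_over_supp[OF bil, of ?P0 _ "\<lambda>m n. (n, 0, 0)" ?P1 "\<lambda>m. (0, 0, 0)" fst, OF _ _ _ that]) auto
  qed (auto simp: is_lin_id c0 c1 intro: supp_in_mono)
  have s2: "skew_poly_ext K (h ` supp_in ?P1) (h (e (gidx X2))) (h ` supp_in ?P2)"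
  proof (rule skew_poly_ext_typed[OF h falg_Valg K bil,
        where \<sigma> = "diag (\<lambda>m. q ^ fst m)" and \<tau> = "diag (\<lambda>m. inverse (q ^ fst m))"])
    show "vm (e (gidx X2)) u - vm (diag (\<lambda>m. q ^ fst m) u) (e (gidx X2)) \<in> supp_in ?P1" if "u \<in> supp_in ?P1" for u
    proof (rule lin_supp_in[of "\<lambda>u. vm (e (gidx X2)) u - vm (diag (\<lambda>m. q ^ fst m) u) (e (gidx X2))", OF _ that])
      fix m assume "?P1 m"
      then obtain i where "m = (i, 0, 0)" by (cases m) auto
      then show "vm (e (gidx X2)) (e m) - vm (diag (\<lambda>m. q ^ fst m) (e m)) (e (gidx X2)) \<in> supp_in ?P1"
        unfolding vm_gen using L2[of i 0 0] vm_e_X2[of i 1]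
        by (simp add: subspcD(1)[OF subspc_supp_in] flip: One_nat_def del: L_e)
    qed (simp_all add: is_lin_def algebra_simps is_linD[OF diag_lin])
    show "\<exists>!c :: nat \<Rightarrow> _. range c \<subseteq> supp_in ?P1 \<and> finite {n. c n \<noteq> 0} \<and>
        a = (\<Sum>n | c n \<noteq> 0. vm (c n) (e (gidx X2) [^]\<^bsub>Valg\<^esub> n))" if "a \<in> supp_in ?P2" for a
      unfolding gen_pow
      by (rule free_over_supp[OF bil, of ?P1 _ "\<lambda>m n. (fst m, n, 0)" ?P2 "\<lambda>m. (fst m, 0, 0)" "\<lambda>m. fst (snd m)", OF _ _ _ that])
        (auto simp: vm_e_X2)
  qed (auto simp: c1 c2 diag_supp_in diag_inverse intro: supp_in_mono)
  \<comment> \<open>Moving x1 past x3^i x2^j multiplies the leading word by q^(j - i) and otherwise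
    leaves only words free of x1, which are the value of the derivation.\<close>
  have X1: "bas X1 i j 0 - (q ^ j * inverse (q ^ i)) \<bullet> e (i, j, 1) \<in> supp_in ?P2" for i j
  proof (induction i)
    case 0
    show ?case
    proof (induction j)
      case (Suc j)
      have "q \<bullet> L X2 (bas X1 0 j 0 - (q ^ j * inverse (q ^ 0)) \<bullet> e (0, j, 1)) + A \<bullet> e (1, j, 0) \<in> supp_in ?P2"
        by (intro subspcD(2,3)[OF subspc_supp_in] pres2 Suc) simp
      then show ?case by (simp add: bas_X1_Suc algebra_simps)
    qed (simp add: subspcD(1)[OF subspc_supp_in])
  next
    case (Suc i)
    have "inverse q \<bullet> L X3 (bas X1 i j 0 - (q ^ j * inverse (q ^ i)) \<bullet> e (i, j, 1))
        - (inverse q * C) \<bullet> L X2 (e (i, j, 0)) \<in> supp_in ?P2"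
      by (intro subspcD(5,3)[OF subspc_supp_in] pres2 pres3' Suc) simp
    then show ?case by (simp add: algebra_simps)
  qed
  define s where "s m = q ^ fst (snd m) * inverse (q ^ fst m)" for m :: idx
  have s0: "s m \<noteq> 0" for m by (simp add: s_def)
  have s3: "skew_poly_ext K (h ` supp_in ?P2) (h (e (gidx X1))) (h ` supp_in ?P3)"
  proof (rule skew_poly_ext_typed[OF h falg_Valg K bil,
        where \<sigma> = "diag s" and \<tau> = "diag (\<lambda>m. inverse (s m))"])
    let ?s = "diag s"
    show "vm (e (gidx X1)) u - vm (?s u) (e (gidx X1)) \<in> supp_in ?P2" if "u \<in> supp_in ?P2" for u
    proof (rule lin_supp_in[of "\<lambda>u. vm (e (gidx X1)) u - vm (?s u) (e (gidx X1))", OF _ that])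
      fix m assume "?P2 m"
      then obtain i j where "m = (i, j, 0)" by (cases m) auto
      then show "vm (e (gidx X1)) (e m) - vm (?s (e m)) (e (gidx X1)) \<in> supp_in ?P2"
        unfolding vm_gen using X1[of i j] vm_e_X1[of i j 1] by (simp add: s_def flip: One_nat_def)
    qed (simp_all add: is_lin_def algebra_simps is_linD[OF diag_lin])
    show "\<exists>!c :: nat \<Rightarrow> _. range c \<subseteq> supp_in ?P2 \<and> finite {n. c n \<noteq> 0} \<and>
        a = (\<Sum>n | c n \<noteq> 0. vm (c n) (e (gidx X1) [^]\<^bsub>Valg\<^esub> n))" if "a \<in> supp_in ?P3" for a
      unfolding gen_pow
      by (rule free_over_supp[OF bil, of ?P2 _ "\<lambda>m n. (fst m, fst (snd m), n)" ?P3
            "\<lambda>m. (fst m, fst (snd m), 0)" "\<lambda>m. snd (snd m)", OF _ _ _ that])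
        (auto simp: vm_e_X1)
  qed (auto simp: c2 diag_supp_in diag_inverse[OF s0] U U')
  have "iterated_skew_poly K [h (e (gidx X1)), h (e (gidx X2)), h (e (gidx X3))] (h ` supp_in ?P3)"
    by (intro iterated_skew_poly.adjoin[OF _ s3] iterated_skew_poly.adjoin[OF _ s2]
        iterated_skew_poly.adjoin[OF _ s1] iterated_skew_poly_base[OF h K])
  then show ?thesis using alg_isoD(7)[OF h] by (simp add: U)
qed

end

context qalg3_weight
begin

theorem graded_claim:
  assumes "B' = 0"
  shows "is_filtration T F \<and> (\<forall>k. filt_deg F (X k) = d k) \<and>
    (\<exists>zs. mset zs = {#graded_symbol T F (X X1), graded_symbol T F (X X2), graded_symbol T F (X X3)#} \<and>
       iterated_skew_poly Gr zs (carrier Gr)) \<and>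
    (\<exists>\<phi> \<in> alg_iso (presented_alg (coeff ` rels3 q A' B' C')) Gr.
       \<forall>k. \<phi> (presented_gen (coeff ` rels3 q A' B' C') k) = graded_symbol T F (X k))"
proof (intro conjI allI)
  show "\<exists>zs. mset zs = {#graded_symbol T F (X X1), graded_symbol T F (X X2), graded_symbol T F (X X3)#} \<and>
       iterated_skew_poly Gr zs (carrier Gr)"
    by (rule exI[of _ "[Phi (e (gidx X1)), Phi (e (gidx X2)), Phi (e (gidx X3))]"], rule conjI,
        simp only: graded_symbol_gen mset.simps, rule G.iterated_skew_poly_Valg[OF assms Phi_iso ring_Gr])
qed (rule is_filtration_F filt_deg_gen graded_presentation)+

end

lemma T_graded_claim_weight:
  assumes "qalg3_weight q (1 - q^2) (inverse q - q) (inverse q - q) d A' 0 C'"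
  shows "T_graded_claim q d (coeff ` rels3 q A' 0 C')"
  using qalg3_weight.graded_claim[OF assms refl]
  unfolding T_graded_claim_def Let_def T_alg_def T_gen_def T_rels_eq .

section \<open>The quantum torus\<close>

text \<open>The basis vector \<open>e (a, b)\<close> is \<open>y\<^sup>a x\<^sup>b\<close>, so that \<open>x\<^sup>b y\<^sup>a' = q\<^bsup>b a'\<^esup> y\<^sup>a' x\<^sup>b\<close>.\<close>

definition tor :: "'a::field \<Rightarrow> (int \<times> int \<Rightarrow>\<^sub>0 'a) \<Rightarrow> (int \<times> int \<Rightarrow>\<^sub>0 'a) \<Rightarrow> (int \<times> int \<Rightarrow>\<^sub>0 'a)" where
  "tor q = tw (\<lambda>x y. (fst x + fst y, snd x + snd y)) (\<lambda>x y. q powi (snd x * fst y))"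

locale quantum_torus =
  fixes q :: "'a::field"
  assumes q_nz [simp]: "q \<noteq> 0"
begin

lemma tor_e [simp]: "tor q (e (a, b)) (e (a', b')) = q powi (b * a') \<bullet> e (a + a', b + b')"
  by (simp add: tor_def)

lemma tor_bilin [simp]: "is_bilin (tor q)"
  by (simp add: tor_def)

lemmas tor_lin [simp] = is_bilinD[OF tor_bilin]
lemmas tor_simps [simp] = is_linD[OF tor_lin(1)] is_linD[OF tor_lin(2)]

lemma tor_assoc: "tor q (tor q u v) w = tor q u (tor q v w)"
  unfolding tor_def by (rule tw_assoc) (simp_all add: power_int_add[symmetric] algebra_simps)

lemma tor_one [simp]: "tor q (e (0, 0)) u = u" "tor q u (e (0, 0)) = u"
  unfolding tor_def by (rule tw_unit, simp, simp, rule tw_unit', simp, simp)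

lemma falg_tor: "falg (typed_alg (tor q) (e (0, 0)))"
  by (rule falg_typed_alg) (simp_all add: tor_assoc)

lemma coeff_tor:
  "coeff (tor q u v) z = (\<Sum>x\<in>keys u. \<Sum>y\<in>keys v. coeff u x * (coeff v y * (q powi (snd x * fst y) *
     (if z = (fst x + fst y, snd x + snd y) then 1 else 0))))"
  unfolding tor_def coeff_tw ..

lemma coeff_tor_e:
  "coeff (tor q (e (a, b)) u) (a', b') = q powi (b * (a' - a)) * coeff u (a' - a, b' - b)"
proof -
  have "coeff (tor q (e (a, b)) u) (a', b')
      = (\<Sum>y\<in>keys u. coeff u y * (q powi (b * fst y) * (if (a', b') = (a + fst y, b + snd y) then 1 else 0)))"
    unfolding coeff_tor by (simp only: keys_single one_neq_zero if_False) simp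
  also have "\<dots> = (\<Sum>y\<in>keys u. if y = (a' - a, b' - b) then q powi (b * (a' - a)) * coeff u (a' - a, b' - b) else 0)"
    by (rule sum.cong[OF refl]) auto
  finally have "coeff (tor q (e (a, b)) u) (a', b')
      = (\<Sum>y\<in>keys u. if y = (a' - a, b' - b) then q powi (b * (a' - a)) * coeff u (a' - a, b' - b) else 0)" .
  then show ?thesis by (simp add: in_keys_iff)
qed

section \<open>Absence of zero divisors in the quantum torus\<close>

lemma lex_max:
  fixes u :: "int \<times> int \<Rightarrow>\<^sub>0 'a"
  assumes "u \<noteq> 0"
  obtains x where "x \<in> keys u" "\<And>y. y \<in> keys u \<Longrightarrow> fst y < fst x \<or> (fst y = fst x \<and> snd y \<le> snd x)"
proof -
  have ne: "keys u \<noteq> {}" using assms by simp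
  define a where "a = Max (fst ` keys u)"
  have a: "a \<in> fst ` keys u" "\<And>y. y \<in> keys u \<Longrightarrow> fst y \<le> a"
    unfolding a_def using ne by simp_all
  define b where "b = Max (snd ` {y \<in> keys u. fst y = a})"
  have fin: "finite (snd ` {y \<in> keys u. fst y = a})" by simp
  have "b \<in> snd ` {y \<in> keys u. fst y = a}"
    unfolding b_def using a(1) by (intro Max_in fin) auto
  then have ab: "(a, b) \<in> keys u" by auto
  show ?thesis
  proof (rule that[OF ab])
    fix y assume y: "y \<in> keys u"
    show "fst y < fst (a, b) \<or> (fst y = fst (a, b) \<and> snd y \<le> snd (a, b))"
    proof (cases "fst y = a")
      case True
      then have "snd y \<le> b" unfolding b_def using y by (intro Max_ge fin) auto
      then show ?thesis using True by simp
    next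
      case False
      then show ?thesis using a(2)[OF y] by simp
    qed
  qed
qed

text \<open>The product of the lexicographically largest monomials cannot cancel: the order on
  exponents is total and translation invariant, and powers of q are nonzero.\<close>

lemma tor_domain:
  assumes "tor q u v = 0"
  shows "u = 0 \<or> v = 0"
proof (rule ccontr)
  assume "\<not> (u = 0 \<or> v = 0)"
  then have uv: "u \<noteq> 0" "v \<noteq> 0" by auto
  obtain x where x: "x \<in> keys u" "\<And>y. y \<in> keys u \<Longrightarrow> fst y < fst x \<or> (fst y = fst x \<and> snd y \<le> snd x)"
    using lex_max[OF uv(1)] by blast
  obtain y where y: "y \<in> keys v" "\<And>z. z \<in> keys v \<Longrightarrow> fst z < fst y \<or> (fst z = fst y \<and> snd z \<le> snd y)"
    using lex_max[OF uv(2)] by blast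
  let ?z = "(fst x + fst y, snd x + snd y)"
  let ?c = "coeff u x * (coeff v y * q powi (snd x * fst y))"
  have "coeff (tor q u v) ?z = (\<Sum>x'\<in>keys u. \<Sum>y'\<in>keys v. if y' = y then (if x' = x then ?c else 0) else 0)"
    unfolding coeff_tor
  proof (intro sum.cong refl)
    fix x' y' assume "x' \<in> keys u" "y' \<in> keys v"
    note le = x(2)[OF this(1)] y(2)[OF this(2)]
    show "coeff u x' * (coeff v y' * (q powi (snd x' * fst y') *
        (if ?z = (fst x' + fst y', snd x' + snd y') then 1 else 0))) = (if y' = y then (if x' = x then ?c else 0) else 0)"
    proof (cases "x' = x \<and> y' = y")
      case False
      then have "?z \<noteq> (fst x' + fst y', snd x' + snd y')"
        using le by (auto simp: prod_eq_iff)
      then show ?thesis using False by auto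
    qed auto
  qed
  also have "\<dots> = ?c" using x(1) y(1) by simp
  finally have "?c = 0" using assms by simp
  then show False using x(1) y(1) by (simp add: in_keys_iff)
qed

section \<open>The inversion, the images of the generators and their leading exponents\<close>

definition th :: "(int \<times> int \<Rightarrow>\<^sub>0 'a) \<Rightarrow> (int \<times> int \<Rightarrow>\<^sub>0 'a)" where
  "th = lin (\<lambda>x. e (- fst x, - snd x))"

lemma th_lin [simp]: "is_lin th"
  by (simp add: th_def)

lemmas th_simps [simp] = is_linD[OF th_lin]

lemma th_e [simp]: "th (e (a, b)) = e (- a, - b)"
  by (simp add: th_def)

text \<open>The exponent b a' in the cocycle is unchanged when both factors are inverted.\<close>

lemma th_tor: "th (tor q u v) = tor q (th u) (th v)"
proof (rule is_bilin_ext[of "\<lambda>u v. th (tor q u v)" "\<lambda>u v. tor q (th u) (th v)"])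
  fix x y :: "int \<times> int"
  show "th (tor q (e x) (e y)) = tor q (th (e x)) (th (e y))" by (cases x; cases y) simp
qed (simp_all add: is_bilin_def is_lin_def)

lemma coeff_th: "coeff (th u) (a, b) = coeff u (- a, - b)"
proof -
  have "coeff (th u) (a, b) = (\<Sum>x\<in>keys u. if x = (- a, - b) then coeff u (- a, - b) else 0)"
    unfolding th_def lin_def lookup_sum by (rule sum.cong) (auto simp: coeff_e)
  then show ?thesis by (simp add: in_keys_iff)
qed

definition tg :: "gen \<Rightarrow> (int \<times> int \<Rightarrow>\<^sub>0 'a)" where
  "tg g = (case g of X1 \<Rightarrow> e (0, 1) + e (0, - 1) | X2 \<Rightarrow> e (1, 0) + e (- 1, 0)
     | X3 \<Rightarrow> inverse q \<bullet> (e (- 1, 1) + e (1, - 1)))"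

lemma tg_simps: "tg X1 = e (0, 1) + e (0, - 1)" "tg X2 = e (1, 0) + e (- 1, 0)"
  "tg X3 = inverse q \<bullet> (e (- 1, 1) + e (1, - 1))"
  by (simp_all add: tg_def)

lemma th_tg [simp]: "th (tg g) = tg g"
  by (cases g) (simp_all add: tg_simps add_ac)

lemma tg_rels:
  "tor q (tg X1) (tg X2) - q \<bullet> tor q (tg X2) (tg X1) - (1 - q^2) \<bullet> tg X3 = 0"
  "tor q (tg X2) (tg X3) - q \<bullet> tor q (tg X3) (tg X2) - (inverse q - q) \<bullet> tg X1 = 0"
  "tor q (tg X3) (tg X1) - q \<bullet> tor q (tg X1) (tg X3) - (inverse q - q) \<bullet> tg X2 = 0"
  by (rule poly_mapping_eqI, simp add: tg_simps coeff_simps power2_eq_square field_simps)+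

text \<open>\<open>f\<close> and \<open>g\<close> are used as linear coordinates on the exponent
  lattice: the support lies in a parallelogram centred at the origin, with half-widths i and j, and
  the corner (i, j) occurs.\<close>

definition lead :: "(int \<times> int \<Rightarrow> int) \<Rightarrow> (int \<times> int \<Rightarrow> int) \<Rightarrow> int \<Rightarrow> int \<Rightarrow> (int \<times> int \<Rightarrow>\<^sub>0 'a) \<Rightarrow> bool" where
  "lead f g i j u \<longleftrightarrow> (\<forall>x. coeff u x \<noteq> 0 \<longrightarrow> \<bar>f x\<bar> \<le> i \<and> \<bar>g x\<bar> \<le> j) \<and> (\<forall>x. f x = i \<and> g x = j \<longrightarrow> coeff u x \<noteq> 0)"

text \<open>The shift by (a, b) advances \<open>f\<close> by one and fixes \<open>g\<close>. The new
  corner is reached only from the old corner by this shift, since the opposite shift would have to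
  start beyond the bound i.\<close>

lemma lead_step:
  assumes u: "lead f g i j u" and i: "0 \<le> i" and c: "c \<noteq> 0"
    and f: "\<And>x y. f (x - a, y - b) = f (x, y) - 1" "\<And>x y. f (x + a, y + b) = f (x, y) + 1"
    and g: "\<And>x y. g (x - a, y - b) = g (x, y)" "\<And>x y. g (x + a, y + b) = g (x, y)"
  shows "lead f g (i + 1) j (tor q (c \<bullet> (e (a, b) + e (- a, - b))) u)"
proof -
  have co: "coeff (tor q (c \<bullet> (e (a, b) + e (- a, - b))) u) (x, y)
      = c * (q powi (b * (x - a)) * coeff u (x - a, y - b) + q powi (- b * (x + a)) * coeff u (x + a, y + b))" for x y
    using coeff_tor_e[of a b u x y] coeff_tor_e[of "- a" "- b" u x y] by (simp add: lookup_add algebra_simps)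
  have 1: "\<bar>f z\<bar> \<le> i \<and> \<bar>g z\<bar> \<le> j" if "coeff u z \<noteq> 0" for z using u that unfolding lead_def by blast
  have 2: "coeff u z \<noteq> 0" if "f z = i" "g z = j" for z using u that unfolding lead_def by blast
  show ?thesis
    unfolding lead_def
  proof (intro conjI allI impI)
    fix z assume nz: "coeff (tor q (c \<bullet> (e (a, b) + e (- a, - b))) u) z \<noteq> 0"
    obtain x y where z: "z = (x, y)" by (cases z)
    have "coeff u (x - a, y - b) \<noteq> 0 \<or> coeff u (x + a, y + b) \<noteq> 0"
      using nz unfolding z co by auto
    then show "\<bar>f z\<bar> \<le> i + 1" "\<bar>g z\<bar> \<le> j" using 1[of "(x - a, y - b)"] 1[of "(x + a, y + b)"] f[of x y] g[of x y]
      unfolding z by auto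
  next
    fix z assume fg: "f z = i + 1 \<and> g z = j"
    obtain x y where z: "z = (x, y)" by (cases z)
    have "coeff u (x - a, y - b) \<noteq> 0" using 2[of "(x - a, y - b)"] f[of x y] g[of x y] fg unfolding z by auto
    moreover have "coeff u (x + a, y + b) = 0" using 1[of "(x + a, y + b)"] f[of x y] fg i unfolding z by auto
    ultimately show "coeff (tor q (c \<bullet> (e (a, b) + e (- a, - b))) u) z \<noteq> 0"
      unfolding z co using c by simp
  qed
qed

lemma lead_swap: "lead f g i j u \<longleftrightarrow> lead g f j i u"
  by (auto simp: lead_def)

lemma lead_pow:
  assumes t: "tg h = c \<bullet> (e (a, b) + e (- a, - b))" "c \<noteq> 0" and i: "0 \<le> i"
    and f: "\<And>x y. f (x - a, y - b) = f (x, y) - 1" "\<And>x y. f (x + a, y + b) = f (x, y) + 1"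
    and g: "\<And>x y. g (x - a, y - b) = g (x, y)" "\<And>x y. g (x + a, y + b) = g (x, y)"
    and u: "lead f g i j u"
  shows "lead f g (i + int n) j (foldr (\<lambda>g. tor q (tg g)) (replicate n h) u)"
proof (induction n)
  case (Suc n)
  from lead_step[OF Suc, of c a b] i t f g show ?case by (simp add: add_ac)
qed (use u in simp)

end

text \<open>Read from left to right, the three relations bring every composite into words ordered as
  \<open>L3\<close>, \<open>L2\<close>, \<open>L1\<close>; the coefficients on both sides then agree
  by field arithmetic with r = q^-1.\<close>

lemma cubic_central:
  fixes q r :: "'a::field" and L1 L2 L3 :: "('b \<Rightarrow>\<^sub>0 'a) \<Rightarrow> ('b \<Rightarrow>\<^sub>0 'a)"
  assumes qr: "q * r = 1" and lin: "is_lin L1" "is_lin L2" "is_lin L3"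
    and rel12: "\<And>v. L1 (L2 v) = q \<bullet> L2 (L1 v) + (1 - q^2) \<bullet> L3 v"
    and rel13: "\<And>v. L1 (L3 v) = r \<bullet> L3 (L1 v) - (r * (r - q)) \<bullet> L2 v"
    and rel23: "\<And>v. L2 (L3 v) = q \<bullet> L3 (L2 v) + (r - q) \<bullet> L1 v"
  defines "p \<equiv> \<lambda>v. L3 (L2 (L1 v)) - q \<bullet> L3 (L3 v) - r^2 \<bullet> L2 (L2 v) - L1 (L1 v) + (2 * (1 + r^2)) \<bullet> v"
  shows "L1 (p v) = p (L1 v)" "L2 (p v) = p (L2 v)" "L3 (p v) = p (L3 v)"
proof -
  note L = lin[THEN is_linD(1)] lin[THEN is_linD(2)] lin[THEN is_linD(5)]
  have q0: "q \<noteq> 0" using qr by auto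
  then have r: "r = 1 / q" using qr by (simp add: eq_divide_eq mult.commute)
  show "L1 (p v) = p (L1 v)" unfolding p_def
    by (rule poly_mapping_eqI, simp only: L rel12 rel13 rel23 smul_simps lookup_add lookup_minus coeff_smul)
      (use q0 in \<open>simp add: r field_simps power2_eq_square\<close>)
  show "L2 (p v) = p (L2 v)" unfolding p_def
    by (rule poly_mapping_eqI, simp only: L rel12 rel13 rel23 smul_simps lookup_add lookup_minus coeff_smul)
      (use q0 in \<open>simp add: r field_simps power2_eq_square\<close>)
  show "L3 (p v) = p (L3 v)" unfolding p_def
    by (rule poly_mapping_eqI, simp only: L rel12 rel13 rel23 smul_simps lookup_add lookup_minus coeff_smul)
      (use q0 in \<open>simp add: r field_simps power2_eq_square\<close>)
qed

section \<open>Evaluation in the quantum torus and the central element\<close>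

locale torus_quotient = quantum_torus q + qalg3 q "1 - q^2" "inverse q - q" "inverse q - q" for q :: "'a::field"
begin

definition Ev :: "(gen list \<Rightarrow>\<^sub>0 'a) \<Rightarrow> (int \<times> int \<Rightarrow>\<^sub>0 'a)" where
  "Ev = lin (\<lambda>w. foldr (\<lambda>g. tor q (tg g)) w (e (0, 0)))"

lemma Ev_lin [simp]: "is_lin Ev"
  by (simp add: Ev_def)

lemmas Ev_simps [simp] = is_linD[OF Ev_lin]

lemma Ev_e: "Ev (e w) = foldr (\<lambda>g. tor q (tg g)) w (e (0, 0))"
  by (simp add: Ev_def)

lemma Ev_fm: "Ev (fm u v) = tor q (Ev u) (Ev v)"
proof (rule is_bilin_ext[of "\<lambda>u v. Ev (fm u v)" "\<lambda>u v. tor q (Ev u) (Ev v)"])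
  show "Ev (fm (e w) (e w')) = tor q (Ev (e w)) (Ev (e w'))" for w w'
    by (induction w) (simp_all add: Ev_e tor_assoc)
qed (simp_all add: is_bilin_def is_lin_def)

text \<open>The kernel of the evaluation is an ideal that contains the relations, so
  \<open>span\<close> applies and the evaluation descends to normal forms.\<close>

lemma Ev_iota_N: "Ev (iota (N u)) = Ev u"
proof -
  have "tideal {u. Ev u = 0}" by (simp add: tideal_def subspc_def Ev_fm)
  moreover have "rels3 q (1 - q^2) (inverse q - q) (inverse q - q) \<subseteq> {u. Ev u = 0}"
    using tg_rels by (simp add: rels3_def Ev_e)
  ultimately have "u - iota (N u) \<in> {u. Ev u = 0}" by (rule span)
  then show ?thesis by simp
qed

definition pi :: "(idx \<Rightarrow>\<^sub>0 'a) \<Rightarrow> (int \<times> int \<Rightarrow>\<^sub>0 'a)" where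
  "pi v = Ev (iota v)"

lemma pi_lin [simp]: "is_lin pi"
  unfolding pi_def by (rule is_lin_comp) simp_all

lemmas pi_simps [simp] = is_linD[OF pi_lin]

lemma pi_vm: "pi (vm u v) = tor q (pi u) (pi v)"
  using Ev_iota_N[of "fm (iota u) (iota v)"] by (simp add: N_fm pi_def Ev_fm)

lemma pi_L: "pi (L g v) = tor q (tg g) (pi v)"
  using pi_vm[of "e (gidx g)" v] by (simp add: pi_def Ev_e)

lemma pi_one: "pi (e (0, 0, 0)) = e (0, 0)"
  by (simp add: pi_def Ev_e)

lemma pi_e: "pi (e m) = foldr (\<lambda>g. tor q (tg g)) (fmon m) (e (0, 0))"
  by (simp add: pi_def Ev_e)

lemma th_pi: "th (pi v) = pi v"
proof (rule is_lin_ext[of "\<lambda>v. th (pi v)" pi])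
  fix m
  have "th (foldr (\<lambda>g. tor q (tg g)) w (e (0, 0))) = foldr (\<lambda>g. tor q (tg g)) w (e (0, 0))" for w
    by (induction w) (simp_all add: th_tor)
  then show "th (pi (e m)) = pi (e m)" by (simp only: pi_e)
qed (simp_all add: is_lin_comp)

text \<open>Left multiplication by p, written with operators so that centrality becomes commutation
  with each \<open>L g\<close>.\<close>

definition P :: "(idx \<Rightarrow>\<^sub>0 'a) \<Rightarrow> (idx \<Rightarrow>\<^sub>0 'a)" where
  "P v = L X3 (L X2 (L X1 v)) - q \<bullet> L X3 (L X3 v) - inverse (q^2) \<bullet> L X2 (L X2 v) - L X1 (L X1 v)
     + (2 * (1 + inverse (q^2))) \<bullet> v"

lemma P_lin [simp]: "is_lin P"
  by (simp add: is_lin_def P_def algebra_simps)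

lemmas P_simps [simp] = is_linD[OF P_lin]

lemma vm_L: "vm (L g u) v = L g (vm u v)"
  using vm_assoc[of "e (gidx g)" u v] by simp

definition P0 :: "idx \<Rightarrow>\<^sub>0 'a" where "P0 = P (e (0, 0, 0))"

lemma vm_P0: "vm P0 v = P v"
  unfolding P0_def P_def by (simp only: vm_simps vm_L vm_one)

lemma L_P: "L g (P v) = P (L g v)"
  using cubic_central[of q "inverse q" "L X1" "L X2" "L X3" v] rel12 rel13 rel23
  by (cases g) (simp_all only: P_def is_lin_L right_inverse[OF q_nz] power_inverse simp_thms)

lemma P0_central: "vm v P0 = vm P0 v"
proof (rule is_lin_ext[of "\<lambda>v. vm v P0" "\<lambda>v. vm P0 v"])
  fix m
  have foldr_P: "foldr L w (P u) = P (foldr L w u)" for w u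
    by (induction w) (simp_all add: L_P)
  have "vm (e m) P0 = P (foldr L (fmon m) (e (0, 0, 0)))" by (simp only: vm_e P0_def foldr_P)
  then show "vm (e m) P0 = vm P0 (e m)" by (simp only: foldr_fmon vm_P0)
qed simp_all

lemma pi_P0: "pi P0 = 0"
proof -
  have "pi P0 = tor q (tg X3) (tor q (tg X2) (tg X1)) - q \<bullet> tor q (tg X3) (tg X3)
      - inverse (q^2) \<bullet> tor q (tg X2) (tg X2) - tor q (tg X1) (tg X1) + (2 * (1 + inverse (q^2))) \<bullet> e (0, 0)"
    unfolding P0_def P_def by (simp only: pi_simps pi_L pi_one tor_one)
  \<comment> \<open>The first four summands have constant terms 2, -2, -2 q^-2 and -2, which the
    last summand 2 (1 + q^-2) cancels.\<close>
  also have "\<dots> = 0"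
    by (rule poly_mapping_eqI) (simp add: tg_simps coeff_simps power2_eq_square field_simps)
  finally show ?thesis .
qed

end

section \<open>The quotient by the central element\<close>

text \<open>The monomials \<open>x\<^sub>3\<^sup>i x\<^sub>2\<^sup>j x\<^sub>1\<^sup>k\<close> with \<open>i j k = 0\<close> form a basis of \<open>T/pT\<close>. Under \<open>pi\<close> the leading terms of
  such a monomial, with respect to the hexagonal norm \<open>hx\<close> on the exponents, are those at \<open>lab (i, j, k)\<close>
  and \<open>- lab (i, j, k)\<close>, and these labels meet every orbit of \<open>- 1\<close> on the exponents exactly once.\<close>

fun nrm :: "idx \<Rightarrow> bool" where
  "nrm (i, j, k) \<longleftrightarrow> i = 0 \<or> j = 0 \<or> k = 0"

text \<open>The sum of the leading exponents of the factors: (-1, 1) for x3, (1, 0) for x2, (0, 1)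
  for x1. Next to x3 the other exponent (-1, 0) of x2 is taken, being the one adjacent to (-1, 1) on
  the hexagon.\<close>

fun lab :: "idx \<Rightarrow> int \<times> int" where
  "lab (i, j, k) = (if i = 0 then (int j, int k) else if j = 0 then (- int i, int i + int k)
     else (- (int i + int j), int i))"

text \<open>The unit sphere is the hexagon whose vertices are the six exponents in the images of the
  generators, and the norm is additive on each cone spanned by adjacent vertices.\<close>

fun hx :: "int \<times> int \<Rightarrow> int" where
  "hx (a, b) = max (max \<bar>a\<bar> \<bar>b\<bar>) \<bar>a + b\<bar>"

abbreviation tdeg :: "idx \<Rightarrow> nat" where "tdeg \<equiv> wt (\<lambda>_. 1)"

abbreviation neg :: "int \<times> int \<Rightarrow> int \<times> int" where "neg x \<equiv> (- fst x, - snd x)"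

lemma hx_lab: "nrm m \<Longrightarrow> hx (lab m) = int (tdeg m)"
  by (cases m) auto

lemma hx_neg: "hx (neg x) = hx x"
proof (cases x)
  case (Pair a b)
  have "\<bar>- a - b\<bar> = \<bar>a + b\<bar>" by arith
  then show ?thesis by (simp add: Pair)
qed

lemma lab_inj: "nrm m \<Longrightarrow> nrm m' \<Longrightarrow> lab m = lab m' \<or> lab m = neg (lab m') \<Longrightarrow> m = m'"
  by (cases m; cases m') (auto split: if_splits)

text \<open>The half-plane where b > 0, or b = 0 and a \<ge> 0, meets every orbit and is covered by
  three cones, one for each exponent that may vanish.\<close>

lemma lab_surj: "\<exists>m. nrm m \<and> (x = lab m \<or> x = neg (lab m))"
proof -
  have half: "\<exists>m. nrm m \<and> (a, b) = lab m" if ab: "b > 0 \<or> (b = 0 \<and> a \<ge> 0)" for a b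
  proof -
    consider "a \<ge> 0" "b \<ge> 0" | "a < 0" "a + b \<ge> 0" | "a < 0" "b > 0" "a + b < 0" using ab by linarith
    then show ?thesis
    proof cases
      case 1
      then show ?thesis by (intro exI[of _ "(0, nat a, nat b)"]) auto
    next
      case 2
      then show ?thesis by (intro exI[of _ "(nat (- a), 0, nat (a + b))"]) auto
    next
      case 3
      then show ?thesis by (intro exI[of _ "(nat b, nat (- (a + b)), 0)"]) auto
    qed
  qed
  obtain a b where x: "x = (a, b)" by (cases x)
  show ?thesis
  proof (cases "b > 0 \<or> (b = 0 \<and> a \<ge> 0)")
    case True
    then show ?thesis using half[OF True] unfolding x by blast
  next
    case False
    then have c: "- b > 0 \<or> (- b = 0 \<and> - a \<ge> 0)" by linarith
    obtain m where m: "nrm m" "(- a, - b) = lab m" using half[OF c] by blast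
    have "(a, b) = neg (lab m)" unfolding m(2)[symmetric] by simp
    then show ?thesis using m(1) unfolding x by blast
  qed
qed

text \<open>The sum p + r reaches I + J in absolute value only at two opposite corners, and p or r
  alone can do so only when the other bound is 0.\<close>

lemma hex_extreme:
  fixes p r :: int
  assumes "\<bar>p\<bar> \<le> I" "\<bar>r\<bar> \<le> J"
  shows "max (max \<bar>p\<bar> \<bar>r\<bar>) \<bar>p + r\<bar> \<le> I + J"
    "max (max \<bar>p\<bar> \<bar>r\<bar>) \<bar>p + r\<bar> = I + J \<Longrightarrow> (p = I \<and> r = J) \<or> (p = - I \<and> r = - J)"
  using assms by (auto simp: max_def abs_if split: if_splits)

lemma exists_max_wt:
  assumes "(v :: 'b \<Rightarrow>\<^sub>0 'a::zero) \<noteq> 0"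
  obtains m where "m \<in> keys v" "\<And>m'. m' \<in> keys v \<Longrightarrow> (f m' :: nat) \<le> f m"
proof -
  have "Max (f ` keys v) \<in> f ` keys v" using assms by (intro Max_in) auto
  then obtain m where m: "m \<in> keys v" "Max (f ` keys v) = f m" by auto
  have "f m' \<le> f m" if "m' \<in> keys v" for m'
    unfolding m(2)[symmetric] using that by simp
  then show ?thesis using that m(1) by blast
qed

context torus_quotient
begin

lemma lead_hex:
  assumes lead: "lead f g I J u" and hx: "\<And>z. hx z = max (max \<bar>f z\<bar> \<bar>g z\<bar>) \<bar>f z + g z\<bar>"
    and inj: "\<And>z z'. f z = f z' \<Longrightarrow> g z = g z' \<Longrightarrow> z = z'"
    and l: "f l = I" "g l = J" "f (neg l) = - I" "g (neg l) = - J"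
  shows "(coeff u z \<noteq> 0 \<longrightarrow> hx z \<le> I + J) \<and> (coeff u z \<noteq> 0 \<and> hx z = I + J \<longrightarrow> z = l \<or> z = neg l) \<and>
    coeff u l \<noteq> 0"
proof (intro conjI impI)
  show "coeff u l \<noteq> 0" using lead l(1,2) unfolding lead_def by blast
  show "hx z \<le> I + J" if "coeff u z \<noteq> 0"
    unfolding hx using lead that unfolding lead_def by (intro hex_extreme(1)) blast+
  show "z = l \<or> z = neg l" if nz: "coeff u z \<noteq> 0 \<and> hx z = I + J"
  proof -
    have "\<bar>f z\<bar> \<le> I" "\<bar>g z\<bar> \<le> J" using lead nz unfolding lead_def by blast+
    from hex_extreme(2)[OF this] nz have "(f z = I \<and> g z = J) \<or> (f z = - I \<and> g z = - J)"
      unfolding hx by blast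
    then show ?thesis using inj[of z l] inj[of z "neg l"] l by metis
  qed
qed

text \<open>A reduced monomial involves at most two generators. In coordinates dual to their leading
  exponents each factor moves one coordinate only, so the support lies in a parallelogram on which
  the norm is largest at the label and its negative.\<close>

lemma lead_pi:
  assumes "nrm m"
  shows "coeff (pi (e m)) x \<noteq> 0 \<Longrightarrow> hx x \<le> int (tdeg m)"
    and "coeff (pi (e m)) x \<noteq> 0 \<Longrightarrow> hx x = int (tdeg m) \<Longrightarrow> x = lab m \<or> x = neg (lab m)"
    and "coeff (pi (e m)) (lab m) \<noteq> 0"
proof -
  let ?M = "\<lambda>g. tor q (tg g)"
  obtain i j k where m: "m = (i, j, k)" by (cases m)
  have t1: "tg X1 = 1 \<bullet> (e (0, 1) + e (- 0, - 1))" by (simp add: tg_simps)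
  have t2: "tg X2 = 1 \<bullet> (e (1, 0) + e (- 1, - 0))" by (simp add: tg_simps)
  \<comment> \<open>The same image with (-1, 0) as its leading exponent, for the cone in which x3
    and x2 meet.\<close>
  have t2': "tg X2 = 1 \<bullet> (e (- 1, 0) + e (- (- 1), - 0))" by (simp add: tg_simps add_ac)
  have t3: "tg X3 = inverse q \<bullet> (e (- 1, 1) + e (- (- 1), - 1))" by (simp add: tg_simps)
  have base: "lead f g 0 0 (e (0, 0))" if h: "f (0, 0) = 0" "g (0, 0) = 0"
    "\<And>z. f z = 0 \<and> g z = 0 \<Longrightarrow> z = (0, 0)" for f g
    unfolding lead_def
  proof (intro conjI allI impI)
    fix x :: "int \<times> int" assume "coeff (e (0, 0)) x \<noteq> (0 :: 'a)"
    then have "x = (0, 0)" by (simp add: coeff_e split: if_splits)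
    then show "\<bar>f x\<bar> \<le> 0" "\<bar>g x\<bar> \<le> 0" using h(1,2) by simp_all
  next
    fix x :: "int \<times> int" assume "f x = 0 \<and> g x = 0"
    from h(3)[OF this] show "coeff (e (0, 0)) x \<noteq> (0 :: 'a)" by (simp add: coeff_e)
  qed
  have "i = 0 \<or> (i \<noteq> 0 \<and> j = 0) \<or> (i \<noteq> 0 \<and> j \<noteq> 0 \<and> k = 0)" using assms m by auto
  then have "(coeff (pi (e m)) x \<noteq> 0 \<longrightarrow> hx x \<le> int (tdeg m)) \<and>
    (coeff (pi (e m)) x \<noteq> 0 \<and> hx x = int (tdeg m) \<longrightarrow> x = lab m \<or> x = neg (lab m)) \<and> coeff (pi (e m)) (lab m) \<noteq> 0"
  proof (elim disjE conjE)
    assume i: "i = 0"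
    have "lead snd fst (0 + int k) 0 (foldr ?M (replicate k X1) (e (0, 0)))"
      by (rule lead_pow[OF t1]) (simp_all add: base prod_eq_iff)
    then have "lead fst snd 0 (int k) (foldr ?M (replicate k X1) (e (0, 0)))"
      by (simp only: lead_swap add_0)
    then have "lead fst snd (0 + int j) (int k) (foldr ?M (replicate j X2) (foldr ?M (replicate k X1) (e (0, 0))))"
      by (rule lead_pow[OF t2, rotated -1]) simp_all
    then have "lead fst snd (int j) (int k) (pi (e m))"
      by (simp only: pi_e m i fmon.simps foldr_append add_0 replicate_0 foldr.simps id_apply)
    from lead_hex[OF this, of "lab m" x] show ?thesis
      by (simp add: m i prod_eq_iff split_paired_all)
  next
    assume i: "i \<noteq> 0" "j = 0"
    \<comment> \<open>Coordinates dual to (-1, 1) and (0, 1): \<open>?f\<close> counts factors x3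
      and \<open>?g\<close> factors x1.\<close>
    let ?f = "\<lambda>z::int \<times> int. - fst z" and ?g = "\<lambda>z::int \<times> int. fst z + snd z"
    have "lead ?g ?f (0 + int k) 0 (foldr ?M (replicate k X1) (e (0, 0)))"
      by (rule lead_pow[OF t1]) (simp_all add: base prod_eq_iff)
    then have "lead ?f ?g 0 (int k) (foldr ?M (replicate k X1) (e (0, 0)))"
      by (simp only: lead_swap[of ?g] add_0)
    then have "lead ?f ?g (0 + int i) (int k) (foldr ?M (replicate i X3) (foldr ?M (replicate k X1) (e (0, 0))))"
      by (rule lead_pow[OF t3, rotated -1]) simp_all
    then have "lead ?f ?g (int i) (int k) (pi (e m))"
      by (simp only: pi_e m i fmon.simps foldr_append add_0 replicate_0 foldr.simps id_apply)
    moreover have "hx z = max (max \<bar>- fst z\<bar> \<bar>fst z + snd z\<bar>) \<bar>- fst z + (fst z + snd z)\<bar>" for z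
    proof (cases z)
      case (Pair a b)
      have 1: "\<bar>- a\<bar> = \<bar>a\<bar>" and 2: "- a + (a + b) = b" by simp_all
      show ?thesis unfolding Pair fst_conv snd_conv 1 2 hx.simps by (simp only: max.assoc max.commute max.left_commute)
    qed
    ultimately show ?thesis
      using lead_hex[of ?f ?g "int i" "int k" "pi (e m)" "lab m" x] i by (simp add: m prod_eq_iff)
  next
    assume i: "i \<noteq> 0" "j \<noteq> 0" "k = 0"
    \<comment> \<open>Coordinates dual to (-1, 1) and (-1, 0): \<open>?f\<close> counts factors x3
      and \<open>?g\<close> factors x2.\<close>
    let ?f = "\<lambda>z::int \<times> int. snd z" and ?g = "\<lambda>z::int \<times> int. - (fst z + snd z)"
    have "lead ?g ?f (0 + int j) 0 (foldr ?M (replicate j X2) (e (0, 0)))"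
      by (rule lead_pow[OF t2']) (simp_all add: base prod_eq_iff)
    then have "lead ?f ?g 0 (int j) (foldr ?M (replicate j X2) (e (0, 0)))"
      by (simp only: lead_swap[of ?g] add_0)
    then have "lead ?f ?g (0 + int i) (int j) (foldr ?M (replicate i X3) (foldr ?M (replicate j X2) (e (0, 0))))"
      by (rule lead_pow[OF t3, rotated -1]) simp_all
    then have "lead ?f ?g (int i) (int j) (pi (e m))"
      by (simp only: pi_e m i(3) fmon.simps foldr_append add_0 replicate_0 foldr.simps id_apply)
    moreover have "hx z = max (max \<bar>snd z\<bar> \<bar>- (fst z + snd z)\<bar>) \<bar>snd z + - (fst z + snd z)\<bar>" for z
    proof (cases z)
      case (Pair a b)
      have 1: "\<bar>- (a + b)\<bar> = \<bar>a + b\<bar>" and 2: "\<bar>b + - (a + b)\<bar> = \<bar>a\<bar>" by (rule abs_minus_cancel, simp)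
      show ?thesis unfolding Pair fst_conv snd_conv 1 2 hx.simps by (simp only: max.assoc max.commute max.left_commute)
    qed
    ultimately show ?thesis
      using lead_hex[of ?f ?g "int i" "int j" "pi (e m)" "lab m" x] i by (simp add: m prod_eq_iff)
  qed
  then show "coeff (pi (e m)) x \<noteq> 0 \<Longrightarrow> hx x \<le> int (tdeg m)"
    "coeff (pi (e m)) x \<noteq> 0 \<Longrightarrow> hx x = int (tdeg m) \<Longrightarrow> x = lab m \<or> x = neg (lab m)"
    "coeff (pi (e m)) (lab m) \<noteq> 0" by blast+
qed

text \<open>Triangularity: a label of norm \<open>tdeg m\<close> could occur in
  \<open>pi (e m')\<close> only as a leading exponent, and labels separate the orbits.\<close>

lemma coeff_pi_lab:
  assumes "nrm m" "nrm m'" "tdeg m' \<le> tdeg m" "m' \<noteq> m"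
  shows "coeff (pi (e m')) (lab m) = 0"
proof (rule ccontr)
  assume nz: "coeff (pi (e m')) (lab m) \<noteq> 0"
  have "hx (lab m) \<le> int (tdeg m')" by (rule lead_pi(1)[OF assms(2) nz])
  then have "hx (lab m) = int (tdeg m')" using hx_lab[OF assms(1)] assms(3) by simp
  then have "lab m = lab m' \<or> lab m = neg (lab m')" by (rule lead_pi(2)[OF assms(2) nz])
  then show False using lab_inj[OF assms(1,2)] assms(4) by blast
qed

lemma coeff_pi: "coeff (pi v) x = (\<Sum>m\<in>keys v. coeff v m * coeff (pi (e m)) x)"
  by (subst is_lin_eq_lin[OF pi_lin]) (simp add: lin_def lookup_sum)

text \<open>At the label of a term of maximal degree no other term contributes, so nothing can
  cancel its nonzero leading coefficient.\<close>

lemma pi_inj_nrm: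
  assumes v: "v \<in> supp_in nrm" and pi: "pi v = 0"
  shows "v = 0"
proof (rule ccontr)
  assume "v \<noteq> 0"
  then obtain m where m: "m \<in> keys v" "\<And>m'. m' \<in> keys v \<Longrightarrow> tdeg m' \<le> tdeg m"
    using exists_max_wt[of v tdeg] by blast
  note nrm = supp_in_keysD[OF v]
  have "coeff (pi v) (lab m) = (\<Sum>m'\<in>keys v. if m' = m then coeff v m * coeff (pi (e m)) (lab m) else 0)"
    unfolding coeff_pi[of v]
  proof (rule sum.cong[OF refl])
    fix m' assume m': "m' \<in> keys v"
    show "coeff v m' * coeff (pi (e m')) (lab m) = (if m' = m then coeff v m * coeff (pi (e m)) (lab m) else 0)"
      using coeff_pi_lab[OF nrm[OF m(1)] nrm[OF m'] m(2)[OF m']] by (cases "m' = m") simp_all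
  qed
  also have "\<dots> = coeff v m * coeff (pi (e m)) (lab m)" using m(1) by simp
  finally show False using pi m(1) lead_pi(3)[OF nrm[OF m(1)]] by (simp add: in_keys_iff)
qed

text \<open>Descent on the hexagonal norm: the outermost layer of a fixed element is matched by
  reduced monomials, and the difference has smaller norm.\<close>

lemma pi_surj_bounded:
  "th f = f \<Longrightarrow> f \<in> supp_in (\<lambda>x. hx x < int n) \<Longrightarrow> \<exists>v. pi v = f"
proof (induction n arbitrary: f)
  case 0
  have "f = 0"
  proof (rule poly_mapping_eqI)
    fix x :: "int \<times> int"
    have "\<not> hx x < int 0" by (cases x) auto
    then show "coeff f x = coeff 0 x" using supp_inD[OF 0(2)] by simp
  qed
  then show ?case using pi_simps(3) by blast
next
  case (Suc n)
  let ?M = "{m. nrm m \<and> tdeg m = n}"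
  have fin: "finite ?M"
    by (rule finite_subset[of _ "{..n} \<times> {..n} \<times> {..n}"]) auto
  \<comment> \<open>Each coefficient of \<open>f\<close> at a label is divided by the leading
    coefficient of the monomial with that label; by \<open>coeff_pi_lab\<close> the monomials of
    degree n do not disturb one another there.\<close>
  define g where "g = (\<Sum>m\<in>?M. (coeff f (lab m) / coeff (pi (e m)) (lab m)) \<bullet> (e m :: idx \<Rightarrow>\<^sub>0 'a))"
  have co: "coeff (pi g) x = (\<Sum>m\<in>?M. coeff f (lab m) / coeff (pi (e m)) (lab m) * coeff (pi (e m)) x)" for x
    unfolding g_def by (simp add: is_lin_sum[OF pi_lin] lookup_sum)
  have co_lab: "coeff (f - pi g) (lab m) = 0" if m: "m \<in> ?M" for m
  proof -
    have "coeff (pi g) (lab m) = (\<Sum>m'\<in>?M. if m' = m then coeff f (lab m) else 0)"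
      unfolding co
    proof (rule sum.cong[OF refl])
      fix m' assume m': "m' \<in> ?M"
      show "coeff f (lab m') / coeff (pi (e m')) (lab m') * coeff (pi (e m')) (lab m) = (if m' = m then coeff f (lab m) else 0)"
        using m m' lead_pi(3)[of m] coeff_pi_lab[of m m'] by auto
    qed
    also have "\<dots> = coeff f (lab m)" using fin m by simp
    finally show ?thesis by (simp add: lookup_minus)
  qed
  have fixed: "th (f - pi g) = f - pi g" using Suc.prems(1) by (simp add: th_pi)
  have "f - pi g \<in> supp_in (\<lambda>x. hx x < int n)"
    unfolding supp_in_def mem_Collect_eq
  proof (intro allI impI)
    fix x assume x: "\<not> hx x < int n"
    show "coeff (f - pi g) x = 0"
    proof (cases "hx x = int n")
      case True
      obtain m where m: "nrm m" "x = lab m \<or> x = neg (lab m)" using lab_surj by blast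
      have "hx x = hx (lab m)" using m(2) hx_neg by metis
      then have mM: "m \<in> ?M" using hx_lab[OF m(1)] True m(1) by simp
      \<comment> \<open>Invariance under the inversion settles the opposite exponent, so matching at
        the labels is enough.\<close>
      have "coeff (f - pi g) (neg (lab m)) = coeff (f - pi g) (lab m)"
        using coeff_th[of "f - pi g" "fst (lab m)" "snd (lab m)"] unfolding fixed by simp
      then show ?thesis using m(2) co_lab[OF mM] by metis
    next
      case False
      then have gt: "hx x > int n" using x by simp
      have "coeff f x = 0" by (rule supp_inD[OF Suc.prems(2)]) (use gt in simp)
      moreover have "coeff (pi g) x = 0"
        unfolding co
      proof (rule sum.neutral, rule ballI)
        fix m assume m: "m \<in> ?M"
        have "coeff (pi (e m)) x = 0"
          using lead_pi(1)[of m x] m gt by fastforce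
        then show "coeff f (lab m) / coeff (pi (e m)) (lab m) * coeff (pi (e m)) x = 0" by simp
      qed
      ultimately show ?thesis by (simp add: lookup_minus)
    qed
  qed
  from Suc.IH[OF fixed this] obtain v where "pi v = f - pi g" by blast
  then have "pi (v + g) = f" by simp
  then show ?case by blast
qed

lemma pi_surj:
  assumes "th f = f"
  shows "\<exists>v. pi v = f"
proof (rule pi_surj_bounded[OF assms])
  show "f \<in> supp_in (\<lambda>x. hx x < int (Suc (\<Sum>x\<in>keys f. nat (hx x))))"
    unfolding supp_in_def mem_Collect_eq
  proof (intro allI impI, rule ccontr)
    fix x assume x: "\<not> hx x < int (Suc (\<Sum>x\<in>keys f. nat (hx x)))" "coeff f x \<noteq> 0"
    have "nat (hx x) \<le> (\<Sum>x\<in>keys f. nat (hx x))" using x(2) by (intro member_le_sum) (simp_all add: in_keys_iff)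
    with x(1) show False by linarith
  qed
qed

text \<open>With all generators in degree one, p has leading term x3 x2 x1, so a monomial containing
  all three letters is a multiple of p up to lower degree; induction on the degree removes such
  monomials.\<close>

lemma reduce_mod_P0: "\<exists>w. v - vm P0 w \<in> supp_in nrm"
proof -
  \<comment> \<open>All graded constants are 0, so in \<open>W.G\<close> the generators commute up
    to powers of q and leading coefficients are explicit.\<close>
  interpret W: qalg3_weight q "1 - q^2" "inverse q - q" "inverse q - q" "\<lambda>_. 1" 0 0 0
    by unfold_locales auto
  define S where "S = {v. \<exists>w. v - vm P0 w \<in> supp_in nrm}"
  have S: "subspc S"
    unfolding subspc_def
  proof (intro conjI ballI allI)
    show "0 \<in> S" unfolding S_def mem_Collect_eq by (rule exI[of _ 0]) (simp add: subspcD(1)[OF subspc_supp_in])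
    fix u v c assume "u \<in> S"
    then obtain w where w: "u - vm P0 w \<in> supp_in nrm" by (auto simp: S_def)
    have "c \<bullet> u - vm P0 (c \<bullet> w) \<in> supp_in nrm" using subspcD(3)[OF subspc_supp_in w, of c] by simp
    then show "c \<bullet> u \<in> S" unfolding S_def by blast
  next
    fix u v assume "u \<in> S" "v \<in> S"
    then obtain w w' where w: "u - vm P0 w \<in> supp_in nrm" "v - vm P0 w' \<in> supp_in nrm" by (auto simp: S_def)
    have "(u + v) - vm P0 (w + w') \<in> supp_in nrm" using subspcD(2)[OF subspc_supp_in w] by (simp add: algebra_simps)
    then show "u + v \<in> S" unfolding S_def by blast
  qed
  have G2: "W.G.L X2 (e (i, j, k)) = q ^ i \<bullet> e (i, Suc j, k)" for i j k
    by (induction i) (simp_all add: mult.commute)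
  have G10: "W.G.L X1 (e (0, j, k)) = q ^ j \<bullet> e (0, j, Suc k)" for j k
  proof (induction j)
    case (Suc j)
    then show ?case using G2[of 0 j "Suc k"] by (simp add: W.G.bas_X1_Suc mult.commute)
  qed simp
  have G1: "W.G.L X1 (e (i, j, k)) = (q ^ j * inverse (q ^ i)) \<bullet> e (i, j, Suc k)" for i j k
  proof (induction i)
    case 0
    then show ?case using G10 by simp
  next
    case (Suc i)
    then show ?case by (simp add: mult_ac)
  qed
  have "supp_in (\<lambda>m. tdeg m < n) \<subseteq> S" for n
  proof (induction n)
    case 0
    have "supp_in (\<lambda>m. tdeg m < 0) \<subseteq> {0}" by (auto simp: supp_in_def poly_mapping_eq_iff fun_eq_iff)
    then show ?case using subspcD(1)[OF S] by auto
  next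
    case (Suc n)
    have basis: "e m \<in> S" if m: "tdeg m < Suc n" for m
    proof (cases "nrm m")
      case True
      have "e m - vm P0 0 \<in> supp_in nrm" using True by simp
      then show ?thesis unfolding S_def by blast
    next
      case False
      then obtain i j k where ijk: "m = (Suc i, Suc j, Suc k)" by (cases m) (auto simp: gr0_conv_Suc)
      let ?m = "(i, j, k)" and ?t = "tdeg (i, j, k)"
      have n: "?t + 3 \<le> n" using m by (simp add: ijk)
      have em: "e ?m \<in> supp_in (\<lambda>m. tdeg m = ?t)" "e ?m \<in> supp_in (\<lambda>m. tdeg m \<le> ?t)" by simp_all
      \<comment> \<open>The coefficient of \<open>e m\<close> when x3 x2 x1 multiplies the smaller
        monomial in the graded algebra; a product of powers of q, hence invertible.\<close>
      define c where "c = q ^ i * (q ^ j * inverse (q ^ i))"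
      have c: "c \<noteq> 0" by (simp add: c_def)
      have "foldr W.G.L [X3, X2, X1] (e ?m) = c \<bullet> e m"
        using G1[of i j k] G2[of i j "Suc k"] by (simp add: ijk c_def mult_ac del: W.G.L_e) simp
      then have "L X3 (L X2 (L X1 (e ?m))) - c \<bullet> e m \<in> supp_in (\<lambda>m. tdeg m < ?t + 3)"
        using W.foldr_diff_wt[OF em(1), of "[X3, X2, X1]"] by (simp add: numeral_3_eq_3)
      then have 1: "L X3 (L X2 (L X1 (e ?m))) - c \<bullet> e m \<in> supp_in (\<lambda>m. tdeg m < n)"
        by (rule supp_in_mono) (use n in simp)
      have 2: "L g (L g (e ?m)) \<in> supp_in (\<lambda>m. tdeg m < n)" for g
      proof -
        have "L g (L g (e ?m)) \<in> supp_in (\<lambda>m. tdeg m \<le> ?t + 2)"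
          using W.foldr_wt[OF em(2), of "[g, g]"] by (simp add: numeral_2_eq_2)
        then show ?thesis by (rule supp_in_mono) (use n in simp)
      qed
      have 3: "e ?m \<in> supp_in (\<lambda>m. tdeg m < n)" using n by simp
      have "P (e ?m) - c \<bullet> e m = (L X3 (L X2 (L X1 (e ?m))) - c \<bullet> e m) - q \<bullet> L X3 (L X3 (e ?m))
          - inverse (q^2) \<bullet> L X2 (L X2 (e ?m)) - L X1 (L X1 (e ?m)) + (2 * (1 + inverse (q^2))) \<bullet> e ?m"
        unfolding P_def by simp
      also have "\<dots> \<in> supp_in (\<lambda>m. tdeg m < n)"
        by (intro subspcD(2)[OF subspc_supp_in] subspcD(3)[OF subspc_supp_in] subspcD(5)[OF subspc_supp_in] 1 2 3)
      finally have S1: "P (e ?m) - c \<bullet> e m \<in> S" using Suc.IH by blast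
      have S2: "P (e ?m) \<in> S"
      proof -
        have "P (e ?m) - vm P0 (e ?m) \<in> supp_in nrm" by (simp add: vm_P0 subspcD(1)[OF subspc_supp_in])
        then show ?thesis unfolding S_def by blast
      qed
      have "inverse c \<bullet> (P (e ?m) - (P (e ?m) - c \<bullet> e m)) \<in> S"
        by (rule subspcD(3)[OF S subspcD(5)[OF S S2 S1]])
      moreover have "inverse c \<bullet> (P (e ?m) - (P (e ?m) - c \<bullet> e m)) = e m" using c by simp
      ultimately show ?thesis by (simp only:)
    qed
    show ?case
    proof
      fix u :: "idx \<Rightarrow>\<^sub>0 'a" assume "u \<in> supp_in (\<lambda>m. tdeg m < Suc n)"
      then have "lin e u \<in> S" by (intro subspc_lin[OF S] basis) (rule supp_in_keysD)
      then show "u \<in> S" by (simp add: lin_expand)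
    qed
  qed
  moreover have "\<exists>n. v \<in> supp_in (\<lambda>m. tdeg m < n)"
  proof (cases "v = 0")
    case True
    then show ?thesis using subspcD(1)[OF subspc_supp_in] by blast
  next
    case False
    obtain m where "m \<in> keys v" "\<And>m'. m' \<in> keys v \<Longrightarrow> tdeg m' \<le> tdeg m"
      using exists_max_wt[OF False, of tdeg] by blast
    then have "v \<in> supp_in (\<lambda>m'. tdeg m' < Suc (tdeg m))"
      unfolding supp_in_def mem_Collect_eq less_Suc_eq_le by (metis in_keys_iff)
    then show ?thesis by blast
  qed
  ultimately show ?thesis unfolding S_def by blast
qed

text \<open>Modulo multiples of \<open>P0\<close> every element is reduced, and \<open>pi\<close> is
  injective on reduced elements.\<close>

theorem pi_ker: "pi v = 0 \<longleftrightarrow> v \<in> range (vm P0)"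
proof
  assume pi: "pi v = 0"
  obtain w where w: "v - vm P0 w \<in> supp_in nrm" using reduce_mod_P0 by blast
  have "pi (v - vm P0 w) = 0" by (simp add: pi pi_vm pi_P0)
  then have "v - vm P0 w = 0" by (rule pi_inj_nrm[OF w])
  then show "v \<in> range (vm P0)" by auto
qed (auto simp: pi_vm pi_P0)

end

section \<open>The fixed ring\<close>

context torus_quotient
begin

lemma T_alg_eq: "T_alg q = T"
  by (simp add: T_alg_def T_rels_eq)

lemma psi_ops:
  "psi u \<otimes>\<^bsub>T\<^esub> psi v = psi (vm u v)" "psi u \<oplus>\<^bsub>T\<^esub> psi v = psi (u + v)" "psi u \<ominus>\<^bsub>T\<^esub> psi v = psi (u - v)"
  "c \<odot>\<^bsub>T\<^esub> psi u = psi (c \<bullet> u)" "\<one>\<^bsub>T\<^esub> = psi (e (0, 0, 0))" "psi u \<in> carrier T"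
  using alg_isoD(1)[OF psi_iso, of u] alg_isoD(2)[OF psi_iso, of u v] alg_isoD(3)[OF psi_iso, of u v]
    alg_isoD(4)[OF psi_iso] alg_isoD(5)[OF psi_iso, of u c]
    alg_iso_minus[OF psi_iso falgD(1)[OF falg_Valg] ring_presented, of u v]
  by (simp_all add: typed_alg_minus[OF falgD(1)[OF falg_Valg]])

lemma T_p_eq: "T_p q = psi P0"
proof -
  interpret T: ring T by (rule ring_presented)
  have sq: "psi u [^]\<^bsub>T\<^esub> (2::nat) = psi (vm u u)" for u
  proof -
    have "psi u [^]\<^bsub>T\<^esub> Suc 1 = psi u \<otimes>\<^bsub>T\<^esub> psi u"
      by (simp only: T.nat_pow_Suc T.nat_pow_eone[OF psi_ops(6)])
    then show ?thesis by (simp only: Suc_1 psi_ops(1))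
  qed
  have g: "T_gen q g = psi (e (gidx g))" for g
    by (simp add: T_gen_def T_rels_eq psi_gen)
  have "T_p q = psi (vm (vm (e (gidx X3)) (e (gidx X2))) (e (gidx X1)) - q \<bullet> vm (e (gidx X3)) (e (gidx X3))
    - inverse (q^2) \<bullet> vm (e (gidx X2)) (e (gidx X2)) - vm (e (gidx X1)) (e (gidx X1))
    + (2 * (1 + inverse (q^2))) \<bullet> e (0, 0, 0))"
    unfolding T_p_def Let_def T_alg_eq g sq psi_ops ..
  also have "vm (vm (e (gidx X3)) (e (gidx X2))) (e (gidx X1)) - q \<bullet> vm (e (gidx X3)) (e (gidx X3))
    - inverse (q^2) \<bullet> vm (e (gidx X2)) (e (gidx X2)) - vm (e (gidx X1)) (e (gidx X1))
    + (2 * (1 + inverse (q^2))) \<bullet> e (0, 0, 0) = P0"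
    using vm_one(2)[of "e (gidx X1)"] vm_one(2)[of "e (gidx X2)"] vm_one(2)[of "e (gidx X3)"]
    unfolding P0_def P_def vm_gen by (simp only: vm_L vm_gen)
  finally show ?thesis .
qed

lemma T_p_central: "is_central (T_alg q) (T_p q)"
  unfolding is_central_def T_alg_eq T_p_eq
proof (intro conjI ballI)
  fix a assume "a \<in> carrier T"
  then obtain u where "a = psi u" using alg_isoD(7)[OF psi_iso] by auto
  then show "psi P0 \<otimes>\<^bsub>T\<^esub> a = a \<otimes>\<^bsub>T\<^esub> psi P0" by (simp only: psi_ops P0_central)
qed (rule psi_ops)

abbreviation "J \<equiv> {T_p q \<otimes>\<^bsub>T_alg q\<^esub> t | t. t \<in> carrier (T_alg q)}"

lemma J_eq: "J = psi ` range (vm P0)"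
proof -
  have c: "carrier T = range psi" using alg_isoD(7)[OF psi_iso] by simp
  show ?thesis unfolding T_alg_eq T_p_eq c
  proof (intro equalityI subsetI)
    fix x assume "x \<in> psi ` range (vm P0)"
    then obtain w where "x = psi P0 \<otimes>\<^bsub>T\<^esub> psi w" unfolding psi_ops(1) by blast
    then show "x \<in> {psi P0 \<otimes>\<^bsub>T\<^esub> t | t. t \<in> range psi}" by blast
  qed (auto simp: psi_ops(1))
qed

text \<open>The right multiples of p absorb left factors because p is central.\<close>

lemma ideal_J: "ideal J T"
proof (rule idealI[OF ring_presented])
  have sub: "subspc (range (vm P0))"
    unfolding subspc_def
  proof (intro conjI ballI allI)
    show "0 \<in> range (vm P0)" by (rule range_eqI[of _ _ 0]) simp
    fix u v c assume "u \<in> range (vm P0)"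
    then obtain w where w: "u = vm P0 w" by blast
    show "c \<bullet> u \<in> range (vm P0)" by (rule range_eqI[of _ _ "c \<bullet> w"]) (simp add: w)
  next
    fix u v assume "u \<in> range (vm P0)" "v \<in> range (vm P0)"
    then obtain w w' where w: "u = vm P0 w" "v = vm P0 w'" by blast
    show "u + v \<in> range (vm P0)" by (rule range_eqI[of _ _ "w + w'"]) (simp add: w)
  qed
  show "subgroup J (add_monoid T)"
    unfolding J_eq using alg_iso_lin_subspace[OF psi_iso falg_Valg ring_presented sub]
    by (auto simp: lin_subspace_def dest: additive_subgroup.a_subgroup)
  fix a x assume "a \<in> J" and x: "x \<in> carrier T"
  then obtain w where w: "a = psi (vm P0 w)" unfolding J_eq by auto
  obtain u where u: "x = psi u" using x alg_isoD(7)[OF psi_iso] by auto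
  have "vm u (vm P0 w) = vm P0 (vm u w)"
    using vm_assoc[of u P0 w] vm_assoc[of P0 u w] by (simp add: P0_central)
  then show "x \<otimes>\<^bsub>T\<^esub> a \<in> J" unfolding J_eq u w psi_ops by simp
  show "a \<otimes>\<^bsub>T\<^esub> x \<in> J" unfolding J_eq u w psi_ops vm_assoc by simp
qed

text \<open>A consequence of \<open>pi_ker\<close>; it turns every later question about the quotient
  into one about the quantum torus.\<close>

lemma J_coset_iff: "J +>\<^bsub>T\<^esub> psi u = J +>\<^bsub>T\<^esub> psi v \<longleftrightarrow> pi u = pi v"
proof -
  have "J +>\<^bsub>T\<^esub> psi u = J +>\<^bsub>T\<^esub> psi v \<longleftrightarrow> psi (u - v) \<in> psi ` range (vm P0)"
    unfolding quot_alg_coset_eq[OF ideal_J psi_ops(6) psi_ops(6)] psi_ops(3) by (simp only: J_eq)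
  also have "\<dots> \<longleftrightarrow> u - v \<in> range (vm P0)"
    using alg_isoD(6)[OF psi_iso] by (auto simp: inj_on_def)
  finally show ?thesis unfolding pi_ker[symmetric] by simp
qed

lemma T_mod_p_eq: "T_mod_p q = quot_alg T J"
  by (simp only: T_mod_p_def T_alg_eq)

lemma T_mod_p_cases:
  assumes "x \<in> carrier (T_mod_p q)"
  obtains u where "x = J +>\<^bsub>T\<^esub> psi u"
proof -
  obtain a where "a \<in> carrier T" "x = J +>\<^bsub>T\<^esub> a"
    using assms unfolding T_mod_p_eq by (rule quot_alg_cases[OF ideal_J])
  moreover then obtain u where "a = psi u" using alg_isoD(7)[OF psi_iso] by auto
  ultimately show ?thesis using that by blast
qed

lemma T_mod_p_ops:
  "J +>\<^bsub>T\<^esub> psi u \<in> carrier (T_mod_p q)"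
  "(J +>\<^bsub>T\<^esub> psi u) \<otimes>\<^bsub>T_mod_p q\<^esub> (J +>\<^bsub>T\<^esub> psi v) = J +>\<^bsub>T\<^esub> psi (vm u v)"
  "(J +>\<^bsub>T\<^esub> psi u) \<oplus>\<^bsub>T_mod_p q\<^esub> (J +>\<^bsub>T\<^esub> psi v) = J +>\<^bsub>T\<^esub> psi (u + v)"
  "\<one>\<^bsub>T_mod_p q\<^esub> = J +>\<^bsub>T\<^esub> psi (e (0, 0, 0))"
  "c \<odot>\<^bsub>T_mod_p q\<^esub> (J +>\<^bsub>T\<^esub> psi u) = J +>\<^bsub>T\<^esub> psi (c \<bullet> u)"
proof -
  note ops = quot_alg_coset_ops[OF ideal_J psi_ops(6) psi_ops(6)]
  show "J +>\<^bsub>T\<^esub> psi u \<in> carrier (T_mod_p q)"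
    unfolding T_mod_p_eq by (rule quot_alg_coset[OF ideal_J psi_ops(6)])
  show "(J +>\<^bsub>T\<^esub> psi u) \<otimes>\<^bsub>T_mod_p q\<^esub> (J +>\<^bsub>T\<^esub> psi v) = J +>\<^bsub>T\<^esub> psi (vm u v)"
    unfolding T_mod_p_eq ops psi_ops ..
  show "(J +>\<^bsub>T\<^esub> psi u) \<oplus>\<^bsub>T_mod_p q\<^esub> (J +>\<^bsub>T\<^esub> psi v) = J +>\<^bsub>T\<^esub> psi (u + v)"
    unfolding T_mod_p_eq ops psi_ops ..
  show "\<one>\<^bsub>T_mod_p q\<^esub> = J +>\<^bsub>T\<^esub> psi (e (0, 0, 0))"
    unfolding T_mod_p_eq ops psi_ops ..
  show "c \<odot>\<^bsub>T_mod_p q\<^esub> (J +>\<^bsub>T\<^esub> psi u) = J +>\<^bsub>T\<^esub> psi (c \<bullet> u)"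
    unfolding T_mod_p_eq quot_alg_coset_smult[OF ideal_J falg_presented psi_ops(6)] psi_ops ..
qed

lemma psi_0: "psi 0 = \<zero>\<^bsub>T\<^esub>"
  using alg_iso_zero[OF psi_iso falgD(1)[OF falg_Valg] ring_presented] by simp

lemma T_mod_p_zero: "\<zero>\<^bsub>T_mod_p q\<^esub> = J +>\<^bsub>T\<^esub> psi 0"
proof -
  interpret ideal J T by (rule ideal_J)
  have "J +>\<^bsub>T\<^esub> \<zero>\<^bsub>T\<^esub> = J" 
    by (rule a_rcos_const[OF additive_subgroup.zero_closed[OF additive_subgroup_axioms]])
  then show ?thesis unfolding T_mod_p_eq psi_0 by (simp add: FactRing_def)
qed

theorem T_mod_p_domain: "nc_domain (T_mod_p q)"
  unfolding nc_domain_def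
proof (intro conjI ballI impI)
  show "ring (T_mod_p q)" unfolding T_mod_p_eq by (rule ring_quot_alg[OF ideal_J])
  have "e (0, 0) \<noteq> (0 :: int \<times> int \<Rightarrow>\<^sub>0 'a)" by (metis coeff_e lookup_zero zero_neq_one)
  then show "\<one>\<^bsub>T_mod_p q\<^esub> \<noteq> \<zero>\<^bsub>T_mod_p q\<^esub>"
    unfolding T_mod_p_ops T_mod_p_zero J_coset_iff by (simp add: pi_one)
  fix a b assume ab: "a \<in> carrier (T_mod_p q)" "b \<in> carrier (T_mod_p q)" "a \<otimes>\<^bsub>T_mod_p q\<^esub> b = \<zero>\<^bsub>T_mod_p q\<^esub>"
  obtain u where u: "a = J +>\<^bsub>T\<^esub> psi u" by (rule T_mod_p_cases[OF ab(1)])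
  obtain v where v: "b = J +>\<^bsub>T\<^esub> psi v" by (rule T_mod_p_cases[OF ab(2)])
  have "tor q (pi u) (pi v) = 0"
    using ab(3) unfolding u v T_mod_p_ops T_mod_p_zero J_coset_iff by (simp add: pi_vm)
  then show "a = \<zero>\<^bsub>T_mod_p q\<^esub> \<or> b = \<zero>\<^bsub>T_mod_p q\<^esub>"
    unfolding u v T_mod_p_zero J_coset_iff using tor_domain by simp
qed

text \<open>The isomorphism sends a fixed element to the class of a chosen preimage under
  \<open>pi\<close>, which does not depend on the choice. The map \<open>h\<close> passes from the
  model of the torus to the ring \<open>S\<close> of the statement.\<close>

lemma fixed_iso:
  assumes h: "h \<in> alg_iso (typed_alg (tor q) (e (0, 0))) S"
    and \<theta>: "\<And>u. \<theta> (h u) = h (th u)"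
  shows "\<exists>\<phi>. \<phi> \<in> alg_iso (fixed_subalg S \<theta>) (T_mod_p q)"
proof -
  define p where "p = inv_into UNIV h"
  have inj: "h u = h v \<longleftrightarrow> u = v" for u v using alg_isoD(6)[OF h] by (auto simp: inj_on_def)
  have ph: "p (h u) = u" for u
    unfolding p_def by (rule inv_into_f_f) (use alg_isoD(6)[OF h] in simp_all)
  define sel where "sel u = (SOME v. pi v = u)" for u
  have sel: "pi (sel u) = u" if "th u = u" for u
    unfolding sel_def by (rule someI_ex[OF pi_surj[OF that]])
  let ?F = "fixed_subalg S \<theta>" and ?\<phi> = "\<lambda>s. J +>\<^bsub>T\<^esub> psi (sel (p s))"
  have F: "carrier ?F = h ` {u. th u = u}"
  proof -
    have "carrier S = range h" using alg_isoD(7)[OF h] by simp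
    then show ?thesis by (auto simp: fixed_subalg_def \<theta> inj)
  qed
  have Fops: "s \<otimes>\<^bsub>?F\<^esub> t = s \<otimes>\<^bsub>S\<^esub> t" "s \<oplus>\<^bsub>?F\<^esub> t = s \<oplus>\<^bsub>S\<^esub> t" "\<one>\<^bsub>?F\<^esub> = \<one>\<^bsub>S\<^esub>" "c \<odot>\<^bsub>?F\<^esub> s = c \<odot>\<^bsub>S\<^esub> s" for s t c
    by (simp_all add: fixed_subalg_def)
  have hops: "h u \<otimes>\<^bsub>S\<^esub> h v = h (tor q u v)" "h u \<oplus>\<^bsub>S\<^esub> h v = h (u + v)" "\<one>\<^bsub>S\<^esub> = h (e (0, 0))"
    "c \<odot>\<^bsub>S\<^esub> h u = h (c \<bullet> u)" for u v c
    using alg_isoD(2,3)[OF h, of u v] alg_isoD(4)[OF h] alg_isoD(5)[OF h, of u c] by simp_all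
  have "?\<phi> \<in> alg_iso ?F (T_mod_p q)"
  proof (rule alg_isoI)
    fix s t c assume "s \<in> carrier ?F" "t \<in> carrier ?F"
    then obtain u v where uv: "s = h u" "th u = u" "t = h v" "th v = v" unfolding F by auto
    have "th (tor q u v) = tor q u v" "th (u + v) = u + v" by (simp_all add: th_tor uv)
    note fx = sel[OF this(1)] sel[OF this(2)] sel[OF uv(2)] sel[OF uv(4)]
    show "?\<phi> (s \<otimes>\<^bsub>?F\<^esub> t) = ?\<phi> s \<otimes>\<^bsub>T_mod_p q\<^esub> ?\<phi> t"
      unfolding Fops uv(1,3) hops ph T_mod_p_ops J_coset_iff pi_vm fx ..
    show "?\<phi> (s \<oplus>\<^bsub>?F\<^esub> t) = ?\<phi> s \<oplus>\<^bsub>T_mod_p q\<^esub> ?\<phi> t"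
      unfolding Fops uv(1,3) hops ph T_mod_p_ops J_coset_iff pi_simps fx ..
  next
    fix s c assume "s \<in> carrier ?F"
    then obtain u where u: "s = h u" "th u = u" unfolding F by auto
    show "?\<phi> s \<in> carrier (T_mod_p q)" by (rule T_mod_p_ops)
    have "th (c \<bullet> u) = c \<bullet> u" by (simp add: u)
    note fx = sel[OF this] sel[OF u(2)]
    show "?\<phi> (c \<odot>\<^bsub>?F\<^esub> s) = c \<odot>\<^bsub>T_mod_p q\<^esub> ?\<phi> s"
      unfolding Fops u(1) hops ph T_mod_p_ops J_coset_iff pi_simps fx ..
  next
    have "th (e (0, 0)) = e (0, 0)" by simp
    note fx = sel[OF this]
    show "?\<phi> \<one>\<^bsub>?F\<^esub> = \<one>\<^bsub>T_mod_p q\<^esub>"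
      unfolding Fops hops ph T_mod_p_ops J_coset_iff fx pi_one ..
    show "inj_on ?\<phi> (carrier ?F)"
    proof (rule inj_onI)
      fix s t assume st: "s \<in> carrier ?F" "t \<in> carrier ?F" "?\<phi> s = ?\<phi> t"
      then obtain u v where uv: "s = h u" "th u = u" "t = h v" "th v = v" unfolding F by auto
      show "s = t" using st(3) unfolding uv(1,3) ph J_coset_iff sel[OF uv(2)] sel[OF uv(4)] by simp
    qed
    fix x assume "x \<in> carrier (T_mod_p q)"
    then obtain u where u: "x = J +>\<^bsub>T\<^esub> psi u" by (rule T_mod_p_cases)
    have "x = ?\<phi> (h (pi u))" unfolding u ph J_coset_iff sel[OF th_pi] ..
    moreover have "h (pi u) \<in> carrier ?F" unfolding F using th_pi by blast
    ultimately show "x \<in> ?\<phi> ` carrier ?F" by blast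
  qed
  then show ?thesis by blast
qed

end

subsection \<open>Skew Laurent polynomials\<close>

text \<open>Nonnegative powers follow by induction; for negative ones, the image of
  \<open>E (- n)\<close> is a left inverse of \<open>E' n\<close> and hence equals
  \<open>E' (- n)\<close>. With this, the twist and the inversion are determined by their values on
  generators.\<close>

lemma mult_hom_int_powers:
  fixes E E' :: "int \<Rightarrow> 'b"
  assumes assoc: "\<And>u v w. m (m u v) w = m u (m v w)" and one: "\<And>u. m (E 0) u = u" "\<And>u. m u (E 0) = u"
    and E: "\<And>j k. m (E j) (E k) = E (j + k)" "\<And>j k. m (E' j) (E' k) = E' (j + k)" "E' 0 = E 0"
    and \<phi>: "\<And>u v. \<phi> (m u v) = m (\<phi> u) (\<phi> v)" "\<phi> (E 0) = E 0" "\<phi> (E 1) = E' 1"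
  shows "\<phi> (E k) = E' k"
proof -
  have pos: "\<phi> (E (int n)) = E' (int n)" for n
  proof (induction n)
    case (Suc n)
    have "\<phi> (E (int (Suc n))) = \<phi> (m (E (int n)) (E 1))" by (simp add: E add.commute)
    also have "\<dots> = m (E' (int n)) (E' 1)" by (simp only: \<phi>(1,3) Suc)
    also have "\<dots> = E' (int (Suc n))" by (simp add: E(2) add.commute)
    finally show ?case .
  qed (simp add: E \<phi>)
  have "\<phi> (E (- int n)) = E' (- int n)" for n
  proof -
    have "m (\<phi> (E (- int n))) (E' (int n)) = \<phi> (m (E (- int n)) (E (int n)))" by (simp only: \<phi> pos)
    also have "\<dots> = E 0" by (simp only: E add.left_inverse \<phi>)
    finally have "m (m (\<phi> (E (- int n))) (E' (int n))) (E' (- int n)) = E' (- int n)" by (simp only: one)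
    then show ?thesis by (simp only: assoc E add.right_inverse one)
  qed
  then show ?thesis using pos by (cases k) (auto simp del: of_nat_Suc)
qed

lemma coeff_diag: "coeff (diag s u) m = s m * coeff u m"
proof -
  have "coeff (diag s u) m = (\<Sum>k\<in>keys u. if k = m then s m * coeff u m else 0)"
    unfolding diag_def lin_def lookup_sum by (rule sum.cong) (auto simp: coeff_e)
  then show ?thesis by (simp add: in_keys_iff)
qed

text \<open>Keeps the unit of the Laurent polynomials in the form \<open>e 0\<close>, like the other
  monomials.\<close>

declare single_one [simp del]

section \<open>Laurent polynomials in y\<close>

definition lm :: "(int \<Rightarrow>\<^sub>0 'a::field) \<Rightarrow> (int \<Rightarrow>\<^sub>0 'a) \<Rightarrow> (int \<Rightarrow>\<^sub>0 'a)" where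
  "lm = tw (+) (\<lambda>_ _. 1)"

lemma lm_e [simp]: "lm (e i) (e j) = e (i + j)"
  by (simp add: lm_def)

lemma lm_lin [simp]: "is_lin (lm u)" "is_lin (\<lambda>u. lm u v)"
  by (simp_all add: lm_def)

lemmas lm_simps [simp] = is_linD[OF lm_lin(1)] is_linD[OF lm_lin(2)]

lemma lm_assoc: "lm (lm u v) w = lm u (lm v w)"
  unfolding lm_def by (rule tw_assoc) auto

lemma lm_one [simp]: "lm (e 0) u = u" "lm u (e 0) = u"
  unfolding lm_def by (rule tw_unit, simp, simp, rule tw_unit', simp, simp)

lemma falg_lm: "falg (typed_alg lm (e 0))"
  by (rule falg_typed_alg) (simp_all add: is_bilin_def lm_assoc)

lemma coeff_lm: "coeff (lm u v) n = (\<Sum>i\<in>keys u. coeff u i * coeff v (n - i))"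
proof -
  have 1: "coeff (lm (e i) v) n = coeff v (n - i)" for i
  proof -
    have "coeff (lm (e i) v) n = (\<Sum>k\<in>keys v. coeff v k * coeff (lm (e i) (e k)) n)"
      by (subst is_lin_eq_lin[OF lm_lin(1)]) (simp add: lin_def lookup_sum)
    also have "\<dots> = (\<Sum>k\<in>keys v. if k = n - i then coeff v (n - i) else 0)"
      by (rule sum.cong) (auto simp: coeff_e)
    finally show ?thesis by (simp add: in_keys_iff)
  qed
  have "coeff (lm u v) n = (\<Sum>i\<in>keys u. coeff u i * coeff (lm (e i) v) n)"
    by (subst is_lin_eq_lin[OF lm_lin(2)]) (simp add: lin_def lookup_sum)
  then show ?thesis by (simp only: 1)
qed

lemma base_field_finsum: "(\<Oplus>\<^bsub>base_field\<^esub>i\<in>I. f i) = (\<Sum>i\<in>I. f i)"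
proof -
  interpret abelian_monoid base_field
    by (rule abelian_monoidI) (auto simp: base_field_def)
  have z: "\<zero>\<^bsub>base_field\<^esub> = 0" "add base_field = (+)" "carrier base_field = UNIV" by (simp_all add: base_field_def)
  show ?thesis
    by (induction I rule: infinite_finite_induct) (simp_all add: finsum_infinite z Pi_def)
qed

lemma laurent_iso: "(coeff :: (int \<Rightarrow>\<^sub>0 'a::field) \<Rightarrow> _) \<in> alg_iso (typed_alg lm (e 0)) laurent_poly"
proof (rule alg_isoI)
  have it: "iterate_int base_field id i = id" for i
    by (simp add: iterate_int_def base_field_def)
  fix u v :: "int \<Rightarrow>\<^sub>0 'a" and c
  show "coeff u \<in> carrier laurent_poly" by (simp add: skew_laurent_def base_field_def)
  have "(\<Oplus>\<^bsub>base_field\<^esub>i\<in>{i. coeff u i \<noteq> 0}. coeff u i * coeff v (n - i)) = coeff (lm u v) n" for n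
    unfolding base_field_finsum coeff_lm by (rule sum.cong) (auto simp: in_keys_iff)
  then show "coeff (u \<otimes>\<^bsub>typed_alg lm (e 0)\<^esub> v) = coeff u \<otimes>\<^bsub>laurent_poly\<^esub> coeff v"
    by (intro ext) (simp add: skew_laurent_def it, simp add: base_field_def)
  show "coeff (u \<oplus>\<^bsub>typed_alg lm (e 0)\<^esub> v) = coeff u \<oplus>\<^bsub>laurent_poly\<^esub> coeff v"
    by (rule ext) (simp add: skew_laurent_def base_field_def lookup_add)
  show "coeff (c \<odot>\<^bsub>typed_alg lm (e 0)\<^esub> u) = c \<odot>\<^bsub>laurent_poly\<^esub> coeff u"
    by (rule ext) (simp add: skew_laurent_def base_field_def)
  show "coeff \<one>\<^bsub>typed_alg lm (e 0)\<^esub> = \<one>\<^bsub>laurent_poly\<^esub>"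
    by (rule ext) (simp add: skew_laurent_def base_field_def coeff_e)
  show "inj_on coeff (carrier (typed_alg lm (e 0)))"
    by (simp add: inj_on_def lookup_inject)
  show "f \<in> carrier laurent_poly \<Longrightarrow> f \<in> coeff ` carrier (typed_alg lm (e 0))" for f :: "int \<Rightarrow> 'a"
    by (intro image_eqI[of _ _ "Abs_poly_mapping f"]) (auto simp: skew_laurent_def base_field_def)
qed

lemma coeff_zero_laurent: "\<zero>\<^bsub>laurent_poly\<^esub> = coeff 0"
  by (simp add: skew_laurent_def base_field_def fun_eq_iff)

lemma ring_laurent: "ring (laurent_poly :: ('a::field, _) module)"
  by (rule alg_iso_ring_zero[OF laurent_iso falgD(1)[OF falg_lm]]) (simp add: coeff_zero_laurent)

lemma laurent_ops:
  "coeff u \<in> carrier laurent_poly" "coeff u \<otimes>\<^bsub>laurent_poly\<^esub> coeff v = coeff (lm u v)"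
  "coeff u \<oplus>\<^bsub>laurent_poly\<^esub> coeff v = coeff (u + v)" "c \<odot>\<^bsub>laurent_poly\<^esub> coeff u = coeff (c \<bullet> u)"
  using alg_isoD(1)[OF laurent_iso, of u] alg_isoD(2,3)[OF laurent_iso, of u v] alg_isoD(5)[OF laurent_iso, of u c]
  by simp_all

lemma laurent_one: "\<one>\<^bsub>laurent_poly\<^esub> = coeff (e 0 :: int \<Rightarrow>\<^sub>0 'a::field)"
  by (simp add: skew_laurent_def base_field_def fun_eq_iff coeff_e)

lemma laurent_var_eq: "laurent_var base_field = coeff (e 1 :: int \<Rightarrow>\<^sub>0 'a::field)"
  by (simp add: laurent_var_def base_field_def fun_eq_iff coeff_e)

lemma laurent_carrierE:
  assumes "f \<in> carrier laurent_poly"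
  obtains u where "f = coeff u"
  using assms alg_isoD(7)[OF laurent_iso] by auto

section \<open>The twist, the skew Laurent ring and its inversion\<close>

context quantum_torus
begin

context
  fixes \<alpha> :: "(int \<Rightarrow> 'a) \<Rightarrow> (int \<Rightarrow> 'a)"
  assumes \<alpha>: "torus_twist q \<alpha>"
begin

text \<open>An algebra automorphism of the Laurent polynomials is determined by the image of y,
  negative powers included; sending y to q y scales y^m by q^m.\<close>

lemma twist_coeff: "\<alpha> (coeff u) = coeff (diag (\<lambda>m. q powi m) u)"
proof -
  have iso: "\<alpha> \<in> alg_iso laurent_poly laurent_poly" and var: "\<alpha> (coeff (e 1)) = coeff (q \<bullet> e 1)"
    using \<alpha> by (simp_all add: torus_twist_def laurent_var_eq laurent_ops)
  define a where "a u = Abs_poly_mapping (\<alpha> (coeff u))" for u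
  have ca: "coeff (a u) = \<alpha> (coeff u)" for u
    using alg_isoD(1)[OF iso laurent_ops(1)[of u]] by (auto simp: a_def skew_laurent_def base_field_def)
  have ops: "a (lm u v) = lm (a u) (a v)" "a (u + v) = a u + a v" "a (c \<bullet> u) = c \<bullet> a u" for u v c
    using alg_isoD(2,3)[OF iso laurent_ops(1)[of u] laurent_ops(1)[of v]] alg_isoD(5)[OF iso laurent_ops(1)[of u], of c]
    by (simp_all add: laurent_ops lookup_inject flip: ca)
  have a1: "a (e 0) = e 0" and av: "a (e 1) = q \<bullet> e 1"
    using alg_isoD(4)[OF iso] var by (simp_all add: laurent_one lookup_inject flip: ca)
  have ae: "a (e k) = q powi k \<bullet> e k" for k
  proof (rule mult_hom_int_powers[of lm e "\<lambda>k. q powi k \<bullet> e k" a])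
    show "lm (q powi j \<bullet> e j) (q powi k \<bullet> e k) = q powi (j + k) \<bullet> e (j + k)" for j k
      by (simp add: power_int_add mult.commute)
  qed (simp_all add: lm_assoc ops a1 av)
  have "is_lin a" by (rule is_linI) (rule ops)+
  then have "a u = diag (\<lambda>m. q powi m) u"
    by (rule is_lin_ext[OF _ diag_lin]) (simp only: ae diag_e)
  then show ?thesis by (simp only: ca[symmetric])
qed

lemma iterate_twist: "iterate_int laurent_poly \<alpha> i (coeff u) = coeff (diag (\<lambda>m. q powi (i * m)) u)"
proof -
  have comp: "diag s (diag t u) = diag (\<lambda>m. s m * t m) u" for s t :: "int \<Rightarrow> 'a" and u
    by (rule poly_mapping_eqI) (simp add: coeff_diag)
  \<comment> \<open>Taking \<open>c = 1\<close> covers the twist and \<open>c = -1\<close> its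
    inverse, so one induction serves both signs of \<open>i\<close>.\<close>
  have pow: "(f ^^ n) (coeff u) = coeff (diag (\<lambda>m. q powi (int n * (c * m))) u)"
    if f: "\<And>u. f (coeff u) = coeff (diag (\<lambda>m. q powi (c * m)) u)" for f c n and u :: "int \<Rightarrow>\<^sub>0 'a"
  proof (induction n)
    case 0
    show ?case by (rule ext) (simp add: coeff_diag)
  next
    case (Suc n)
    show ?case by (simp add: Suc f comp power_int_add[symmetric] algebra_simps)
  qed
  have iso: "\<alpha> \<in> alg_iso laurent_poly laurent_poly" using \<alpha> by (simp add: torus_twist_def)
  have inv: "inv_into (carrier laurent_poly) \<alpha> (coeff u) = coeff (diag (\<lambda>m. q powi (- 1 * m)) u)" for u
  proof (rule inv_into_f_eq[OF alg_isoD(6)[OF iso] laurent_ops(1)])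
    show "\<alpha> (coeff (diag (\<lambda>m. q powi (- 1 * m)) u)) = coeff u"
      unfolding twist_coeff comp by (rule ext) (simp add: coeff_diag power_int_add[symmetric])
  qed
  show ?thesis
  proof (cases "0 \<le> i")
    case True
    then show ?thesis using pow[of \<alpha> 1 "nat i" u] twist_coeff by (simp add: iterate_int_def)
  next
    case False
    then have i: "int (nat (- i)) * (- 1 * m) = i * m" for m by simp
    show ?thesis unfolding iterate_int_def if_not_P[OF False] pow[OF inv] i ..
  qed
qed

text \<open>The coefficient of x^b as a Laurent polynomial in y. Elements of the skew Laurent ring
  are indexed by the power of x, so \<open>rows\<close> exchanges the two coordinates of an
  exponent.\<close>

definition row :: "int \<Rightarrow> (int \<times> int \<Rightarrow>\<^sub>0 'a) \<Rightarrow> (int \<Rightarrow>\<^sub>0 'a)" where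
  "row b = lin (\<lambda>x. if snd x = b then e (fst x) else 0)"

lemma coeff_row: "coeff (row b u) a = coeff u (a, b)"
proof -
  have "coeff (row b u) a = (\<Sum>x\<in>keys u. if x = (a, b) then coeff u (a, b) else 0)"
    unfolding row_def lin_def lookup_sum by (rule sum.cong) (auto simp: coeff_e)
  then show ?thesis by (simp add: in_keys_iff)
qed

definition rows :: "(int \<times> int \<Rightarrow>\<^sub>0 'a) \<Rightarrow> int \<Rightarrow> int \<Rightarrow> 'a" where
  "rows u b = coeff (row b u)"

lemma rows_eq: "rows u b a = coeff u (a, b)"
  by (simp add: rows_def coeff_row)

abbreviation "S \<equiv> skew_laurent laurent_poly \<alpha>"

lemma coeff_tor_conv:
  "coeff (tor q u v) (m, n) = (\<Sum>x\<in>keys u. coeff u x * (q powi (snd x * (m - fst x)) * coeff v (m - fst x, n - snd x)))"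
proof -
  have "coeff (tor q u v) (m, n) = (\<Sum>x\<in>keys u. coeff u x * coeff (tor q (e x) v) (m, n))"
    by (subst is_lin_eq_lin[OF tor_lin(2)]) (simp add: lin_def lookup_sum)
  also have "\<dots> = (\<Sum>x\<in>keys u. coeff u x * (q powi (snd x * (m - fst x)) * coeff v (m - fst x, n - snd x)))"
    by (rule sum.cong[OF refl]) (metis coeff_tor_e prod.collapse)
  finally show ?thesis .
qed

lemma rows_mult: "rows u \<otimes>\<^bsub>S\<^esub> rows v = rows (tor q u v)"
proof (intro ext)
  fix n m
  let ?B = "{i. rows u i \<noteq> \<zero>\<^bsub>laurent_poly\<^esub>}"
  let ?g = "\<lambda>i a. coeff u (a, i) * (q powi (i * (m - a)) * coeff v (m - a, n - i))"
  have B: "?B = {i. row i u \<noteq> 0}" by (simp add: rows_def coeff_zero_laurent lookup_inject)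
  have "(rows u \<otimes>\<^bsub>S\<^esub> rows v) n m =
      (\<Oplus>\<^bsub>laurent_poly\<^esub>i\<in>?B. rows u i \<otimes>\<^bsub>laurent_poly\<^esub> iterate_int laurent_poly \<alpha> i (rows v (n - i))) m"
    by (simp only: skew_laurent_def[of laurent_poly \<alpha>] monoid.select_convs)
  also have "\<dots> = (\<Oplus>\<^bsub>laurent_poly\<^esub>i\<in>?B. coeff (lm (row i u) (diag (\<lambda>m. q powi (i * m)) (row (n - i) v)))) m"
    unfolding rows_def iterate_twist laurent_ops ..
  also have "\<dots> = (\<Sum>i\<in>?B. coeff (lm (row i u) (diag (\<lambda>m. q powi (i * m)) (row (n - i) v))) m)"
    unfolding alg_iso_typed_finsum[OF laurent_iso falg_lm ring_laurent] lookup_sum ..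
  \<comment> \<open>Rows and entries are summed over the projections of the support, which turns the
    double sum into one over a rectangle; the added terms vanish.\<close>
  also have "\<dots> = (\<Sum>i\<in>?B. \<Sum>a\<in>fst ` keys u. ?g i a)"
  proof (rule sum.cong[OF refl])
    fix i
    have sub: "keys (row i u) \<subseteq> fst ` keys u" by (force simp: in_keys_iff coeff_row)
    have "coeff (lm (row i u) (diag (\<lambda>m. q powi (i * m)) (row (n - i) v))) m = (\<Sum>a\<in>keys (row i u). ?g i a)"
      by (simp add: coeff_lm coeff_diag coeff_row)
    also have "\<dots> = (\<Sum>a\<in>fst ` keys u. ?g i a)"
      by (rule sum.mono_neutral_left[OF _ sub]) (auto simp: in_keys_iff coeff_row)
    finally show "coeff (lm (row i u) (diag (\<lambda>m. q powi (i * m)) (row (n - i) v))) m = (\<Sum>a\<in>fst ` keys u. ?g i a)" .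
  qed
  also have "\<dots> = (\<Sum>i\<in>snd ` keys u. \<Sum>a\<in>fst ` keys u. ?g i a)"
  proof (rule sum.mono_neutral_left)
    show "?B \<subseteq> snd ` keys u"
    proof
      fix i assume "i \<in> ?B"
      then have "row i u \<noteq> 0" by (simp add: B)
      then obtain a where "coeff (row i u) a \<noteq> 0" by (metis poly_mapping_eqI lookup_zero)
      then have "(a, i) \<in> keys u" by (simp add: coeff_row in_keys_iff)
      then show "i \<in> snd ` keys u" by force
    qed
    show "\<forall>i\<in>snd ` keys u - ?B. (\<Sum>a\<in>fst ` keys u. ?g i a) = 0"
    proof (intro ballI sum.neutral)
      fix i a assume "i \<in> snd ` keys u - ?B"
      then have "row i u = 0" by (simp add: B)
      then have "coeff u (a, i) = 0" using coeff_row[of i u a] by simp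
      then show "?g i a = 0" by simp
    qed
  qed simp
  also have "\<dots> = (\<Sum>x\<in>fst ` keys u \<times> snd ` keys u. ?g (snd x) (fst x))"
    by (subst sum.swap) (simp add: sum.cartesian_product case_prod_unfold)
  also have "\<dots> = (\<Sum>x\<in>keys u. ?g (snd x) (fst x))"
    by (rule sum.mono_neutral_right) (auto simp: in_keys_iff intro: rev_image_eqI)
  also have "\<dots> = rows (tor q u v) n m"
    unfolding rows_eq coeff_tor_conv by simp
  finally show "(rows u \<otimes>\<^bsub>S\<^esub> rows v) n m = rows (tor q u v) n m" .
qed

theorem rows_iso: "rows \<in> alg_iso (typed_alg (tor q) (e (0, 0))) S"
proof (rule alg_isoI)
  fix u v :: "int \<times> int \<Rightarrow>\<^sub>0 'a" and c
  have S: "carrier S = {f. range f \<subseteq> carrier laurent_poly \<and> finite {i. f i \<noteq> \<zero>\<^bsub>laurent_poly\<^esub>}}"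
    "one S = (\<lambda>n. if n = 0 then \<one>\<^bsub>laurent_poly\<^esub> else \<zero>\<^bsub>laurent_poly\<^esub>)"
    "add S = (\<lambda>f g n. f n \<oplus>\<^bsub>laurent_poly\<^esub> g n)" "smult S = (\<lambda>c f n. c \<odot>\<^bsub>laurent_poly\<^esub> f n)"
    by (simp_all add: skew_laurent_def[of laurent_poly \<alpha>])
  have "{i. rows u i \<noteq> \<zero>\<^bsub>laurent_poly\<^esub>} \<subseteq> snd ` keys u"
    by (auto simp: coeff_zero_laurent fun_eq_iff rows_eq in_keys_iff intro: rev_image_eqI)
  then show "rows u \<in> carrier S"
    unfolding S using finite_subset laurent_ops(1) by (auto simp: rows_def)
  show "rows (u \<otimes>\<^bsub>typed_alg (tor q) (e (0, 0))\<^esub> v) = rows u \<otimes>\<^bsub>S\<^esub> rows v"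
    by (simp only: rows_mult typed_alg_sel)
  show "rows (u \<oplus>\<^bsub>typed_alg (tor q) (e (0, 0))\<^esub> v) = rows u \<oplus>\<^bsub>S\<^esub> rows v"
    unfolding S rows_def laurent_ops by (intro ext) (simp add: coeff_row lookup_add)
  show "rows (c \<odot>\<^bsub>typed_alg (tor q) (e (0, 0))\<^esub> u) = c \<odot>\<^bsub>S\<^esub> rows u"
    unfolding S rows_def laurent_ops by (intro ext) (simp add: coeff_row)
  show "rows \<one>\<^bsub>typed_alg (tor q) (e (0, 0))\<^esub> = \<one>\<^bsub>S\<^esub>"
    unfolding S laurent_one coeff_zero_laurent by (intro ext) (simp add: rows_eq coeff_e)
  show "inj_on rows (carrier (typed_alg (tor q) (e (0, 0))))"
  proof (rule inj_onI, rule poly_mapping_eqI)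
    fix u v :: "int \<times> int \<Rightarrow>\<^sub>0 'a" and x assume "rows u = rows v"
    then have "rows u (snd x) (fst x) = rows v (snd x) (fst x)" by simp
    then show "coeff u x = coeff v x" by (simp add: rows_eq)
  qed
  fix f assume f: "f \<in> carrier S"
  have fin: "finite {i. f i \<noteq> \<zero>\<^bsub>laurent_poly\<^esub>}" and fin': "finite {a. f i a \<noteq> 0}" for i
  proof -
    show "finite {i. f i \<noteq> \<zero>\<^bsub>laurent_poly\<^esub>}" using f unfolding S by simp
    have "f i \<in> carrier laurent_poly" using f unfolding S by auto
    then obtain u where "f i = coeff u" by (rule laurent_carrierE)
    then show "finite {a. f i a \<noteq> 0}" by simp
  qed
  have "finite {x. f (snd x) (fst x) \<noteq> 0}"
  proof (rule finite_subset)
    show "{x. f (snd x) (fst x) \<noteq> 0} \<subseteq> (\<Union>i\<in>{i. f i \<noteq> \<zero>\<^bsub>laurent_poly\<^esub>}. {a. f i a \<noteq> 0} \<times> {i})"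
      by (auto simp: coeff_zero_laurent fun_eq_iff)
  qed (use fin fin' in auto)
  then have "f = rows (Abs_poly_mapping (\<lambda>x. f (snd x) (fst x)))"
    by (intro ext) (simp add: rows_eq)
  then show "f \<in> rows ` carrier (typed_alg (tor q) (e (0, 0)))" by simp
qed

lemma ring_S: "ring S"
proof (rule alg_iso_ring_zero[OF rows_iso falgD(1)[OF falg_tor]])
  have "\<zero>\<^bsub>S\<^esub> = (\<lambda>n. \<zero>\<^bsub>laurent_poly\<^esub>)" by (simp add: skew_laurent_def[of laurent_poly \<alpha>])
  then show "rows \<zero>\<^bsub>typed_alg (tor q) (e (0, 0))\<^esub> = \<zero>\<^bsub>S\<^esub>"
    by (simp add: coeff_zero_laurent fun_eq_iff rows_eq)
qed

lemma torus_gens: "torus_x = rows (e (0, 1))" "torus_y = rows (e (1, 0))"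
  by (auto simp: torus_x_def torus_y_def laurent_var_def[of laurent_poly] laurent_const_def laurent_var_eq
      laurent_one coeff_zero_laurent fun_eq_iff rows_eq coeff_e)

lemma torus_inversion_rows:
  assumes \<theta>: "torus_inversion S \<theta>"
  shows "\<theta> (rows u) = rows (th u)"
proof -
  interpret S: ring S by (rule ring_S)
  have iso: "\<theta> \<in> alg_iso S S" using \<theta> by (simp add: torus_inversion_def)
  note rD = alg_isoD[OF rows_iso]
  have ops: "rows u \<otimes>\<^bsub>S\<^esub> rows v = rows (tor q u v)" "rows u \<oplus>\<^bsub>S\<^esub> rows v = rows (u + v)"
    "c \<odot>\<^bsub>S\<^esub> rows u = rows (c \<bullet> u)" "rows u \<in> carrier S" for u v c
    using rD(1)[of u] rD(2,3)[of u v] rD(5)[of u c] by simp_all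
  have one: "\<one>\<^bsub>S\<^esub> = rows (e (0, 0))" using rD(4) by simp
  have inj: "rows u = rows v \<longleftrightarrow> u = v" for u v using rD(6) by (auto simp: inj_on_def)
  \<comment> \<open>The product of y^a x^b and y^-a x^-b is q^(-a b), so the inverse has this form
    on the axes a b = 0, which include x and y.\<close>
  have inv: "inv\<^bsub>S\<^esub> (rows (e (a, b))) = rows (e (- a, - b))" if "a * b = 0" for a b
    by (rule S.inv_char) (use that in \<open>auto simp: ops one\<close>)
  have x: "\<theta> (rows (e (0, 1))) = rows (e (0, - 1))" and y: "\<theta> (rows (e (1, 0))) = rows (e (- 1, 0))"
    using \<theta> inv[of 0 1] inv[of 1 0] by (simp_all add: torus_inversion_def torus_gens)
  define t where "t u = inv_into UNIV rows (\<theta> (rows u))" for u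
  have ct: "rows (t u) = \<theta> (rows u)" for u
  proof -
    have "\<theta> (rows u) \<in> range rows" using alg_isoD(1)[OF iso ops(4)] rD(7) by simp
    then show ?thesis unfolding t_def by (rule f_inv_into_f)
  qed
  have tops: "t (tor q u v) = tor q (t u) (t v)" "t (u + v) = t u + t v" "t (c \<bullet> u) = c \<bullet> t u" for u v c
    using alg_isoD(2,3)[OF iso ops(4)[of u] ops(4)[of v]] alg_isoD(5)[OF iso ops(4)[of u], of c]
    by (simp_all only: ops ct[symmetric] inj)
  have t1: "t (e (0, 0)) = e (0, 0)" and tx: "t (e (0, 1)) = e (0, - 1)" and ty: "t (e (1, 0)) = e (- 1, 0)"
    using alg_isoD(4)[OF iso] x y by (simp_all only: one ct[symmetric] inj)
  have X: "t (e (0, k)) = e (0, - k)" for k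
    by (rule mult_hom_int_powers[of "tor q" "\<lambda>k. e (0, k)" "\<lambda>k. e (0, - k)" t])
      (simp_all add: tor_assoc tops t1 tx)
  have Y: "t (e (k, 0)) = e (- k, 0)" for k
    by (rule mult_hom_int_powers[of "tor q" "\<lambda>k. e (k, 0)" "\<lambda>k. e (- k, 0)" t])
      (simp_all add: tor_assoc tops t1 ty)
  have te: "t (e z) = th (e z)" for z
  proof (cases z)
    case (Pair a b)
    have "t (e (a, b)) = t (tor q (e (a, 0)) (e (0, b)))" by simp
    also have "\<dots> = e (- a, - b)" unfolding tops X Y by simp
    finally show ?thesis by (simp add: Pair)
  qed
  have "is_lin t" by (rule is_linI) (rule tops)+
  then have "t u = th u" by (rule is_lin_ext[OF _ th_lin te])
  then show ?thesis by (simp only: ct[symmetric])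
qed

end

end

theorem proposition6p6:
  fixes q :: "'a::field"
    and \<alpha> :: "(int \<Rightarrow> 'a) \<Rightarrow> (int \<Rightarrow> 'a)"
    and \<theta> :: "(int \<Rightarrow> int \<Rightarrow> 'a) \<Rightarrow> (int \<Rightarrow> int \<Rightarrow> 'a)"
  assumes "CHAR('a) \<noteq> 2"
    and "q \<noteq> 0"
    and "\<forall>n>0. q ^ n \<noteq> 1"
    and "torus_twist q \<alpha>"
    and "torus_inversion (skew_laurent laurent_poly \<alpha>) \<theta>"
  shows
    "is_basis (T_alg q) (\<lambda>(i :: nat, j :: nat, k :: nat).
        T_gen q X3 [^]\<^bsub>T_alg q\<^esub> i \<otimes>\<^bsub>T_alg q\<^esub> T_gen q X2 [^]\<^bsub>T_alg q\<^esub> j \<otimes>\<^bsub>T_alg q\<^esub> T_gen q X1 [^]\<^bsub>T_alg q\<^esub> k)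
     \<and> T_graded_claim q (\<lambda>g. case g of X1 \<Rightarrow> 0 | X2 \<Rightarrow> 1 | X3 \<Rightarrow> 1) (gr_rels_ii q)
     \<and> T_graded_claim q (\<lambda>g. 1) (gr_rels_iii q)
     \<and> (is_central (T_alg q) (T_p q) \<and> nc_domain (T_mod_p q))
     \<and> (\<exists>\<phi>. \<phi> \<in> alg_iso (fixed_subalg (skew_laurent laurent_poly \<alpha>) \<theta>) (T_mod_p q))"
proof -
  interpret torus_quotient q by unfold_locales (rule assms(2))+
  \<comment> \<open>For the weights 0, 1, 1 the relations with constants \<open>A\<close> and
    \<open>C\<close> are homogeneous, while x2 x3 has weight 2 and x1 weight 0, so only
    \<open>B\<close> is replaced by 0.\<close>
  have ii: "qalg3_weight q (1 - q^2) (inverse q - q) (inverse q - q)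
      (\<lambda>g. case g of X1 \<Rightarrow> 0 | X2 \<Rightarrow> 1 | X3 \<Rightarrow> 1) (1 - q^2) 0 (inverse q - q)"
    by unfold_locales auto
  \<comment> \<open>With all weights 1 the linear right-hand sides have weight 1 and the products on
    the left weight 2, so all three constants are replaced by 0.\<close>
  have iii: "qalg3_weight q (1 - q^2) (inverse q - q) (inverse q - q) (\<lambda>g. 1) 0 0 0"
    by unfold_locales auto
  show ?thesis
  proof (intro conjI)
    show "is_basis (T_alg q) (\<lambda>(i :: nat, j :: nat, k :: nat).
        T_gen q X3 [^]\<^bsub>T_alg q\<^esub> i \<otimes>\<^bsub>T_alg q\<^esub> T_gen q X2 [^]\<^bsub>T_alg q\<^esub> j \<otimes>\<^bsub>T_alg q\<^esub> T_gen q X1 [^]\<^bsub>T_alg q\<^esub> k)"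
      using presented_basis unfolding T_alg_def T_gen_def T_rels_eq .
    show "T_graded_claim q (\<lambda>g. case g of X1 \<Rightarrow> 0 | X2 \<Rightarrow> 1 | X3 \<Rightarrow> 1) (gr_rels_ii q)"
      unfolding gr_rels_ii_eq by (rule T_graded_claim_weight[OF ii])
    show "T_graded_claim q (\<lambda>g. 1) (gr_rels_iii q)"
      unfolding gr_rels_iii_eq by (rule T_graded_claim_weight[OF iii])
    show "\<exists>\<phi>. \<phi> \<in> alg_iso (fixed_subalg (skew_laurent laurent_poly \<alpha>) \<theta>) (T_mod_p q)"
      by (rule fixed_iso[OF rows_iso[OF assms(4)]]) (rule torus_inversion_rows[OF assms(4,5)])
  qed (rule T_p_central T_mod_p_domain)+
qed

end
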